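(* Assume the signal model, standing assumptions and spatial discretization described in the context. Let $T<\infty$, let $u(0,x)$ be smooth, suppose that the strong solution $u$ of the DMZ equation $du=\mathcal L_0u\,dt+\sum_{k=1}^d\mathcal L_ku\,dy_t^k$ and its derivatives in $x$ up to order $4$ are uniformly bounded on ${\bf I}=[-L,L]^d$ for $0\le t\le T$, and let $0<\Delta x<h_0$. Let ${\bf U}(t)$ solve the semi-discrete scheme $d{\bf U}={\bf L}_0{\bf U}\,dt+\sum_{k=1}^d{\bf L}_k{\bf U}\,dy_t^k$ and let $\widetilde{\bf U}(t)$ solve the tensor-train (TT) semi-discrete scheme $$d\widetilde{\bf U}(t)=\widetilde{\bf L}_0\widetilde{\bf U}(t)\,dt+\sum_{k=1}^d\widetilde{\bf L}_k\widetilde{\bf U}(t)\,dy_t^k,$$ where, for the prescribed relative accuracy $\varepsilon$, the TT approximations satisfy (Frobenius norms) $$\|\widetilde{\bf U}(0)-{\bf U}(0)\|_F\le\varepsilon\|{\bf U}(0)\|_F,\quad \|\widetilde{\bf L}_0-{\bf L}_0\|_F\le\varepsilon(\Delta x)^{d/2+2}\|{\bf L}_0\|_F,\quad \|\widetilde{\bf L}_k-{\bf L}_k\|_F\le\varepsilon(\Delta x)^{d/2+1}\|{\bf L}_k\|_F\ (1\le k\le d).$$ Then the grid function $\widetilde{\mathcal E}_{\bf i}(t):={\bf U}_{\bf i}(t)-\widetilde{\bf U}_{\bf i}(t)$ satisfies, for $0\le t\le T$, $$\mathbb E\big(\|\widetilde{\mathcal E}(t)\|^2\big)\le e^{K_0^{\rm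 TT}t}\Big(\varepsilon^2K_1^{\rm TT}\|{\bf U}(0)\|^2+\mathbb E\big(\|\widetilde{\mathcal E}(0)\|^2\big)\Big),$$ where $K_0^{\rm TT},K_1^{\rm TT}>0$ are independent of $\varepsilon$ and $t$.
   Context: Signal model. $$dx_t=f(x_t)dt+G(x_t)dv_t+\rho(x_t)dw_t,\qquad dy_t=h(x_t)dt+dw_t,$$ where $x_t,y_t\in\mathbb R^d$, $f,h:\mathbb R^d\to\mathbb R^d$, $G,\rho$ are matrix-valued functions, $v_t,w_t$ are standard Brownian motions, and $x_t$, $y_t$, ${\bf U}(t)$ are adapted to a filtration $(\mathcal F_t)_{t\ge0}$. The DMZ operators are $$\mathcal L_0u=\tfrac12\sum_{i,j}\frac{\partial^2((GG^\top+\rho\rho^\top)_{ij}u)}{\partial x_i\partial x_j}-\sum_{k=1}^d\frac{\partial(f_ku)}{\partial x_k},\qquad \mathcal L_ku=h_ku-\sum_{i=1}^d\frac{\partial(\rho_{ik}u)}{\partial x_i}.$$ Standing assumptions. (1) $G(x)G(x)^\top$ and $\rho(x)\rho(x)^\top$ are diagonal with nonnegative diagonal entries, and there are constants $\lambda_G,\Lambda_G,\Lambda_\rho>0$ with $\lambda_G|\xi|^2\le\xi^\top G(x)G(x)^\top\xi\le\Lambda_G|\xi|^2$ and $\xi^\top\rho(x)\rho(x)^\top\xi\le\Lambda_\rho|\xi|^2$ for all $x,\xi\in\mathbb R^d$. (2) All entries $\rho_{ij},G_{ij}$ are in $C_b^4$ (four times continuously differentiable with all derivatives up to order four bounded). (3)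 $f,h$ are $C^1$ with bounded derivatives, hence Lipschitz with constants $L_f,L_h$. (4) $|f(x)|^2\le K(1+|x|^2)$ and $|h(x)|<C_h$ for all $x$. Spatial discretization. The domain is restricted to the cube ${\bf I}=[-L,L]^d$; $\Delta x=\frac{2L}{N+1}$. One-dimensional grid points are $-L+r\Delta x$, $r=1,\dots,N$, and midpoints are $-L+r\Delta x$, $r=\frac12,\frac32,\dots,N+\frac12$. $\mathcal X$ is the $d$-fold product of the grid points (indexed by ${\bf i}\in\{1,\dots,N\}^d$), and $\overline{\mathcal X}^{(k)}$ is the product grid with midpoints in the $k$-th direction and grid points in all others. $\overline{\bf C}_1\in\mathbb R^{(N+1)\times N}$ is $\frac1{\Delta x}$ times the matrix with entries $1$ at $(i,i)$, $-1$ at $(i+1,i)$, $1\le i\le N$, and $0$ elsewhere; ${\bf C}_1=\frac1{2\Delta x}\operatorname{tridiag}(-1,0,1)\in\mathbb R^{N\times N}$ (sub-, main, superdiagonal entries $-1,0,1$); thus $-\overline{\bf C}_1^\top\overline{\bf C}_1$ and ${\bf C}_1$ are the discrete Laplace and central difference operators with homogeneous Dirichlet boundary conditions. With ${\bf Id}_m^{(N)}$ the identity on $(\mathbb R^N)^{\otimes m}$, put $\overline{\bf C}_d^{(k)}={\bf Id}^{(N)}_{k-1}\otimes\overline{\bf C}_1\otimes{\bf Id}^{(N)}_{d-k}$, ${\bf C}_d^{(k)}={\bf Id}^{(N)}_{k-1}\otimes{\bf C}_1\otimes{\bf Id}^{(N)}_{d-k}$. For scalar $g$, ${\bf M}_g=\operatorname{diag}(g(\mathcal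 X))$; for $g=A_{kk}$ a diagonal entry of a matrix function $A$, $\overline{\bf M}_{g}=\operatorname{diag}(g(\overline{\mathcal X}^{(k)}))$. Define $${\bf \Delta}_G=-\sum_{i=1}^d(\overline{\bf C}_d^{(i)})^\top\overline{\bf M}_{(GG^\top)_{ii}}\overline{\bf C}_d^{(i)},\quad {\bf \Delta}_\rho=-\sum_{i=1}^d(\overline{\bf C}_d^{(i)})^\top\overline{\bf M}_{(\rho\rho^\top)_{ii}}\overline{\bf C}_d^{(i)},$$ $${\bf C}_d=\sum_{k=1}^d{\bf M}_{f_k}{\bf C}_d^{(k)},\quad {\bf M}_{(0)}={\bf M}_{\operatorname{div}(f)},\quad {\bf M}_{(k)}={\bf M}_{h_k-\nabla\cdot(\rho_{\cdot k})},$$ $${\bf L}_0=\tfrac12({\bf \Delta}_\rho+{\bf \Delta}_G)-{\bf C}_d-{\bf M}_{(0)},\qquad {\bf L}_k={\bf M}_{(k)}-\sum_{i=1}^d{\bf M}_{\rho_{ik}}{\bf C}_d^{(i)}\quad(1\le k\le d).$$ $\widetilde{\bf L}_j$ and $\widetilde{\bf U}(0)$ are tensor-train (low-rank) approximations of ${\bf L}_j$ and ${\bf U}(0)$, of the same sizes. Norm: for a grid function $u$, $\|u\|=\sqrt{(\Delta x)^d\sum_{\bf i}u_{\bf i}^2}$; $\|\cdot\|_F$ is the (unscaled) Frobenius norm. $h_0>0$ is a constant, independent of $\Delta x$, such that for some $c_0>0$ independent of $\Delta x$, all $0<\Delta x\le h_0$, all $k=1,\dots,d$, all $\xi\in\mathbb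 R^{N^d}$ and $g=(\rho\rho^\top)_{kk}$: $\xi^\top\big(-(\overline{\bf C}_d^{(k)})^\top\overline{\bf M}_{g}\overline{\bf C}_d^{(k)}+({\bf C}_d^{(k)})^\top{\bf M}_g{\bf C}_d^{(k)}\big)\xi\le c_0\,\xi^\top\xi$.
   Formalization: The constants are uniform over 0 < ε ≤ ε_0 for an arbitrary prescribed bound ε_0 > 0, on which they may depend; independence of ε over all ε > 0 fails, since adding εc·Id to L_0 makes the error grow exponentially in ε. *)

theory Defs
  imports "HOL-Probability.Probability"
begin

section \<open>Stochastic integrals and stochastic differentials\<close>

definition filtered_prob_space :: "'a measure \<Rightarrow> (real \<Rightarrow> 'a measure) \<Rightarrow> bool" where
  "filtered_prob_space M F \<longleftrightarrow>
     prob_space M \<and> filtration (space M) F \<and> (\<forall>t. subalgebra M (F t))"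

definition adapted_on ::
  "(real \<Rightarrow> 'a measure) \<Rightarrow> real set \<Rightarrow> (real \<Rightarrow> 'a \<Rightarrow> 'b::topological_space) \<Rightarrow> bool" where
  "adapted_on F I X \<longleftrightarrow> (\<forall>t\<in>I. X t \<in> borel_measurable (F t))"

definition brownian_motion ::
  "'a measure \<Rightarrow> (real \<Rightarrow> 'a measure) \<Rightarrow> (real \<Rightarrow> 'a \<Rightarrow> real^'n) \<Rightarrow> bool" where
  "brownian_motion M F W \<longleftrightarrow>
     adapted_on F {0..} W \<and>
     (AE \<omega> in M. W 0 \<omega> = 0) \<and>
     (AE \<omega> in M. continuous_on {0..} (\<lambda>t. W t \<omega>)) \<and>
     (\<forall>s t. 0 \<le> s \<and> s < t \<longrightarrow>
        prob_space.indep_set M (sets (F s))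
          (sets (vimage_algebra (space M) (\<lambda>\<omega>. W t \<omega> - W s \<omega>) borel)) \<and>
        prob_space.indep_vars M (\<lambda>_. borel) (\<lambda>i \<omega>. (W t \<omega> - W s \<omega>) $ i) UNIV \<and>
        (\<forall>i. distributed M lborel (\<lambda>\<omega>. (W t \<omega> - W s \<omega>) $ i) (normal_density 0 (sqrt (t - s)))))"

text \<open>
  A simple process is a finite sum of elementary processes
  \<open>\<xi> * 1\<close> on \<open>(r, s]\<close>, with \<open>\<xi>\<close> bounded and \<open>F r\<close>-measurable; it is stored as the list of
  the triples \<open>(r, s, \<xi>)\<close>.
\<close>

type_synonym 'a simple_process = "(real \<times> real \<times> ('a \<Rightarrow> real)) list"

definition is_simple ::
  "'a measure \<Rightarrow> (real \<Rightarrow> 'a measure) \<Rightarrow> 'a simple_process \<Rightarrow> bool" where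
  "is_simple M F S \<longleftrightarrow>
     (\<forall>(r, s, \<xi>) \<in> set S. 0 \<le> r \<and> r \<le> s \<and> \<xi> \<in> borel_measurable (F r) \<and>
        (\<exists>B. \<forall>\<omega>\<in>space M. \<bar>\<xi> \<omega>\<bar> \<le> B))"

definition simple_value :: "'a simple_process \<Rightarrow> real \<Rightarrow> 'a \<Rightarrow> real" where
  "simple_value S t \<omega> = (\<Sum>(r, s, \<xi>)\<leftarrow>S. \<xi> \<omega> * indicator {r<..s} t)"

definition simple_integral ::
  "'a simple_process \<Rightarrow> (real \<Rightarrow> 'a \<Rightarrow> real) \<Rightarrow> real \<Rightarrow> 'a \<Rightarrow> real" where
  "simple_integral S Y t \<omega> = (\<Sum>(r, s, \<xi>)\<leftarrow>S. \<xi> \<omega> * (Y (min t s) \<omega> - Y (min t r) \<omega>))"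

definition tends_to_0_in_prob :: "'a measure \<Rightarrow> (nat \<Rightarrow> 'a \<Rightarrow> ennreal) \<Rightarrow> bool" where
  "tends_to_0_in_prob M Z \<longleftrightarrow>
     (\<forall>e>0. (\<lambda>n. emeasure M {\<omega>\<in>space M. Z n \<omega> > e}) \<longlonglongrightarrow> 0)"

text \<open>
  \<open>is_stoch_integral M F T Y H I\<close>: on \<open>[0,T]\<close> the process \<open>I\<close> is the stochastic integral of the
  measurable adapted process \<open>H\<close> against \<open>Y\<close>, that is, the limit in probability of the integrals
  of simple processes that converge to \<open>H\<close> in \<open>L\<^sup>2[0,T]\<close> in probability.  This mode of
  convergence of the integrands is the right one for integrators \<open>dY = a dt + dW\<close> with \<open>a\<close>
  bounded and \<open>W\<close> a Brownian motion; only such integrators occur below.  For them the integral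
  equals the sum of the pathwise Lebesgue integral of \<open>a H\<close> and the Ito integral of \<open>H\<close> against
  \<open>W\<close>, whatever the approximating sequence.  The squared distance is an \<open>ennreal\<close> integral, so
  that a non-integrable \<open>H\<close> gives the value infinity and not 0.
\<close>

definition is_stoch_integral ::
  "'a measure \<Rightarrow> (real \<Rightarrow> 'a measure) \<Rightarrow> real \<Rightarrow> (real \<Rightarrow> 'a \<Rightarrow> real) \<Rightarrow>
   (real \<Rightarrow> 'a \<Rightarrow> real) \<Rightarrow> (real \<Rightarrow> 'a \<Rightarrow> real) \<Rightarrow> bool" where
  "is_stoch_integral M F T Y H I \<longleftrightarrow>
     (\<lambda>(t, \<omega>). H t \<omega>) \<in> borel_measurable (restrict_space borel {0..T} \<Otimes>\<^sub>M M) \<and>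
     adapted_on F {0..T} H \<and>
     adapted_on F {0..T} I \<and>
     (AE \<omega> in M. continuous_on {0..T} (\<lambda>t. I t \<omega>)) \<and>
     (\<exists>S :: nat \<Rightarrow> 'a simple_process.
        (\<forall>n. is_simple M F (S n)) \<and>
        tends_to_0_in_prob M
          (\<lambda>n \<omega>. \<integral>\<^sup>+t\<in>{0..T}. ennreal ((simple_value (S n) t \<omega> - H t \<omega>)\<^sup>2) \<partial>lborel) \<and>
        (\<forall>t\<in>{0..T}. tends_to_0_in_prob M
          (\<lambda>n \<omega>. ennreal \<bar>simple_integral (S n) Y t \<omega> - I t \<omega>\<bar>)))"

text \<open>
  \<open>has_stoch_diff M F T X a b Y\<close>: the adapted continuous process \<open>X\<close> satisfies
  \<open>dX = a dt + (\<Sum>j. b j dY j)\<close> on \<open>[0,T]\<close>.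
\<close>

definition has_stoch_diff ::
  "'a measure \<Rightarrow> (real \<Rightarrow> 'a measure) \<Rightarrow> real \<Rightarrow> (real \<Rightarrow> 'a \<Rightarrow> real) \<Rightarrow> (real \<Rightarrow> 'a \<Rightarrow> real) \<Rightarrow>
   ('j::finite \<Rightarrow> real \<Rightarrow> 'a \<Rightarrow> real) \<Rightarrow> ('j \<Rightarrow> real \<Rightarrow> 'a \<Rightarrow> real) \<Rightarrow> bool" where
  "has_stoch_diff M F T X a b Y \<longleftrightarrow>
     adapted_on F {0..T} X \<and>
     (AE \<omega> in M. continuous_on {0..T} (\<lambda>t. X t \<omega>)) \<and>
     (AE \<omega> in M. set_integrable lborel {0..T} (\<lambda>s. a s \<omega>)) \<and>
     (\<exists>I. (\<forall>j. is_stoch_integral M F T (Y j) (b j) (I j)) \<and>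
        (\<forall>t\<in>{0..T}. AE \<omega> in M.
           X t \<omega> = X 0 \<omega> + (LINT s:{0..t}|lborel. a s \<omega>) + (\<Sum>j\<in>UNIV. I j t \<omega>)))"

section \<open>Partial derivatives and smoothness classes\<close>

definition partial_d :: "'d::finite \<Rightarrow> (real^'d \<Rightarrow> real) \<Rightarrow> real^'d \<Rightarrow> real" where
  "partial_d i g x = deriv (\<lambda>s. g (x + s *\<^sub>R axis i 1)) 0"

primrec Ck_on :: "nat \<Rightarrow> (real^'d::finite) set \<Rightarrow> (real^'d \<Rightarrow> real) \<Rightarrow> bool" where
  "Ck_on 0 S g \<longleftrightarrow> continuous_on S g"
| "Ck_on (Suc n) S g \<longleftrightarrow>
     (\<forall>x\<in>S. g differentiable (at x)) \<and> (\<forall>i. Ck_on n S (partial_d i g))"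

text \<open>\<open>derivs_bounded n S B g\<close>: \<open>B\<close> bounds, on \<open>S\<close>, all partial derivatives of orders \<open>0,\<dots>,n\<close>.\<close>

primrec derivs_bounded ::
  "nat \<Rightarrow> (real^'d::finite) set \<Rightarrow> real \<Rightarrow> (real^'d \<Rightarrow> real) \<Rightarrow> bool" where
  "derivs_bounded 0 S B g \<longleftrightarrow> (\<forall>x\<in>S. \<bar>g x\<bar> \<le> B)"
| "derivs_bounded (Suc n) S B g \<longleftrightarrow>
     (\<forall>x\<in>S. \<bar>g x\<bar> \<le> B) \<and> (\<forall>i. derivs_bounded n S B (partial_d i g))"

definition Cb :: "nat \<Rightarrow> (real^'d::finite \<Rightarrow> real) \<Rightarrow> bool" where
  "Cb n g \<longleftrightarrow> Ck_on n UNIV g \<and> (\<exists>B. derivs_bounded n UNIV B g)"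

section \<open>Signal model, standing assumptions and DMZ equation\<close>

abbreviation gram :: "(real^'d \<Rightarrow> real^'m^'d) \<Rightarrow> real^'d \<Rightarrow> real^'d^'d" where
  "gram A \<equiv> (\<lambda>x. A x ** transpose (A x))"

definition signal_model ::
  "'a measure \<Rightarrow> (real \<Rightarrow> 'a measure) \<Rightarrow> real \<Rightarrow>
   (real^'d \<Rightarrow> real^'d) \<Rightarrow> (real^'d \<Rightarrow> real^'d) \<Rightarrow>
   (real^'d \<Rightarrow> real^'m^'d) \<Rightarrow> (real^'d \<Rightarrow> real^'d^'d) \<Rightarrow>
   (real \<Rightarrow> 'a \<Rightarrow> real^'m) \<Rightarrow> (real \<Rightarrow> 'a \<Rightarrow> real^'d) \<Rightarrow>
   (real \<Rightarrow> 'a \<Rightarrow> real^'d) \<Rightarrow> (real \<Rightarrow> 'a \<Rightarrow> real^'d) \<Rightarrow> bool" where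
  "signal_model M F T f h G \<rho> v w x y \<longleftrightarrow>
     filtered_prob_space M F \<and> brownian_motion M F v \<and> brownian_motion M F w \<and>
     (\<forall>i. has_stoch_diff M F T (\<lambda>t \<omega>. x t \<omega> $ i)
        (\<lambda>t \<omega>. f (x t \<omega>) $ i)
        (case_sum (\<lambda>j t \<omega>. G (x t \<omega>) $ i $ j) (\<lambda>j t \<omega>. \<rho> (x t \<omega>) $ i $ j))
        (case_sum (\<lambda>j t \<omega>. v t \<omega> $ j) (\<lambda>j t \<omega>. w t \<omega> $ j))) \<and>
     adapted_on F {0..T} y \<and>
     (AE \<omega> in M. \<forall>t\<in>{0..T}.
        y t \<omega> = y 0 \<omega> + (LINT s:{0..t}|lborel. h (x s \<omega>)) + (w t \<omega> - w 0 \<omega>))"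

definition standing_assumptions ::
  "(real^'d \<Rightarrow> real^'d) \<Rightarrow> (real^'d \<Rightarrow> real^'d) \<Rightarrow>
   (real^'d \<Rightarrow> real^'m^'d) \<Rightarrow> (real^'d \<Rightarrow> real^'d^'d) \<Rightarrow> bool" where
  "standing_assumptions f h G \<rho> \<longleftrightarrow>
     (\<forall>x i j. i \<noteq> j \<longrightarrow> gram G x $ i $ j = 0 \<and> gram \<rho> x $ i $ j = 0) \<and>
     (\<forall>x i. 0 \<le> gram G x $ i $ i \<and> 0 \<le> gram \<rho> x $ i $ i) \<and>
     (\<exists>lG>0. \<exists>LG>0. \<exists>Lrho>0. \<forall>x \<xi>.
        lG * (norm \<xi>)\<^sup>2 \<le> \<xi> \<bullet> (gram G x *v \<xi>) \<and>
        \<xi> \<bullet> (gram G x *v \<xi>) \<le> LG * (norm \<xi>)\<^sup>2 \<and>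
        \<xi> \<bullet> (gram \<rho> x *v \<xi>) \<le> Lrho * (norm \<xi>)\<^sup>2) \<and>
     (\<forall>i j. Cb 4 (\<lambda>x. G x $ i $ j)) \<and> (\<forall>i j. Cb 4 (\<lambda>x. \<rho> x $ i $ j)) \<and>
     (\<forall>g\<in>{f, h}. \<forall>i. Ck_on 1 UNIV (\<lambda>x. g x $ i) \<and>
        (\<forall>k. bounded (range (partial_d k (\<lambda>x. g x $ i))))) \<and>
     (\<exists>K. \<forall>x. (norm (f x))\<^sup>2 \<le> K * (1 + (norm x)\<^sup>2)) \<and>
     (\<exists>Ch. \<forall>x. norm (h x) < Ch)"

definition DMZ_L0 ::
  "(real^'d \<Rightarrow> real^'d) \<Rightarrow> (real^'d \<Rightarrow> real^'m^'d) \<Rightarrow> (real^'d \<Rightarrow> real^'d^'d) \<Rightarrow>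
   (real^'d \<Rightarrow> real) \<Rightarrow> real^'d \<Rightarrow> real" where
  "DMZ_L0 f G \<rho> g x =
     (1/2) * (\<Sum>i\<in>UNIV. \<Sum>j\<in>UNIV.
        partial_d i (partial_d j (\<lambda>z. (gram G z + gram \<rho> z) $ i $ j * g z)) x)
     - (\<Sum>k\<in>UNIV. partial_d k (\<lambda>z. f z $ k * g z) x)"

definition DMZ_L ::
  "(real^'d \<Rightarrow> real^'d) \<Rightarrow> (real^'d \<Rightarrow> real^'d^'d) \<Rightarrow> 'd \<Rightarrow>
   (real^'d \<Rightarrow> real) \<Rightarrow> real^'d \<Rightarrow> real" where
  "DMZ_L h \<rho> k g x = h x $ k * g x - (\<Sum>i\<in>UNIV. partial_d i (\<lambda>z. \<rho> z $ i $ k * g z) x)"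

definition DMZ_strong_solution ::
  "'a measure \<Rightarrow> (real \<Rightarrow> 'a measure) \<Rightarrow> real \<Rightarrow>
   (real^'d \<Rightarrow> real^'d) \<Rightarrow> (real^'d \<Rightarrow> real^'d) \<Rightarrow>
   (real^'d \<Rightarrow> real^'m^'d) \<Rightarrow> (real^'d \<Rightarrow> real^'d^'d) \<Rightarrow>
   (real \<Rightarrow> 'a \<Rightarrow> real^'d) \<Rightarrow> (real^'d \<Rightarrow> real) \<Rightarrow> (real \<Rightarrow> 'a \<Rightarrow> real^'d \<Rightarrow> real) \<Rightarrow> bool" where
  "DMZ_strong_solution M F T f h G \<rho> y u0 u \<longleftrightarrow>
     (AE \<omega> in M. u 0 \<omega> = u0) \<and>
     (AE \<omega> in M. \<forall>t\<in>{0..T}. Ck_on 2 UNIV (u t \<omega>)) \<and>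
     (\<forall>x. has_stoch_diff M F T (\<lambda>t \<omega>. u t \<omega> x)
        (\<lambda>t \<omega>. DMZ_L0 f G \<rho> (u t \<omega>) x)
        (\<lambda>k t \<omega>. DMZ_L h \<rho> k (u t \<omega>) x)
        (\<lambda>k t \<omega>. y t \<omega> $ k))"

section \<open>Spatial discretization\<close>

text \<open>
  The tensor space \<open>(\<real>\<^sup>N)\<^sup>\<otimes>\<^sup>d\<close> is indexed by multi-indices \<open>'d \<Rightarrow> nat\<close>.  Matrices are functions of a
  row and a column index, of which only the entries with indices in the intended finite index
  sets (\<open>grid N\<close> or \<open>midgrid N k\<close>) matter.
\<close>

type_synonym 'i fmat = "'i \<Rightarrow> 'i \<Rightarrow> real"

definition mesh :: "real \<Rightarrow> nat \<Rightarrow> real" where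
  "mesh L N = 2 * L / (real N + 1)"

definition grid :: "nat \<Rightarrow> ('d::finite \<Rightarrow> nat) set" where
  "grid N = {i. \<forall>l. i l \<in> {1..N}}"

definition midgrid :: "nat \<Rightarrow> 'd::finite \<Rightarrow> ('d \<Rightarrow> nat) set" where
  "midgrid N k = {i. i k \<in> {1..N+1} \<and> (\<forall>l. l \<noteq> k \<longrightarrow> i l \<in> {1..N})}"

definition grid_point :: "real \<Rightarrow> nat \<Rightarrow> ('d::finite \<Rightarrow> nat) \<Rightarrow> real^'d" where
  "grid_point L N i = (\<chi> l. - L + real (i l) * mesh L N)"

text \<open>The \<open>r\<close>-th midpoint, \<open>r = 1,\<dots>,N+1\<close>, is \<open>- L + (r - 1/2) * mesh L N\<close>.\<close>

definition mid_point :: "real \<Rightarrow> nat \<Rightarrow> 'd \<Rightarrow> ('d::finite \<Rightarrow> nat) \<Rightarrow> real^'d" where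
  "mid_point L N k i =
     (\<chi> l. - L + (if l = k then real (i l) - 1/2 else real (i l)) * mesh L N)"

definition mmul :: "'i set \<Rightarrow> 'i fmat \<Rightarrow> 'i fmat \<Rightarrow> 'i fmat" where
  "mmul S A B = (\<lambda>i j. \<Sum>r\<in>S. A i r * B r j)"

definition mtrans :: "'i fmat \<Rightarrow> 'i fmat" where
  "mtrans A = (\<lambda>i j. A j i)"

definition mdiag :: "('i \<Rightarrow> real) \<Rightarrow> 'i fmat" where
  "mdiag g = (\<lambda>i j. if i = j then g i else 0)"

definition mvec :: "'i set \<Rightarrow> 'i fmat \<Rightarrow> ('i \<Rightarrow> real) \<Rightarrow> 'i \<Rightarrow> real" where
  "mvec S A u = (\<lambda>i. \<Sum>j\<in>S. A i j * u j)"

definition kron :: "('d::finite \<Rightarrow> nat fmat) \<Rightarrow> ('d \<Rightarrow> nat) fmat" where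
  "kron A = (\<lambda>i j. \<Prod>l\<in>UNIV. A l (i l) (j l))"

definition Cbar1 :: "real \<Rightarrow> nat \<Rightarrow> nat fmat" where
  "Cbar1 L N i j = (1 / mesh L N) * (if i = j then 1 else if i = j + 1 then - 1 else 0)"

definition C1 :: "real \<Rightarrow> nat \<Rightarrow> nat fmat" where
  "C1 L N i j = (1 / (2 * mesh L N)) * (if j = i + 1 then 1 else if i = j + 1 then - 1 else 0)"

definition Cbar :: "real \<Rightarrow> nat \<Rightarrow> 'd::finite \<Rightarrow> ('d \<Rightarrow> nat) fmat" where
  "Cbar L N k = kron (\<lambda>l. if l = k then Cbar1 L N else mdiag (\<lambda>_. 1))"

definition Cdir :: "real \<Rightarrow> nat \<Rightarrow> 'd::finite \<Rightarrow> ('d \<Rightarrow> nat) fmat" where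
  "Cdir L N k = kron (\<lambda>l. if l = k then C1 L N else mdiag (\<lambda>_. 1))"

definition Mgrid :: "real \<Rightarrow> nat \<Rightarrow> (real^'d \<Rightarrow> real) \<Rightarrow> ('d::finite \<Rightarrow> nat) fmat" where
  "Mgrid L N g = mdiag (\<lambda>i. g (grid_point L N i))"

text \<open>\<open>CMbarC L N k g\<close> is \<open>Cbar\<^sup>T Mbar\<^sub>g Cbar\<close> in direction \<open>k\<close>.\<close>

definition CMbarC :: "real \<Rightarrow> nat \<Rightarrow> 'd::finite \<Rightarrow> (real^'d \<Rightarrow> real) \<Rightarrow> ('d \<Rightarrow> nat) fmat" where
  "CMbarC L N k g =
     mmul (midgrid N k) (mtrans (Cbar L N k))
       (mmul (midgrid N k) (mdiag (\<lambda>r. g (mid_point L N k r))) (Cbar L N k))"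

definition CMC :: "real \<Rightarrow> nat \<Rightarrow> 'd::finite \<Rightarrow> (real^'d \<Rightarrow> real) \<Rightarrow> ('d \<Rightarrow> nat) fmat" where
  "CMC L N k g =
     mmul (grid N) (mtrans (Cdir L N k)) (mmul (grid N) (Mgrid L N g) (Cdir L N k))"

definition disc_laplace ::
  "real \<Rightarrow> nat \<Rightarrow> (real^'d \<Rightarrow> real^'m^'d) \<Rightarrow> ('d::finite \<Rightarrow> nat) fmat" where
  "disc_laplace L N A = (\<lambda>i j. - (\<Sum>k\<in>UNIV. CMbarC L N k (\<lambda>x. gram A x $ k $ k) i j))"

definition disc_L0 ::
  "real \<Rightarrow> nat \<Rightarrow> (real^'d \<Rightarrow> real^'d) \<Rightarrow> (real^'d \<Rightarrow> real^'m^'d) \<Rightarrow> (real^'d \<Rightarrow> real^'d^'d) \<Rightarrow>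
   ('d::finite \<Rightarrow> nat) fmat" where
  "disc_L0 L N f G \<rho> = (\<lambda>i j.
     (1/2) * (disc_laplace L N \<rho> i j + disc_laplace L N G i j)
     - (\<Sum>k\<in>UNIV. mmul (grid N) (Mgrid L N (\<lambda>x. f x $ k)) (Cdir L N k) i j)
     - Mgrid L N (\<lambda>x. \<Sum>k\<in>UNIV. partial_d k (\<lambda>z. f z $ k) x) i j)"

definition disc_L ::
  "real \<Rightarrow> nat \<Rightarrow> (real^'d \<Rightarrow> real^'d) \<Rightarrow> (real^'d \<Rightarrow> real^'d^'d) \<Rightarrow> 'd \<Rightarrow>
   ('d::finite \<Rightarrow> nat) fmat" where
  "disc_L L N h \<rho> k = (\<lambda>i j.
     Mgrid L N (\<lambda>x. h x $ k - (\<Sum>i\<in>UNIV. partial_d i (\<lambda>z. \<rho> z $ i $ k) x)) i j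
     - (\<Sum>l\<in>UNIV. mmul (grid N) (Mgrid L N (\<lambda>x. \<rho> x $ l $ k)) (Cdir L N l) i j))"

definition h0_condition :: "real \<Rightarrow> (real^'d::finite \<Rightarrow> real^'d^'d) \<Rightarrow> real \<Rightarrow> bool" where
  "h0_condition L \<rho> h0 \<longleftrightarrow> 0 < h0 \<and>
     (\<exists>c0>0. \<forall>N\<ge>1. mesh L N \<le> h0 \<longrightarrow>
        (\<forall>k. \<forall>\<xi> :: ('d \<Rightarrow> nat) \<Rightarrow> real.
           let g = (\<lambda>x. gram \<rho> x $ k $ k) in
           (\<Sum>i\<in>grid N. \<xi> i * mvec (grid N) (\<lambda>i j. - CMbarC L N k g i j + CMC L N k g i j) \<xi> i)
           \<le> c0 * (\<Sum>i\<in>grid N. (\<xi> i)\<^sup>2)))"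

text \<open>The scheme \<open>dU = A0 U dt + (\<Sum>k. A k U dy\<^sup>k)\<close> on the grid.\<close>

definition semi_discrete_solution ::
  "'a measure \<Rightarrow> (real \<Rightarrow> 'a measure) \<Rightarrow> real \<Rightarrow> nat \<Rightarrow>
   ('d \<Rightarrow> nat) fmat \<Rightarrow> ('d \<Rightarrow> ('d \<Rightarrow> nat) fmat) \<Rightarrow>
   (real \<Rightarrow> 'a \<Rightarrow> real^'d) \<Rightarrow> (real \<Rightarrow> 'a \<Rightarrow> ('d::finite \<Rightarrow> nat) \<Rightarrow> real) \<Rightarrow> bool" where
  "semi_discrete_solution M F T N A0 A y U \<longleftrightarrow>
     (\<forall>i\<in>grid N. has_stoch_diff M F T (\<lambda>t \<omega>. U t \<omega> i)
        (\<lambda>t \<omega>. mvec (grid N) A0 (U t \<omega>) i)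
        (\<lambda>k t \<omega>. mvec (grid N) (A k) (U t \<omega>) i)
        (\<lambda>k t \<omega>. y t \<omega> $ k))"

definition frob_vec :: "nat \<Rightarrow> (('d::finite \<Rightarrow> nat) \<Rightarrow> real) \<Rightarrow> real" where
  "frob_vec N u = sqrt (\<Sum>i\<in>grid N. (u i)\<^sup>2)"

definition frob_mat :: "nat \<Rightarrow> ('d::finite \<Rightarrow> nat) fmat \<Rightarrow> real" where
  "frob_mat N A = sqrt (\<Sum>i\<in>grid N. \<Sum>j\<in>grid N. (A i j)\<^sup>2)"

definition grid_norm :: "real \<Rightarrow> nat \<Rightarrow> (('d::finite \<Rightarrow> nat) \<Rightarrow> real) \<Rightarrow> real" where
  "grid_norm L N u = sqrt (mesh L N ^ CARD('d) * (\<Sum>i\<in>grid N. (u i)\<^sup>2))"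

end

theory Submission
  imports Defs
begin

text \<open>
  The grid is fixed and the initial error is at most \<open>\<epsilon>\<close> times the initial value, so it suffices
  to bound the second moment of the error by a multiple of \<open>\<epsilon>\<^sup>2 \<parallel>U(0)\<parallel>\<^sup>2\<close>; constant factors may be
  lost and Ito's formula is not needed.  The pair \<open>(U - Ut, \<epsilon> U)\<close> solves a linear stochastic
  differential equation with coefficients bounded independently of \<open>\<epsilon>\<close>, because
  \<open>L U - Lt Ut = Lt (U - Ut) + ((L - Lt) / \<epsilon>) (\<epsilon> U)\<close>.  Its second moment is bounded by a
  Gronwall argument after restriction to the decreasing events that the solution has stayed
  bounded; monotone exhaustion by these events then also gives integrability.
\<close>

section \<open>Increments of Brownian motion\<close>

text \<open>Constant factors may be lost because \<open>K0TT\<close> and \<open>K1TT\<close> only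
  have to be independent of \<epsilon> and \<open>t\<close>: they may depend on the grid, on
  \<open>T\<close> and on the cap \<open>eps0\<close>. The whole growth factor is therefore put into
  \<open>K1TT\<close>, evaluated at time \<open>T\<close>. The obstacle is that stochastic integrals
  are given only as limits in probability of simple integrals. Neither an isometry for the limit nor
  finiteness of a second moment is available beforehand, so a Gronwall inequality for the moments
  could be vacuous. What is available is a second-moment bound for finite sums with weights known at
  the left ends of the intervals. It passes to the limit through Fatou's lemma and its reverse once
  the integrands are cut off, and the cut supplies the finite value from which Gronwall's argument
  starts. The second component of the pair carries the factor \<epsilon> so that the defect
  \<open>L - Lt\<close> may be divided by \<epsilon>, while the initial value of the whole pair
  stays of order \<epsilon>.\<close>

lemma borel_measurable_vec_component:
  fixes X :: "'a \<Rightarrow> real^'n"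
  assumes "X \<in> borel_measurable N" shows "(\<lambda>\<omega>. X \<omega> $ i) \<in> borel_measurable N"
  using measurable_compose[OF assms, of "\<lambda>x. x $ i" borel]
  by (simp add: borel_measurable_continuous_onI continuous_intros)

locale filtered_space =
  fixes M :: "'a measure" and F :: "real \<Rightarrow> 'a measure"
  assumes fps: "filtered_prob_space M F"

sublocale filtered_space \<subseteq> prob_space M
  using fps by (simp add: filtered_prob_space_def)

context filtered_space
begin

lemma subalg: "subalgebra M (F t)" and filt: "filtration (space M) F"
  using fps by (auto simp: filtered_prob_space_def)

lemma space_F [simp]: "space (F t) = space M"
  using subalg[of t] by (simp add: subalgebra_def)

lemma F_measurable_M: "X \<in> measurable (F t) N \<Longrightarrow> X \<in> measurable M N"
  using measurable_from_subalg[OF subalg] .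

lemma F_measurable_mono:
  assumes "s \<le> t" "X \<in> measurable (F s) N" shows "X \<in> measurable (F t) N"
proof -
  have "subalgebra (F t) (F s)"
    using filtration.sets_F_mono[OF filt assms(1)] by (simp add: subalgebra_def)
  then show ?thesis using measurable_from_subalg assms(2) by blast
qed

lemma adapted_measurable:
  "adapted_on F I X \<Longrightarrow> t \<in> I \<Longrightarrow> X t \<in> borel_measurable M"
  by (auto simp: adapted_on_def intro: F_measurable_M)

text \<open>Truncation at 1 makes \<open>Z n\<close> real and integrable. Splitting at level
  \<open>e/2\<close> bounds the mean of the truncated variable by \<open>e/2\<close> plus the
  probability of exceeding that level, so it converges in \<open>L1\<close>, and an
  \<open>L1\<close> null sequence has an almost surely null subsequence.\<close>

lemma in_prob_imp_AE_subseq: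
  assumes Z[measurable]: "\<And>n. Z n \<in> borel_measurable M" and lim: "tends_to_0_in_prob M Z"
  shows "\<exists>r::nat \<Rightarrow> nat. strict_mono r \<and> (AE \<omega> in M. (\<lambda>n. Z (r n) \<omega>) \<longlonglongrightarrow> 0)"
proof -
  define u where "u n \<omega> = enn2real (min 1 (Z n \<omega>))" for n \<omega>
  have um[measurable]: "u n \<in> borel_measurable M" for n unfolding u_def by measurable
  have u01: "0 \<le> u n \<omega>" "u n \<omega> \<le> 1" for n \<omega>
    unfolding u_def by (auto intro!: enn2real_leI)
  have ui: "integrable M (u n)" for n
    by (rule integrable_const_bound[where B=1]) (use u01 in auto)
  have "(\<lambda>n. \<integral>\<omega>. norm (u n \<omega>) \<partial>M) \<longlonglongrightarrow> 0"
  proof (rule LIMSEQ_I)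
    fix e :: real assume e: "0 < e"
    define A where "A n = {\<omega>\<in>space M. Z n \<omega> > ennreal (e/2)}" for n
    have Am[measurable]: "A n \<in> sets M" for n unfolding A_def by measurable
    have "(\<lambda>n. emeasure M (A n)) \<longlonglongrightarrow> 0"
      using lim e unfolding tends_to_0_in_prob_def A_def by (simp add: ennreal_zero_less_divide)
    then have "(\<lambda>n. enn2real (emeasure M (A n))) \<longlonglongrightarrow> enn2real 0"
      by (intro tendsto_enn2real) auto
    then have "(\<lambda>n. prob (A n)) \<longlonglongrightarrow> 0" by (simp add: measure_def)
    then obtain n0 where n0: "\<And>n. n \<ge> n0 \<Longrightarrow> prob (A n) < e/2"
      using order_tendstoD(2)[of _ 0 sequentially "e/2"] e unfolding eventually_sequentially by fastforce
    have "norm ((\<integral>\<omega>. norm (u n \<omega>) \<partial>M) - 0) < e" if "n \<ge> n0" for n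
    proof -
      have le: "u n \<omega> \<le> e/2 + indicator (A n) \<omega>" if "\<omega> \<in> space M" for \<omega>
      proof (cases "\<omega> \<in> A n")
        case True then show ?thesis using u01[of n \<omega>] e by simp
      next
        case False
        then have "Z n \<omega> \<le> ennreal (e/2)" using that by (auto simp: A_def)
        then have "min 1 (Z n \<omega>) \<le> ennreal (e/2)" by (simp add: min.coboundedI2)
        then have "u n \<omega> \<le> e/2" unfolding u_def using e by (intro enn2real_leI) auto
        then show ?thesis using False by simp
      qed
      have "(\<integral>\<omega>. norm (u n \<omega>) \<partial>M) = (\<integral>\<omega>. u n \<omega> \<partial>M)" using u01 by simp
      also have "\<dots> \<le> (\<integral>\<omega>. e/2 + indicator (A n) \<omega> \<partial>M)"
        by (rule integral_mono[OF ui]) (use le in \<open>auto intro!: integrable_add integrable_const Bochner_Integration.integrable_add integrable_real_indicator emeasure_finite simp: less_top[symmetric]\<close>)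
      also have "\<dots> = e/2 + prob (A n)"
        by (subst Bochner_Integration.integral_add) (auto simp: prob_space less_top[symmetric])
      also have "\<dots> < e" using n0[OF that] by simp
      finally have "(\<integral>\<omega>. norm (u n \<omega>) \<partial>M) < e" .
      moreover have "0 \<le> (\<integral>\<omega>. norm (u n \<omega>) \<partial>M)" by simp
      ultimately show ?thesis by simp
    qed
    then show "\<exists>no. \<forall>n\<ge>no. norm ((\<integral>\<omega>. norm (u n \<omega>) \<partial>M) - 0) < e" by blast
  qed
  from tendsto_L1_AE_subseq[OF ui this] obtain r :: "nat \<Rightarrow> nat"
    where r: "strict_mono r" and ae: "AE \<omega> in M. (\<lambda>n. u (r n) \<omega>) \<longlonglongrightarrow> 0" by blast
  have "(\<lambda>n. Z (r n) \<omega>) \<longlonglongrightarrow> 0" if "(\<lambda>n. u (r n) \<omega>) \<longlonglongrightarrow> 0" for \<omega>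
  proof -
    have ueq: "ennreal (u n \<omega>) = min 1 (Z n \<omega>)" for n
      unfolding u_def by (rule ennreal_enn2real) (metis ennreal_one_less_top min.cobounded1 order_le_less_trans)
    have "(\<lambda>n. min 1 (Z (r n) \<omega>)) \<longlonglongrightarrow> 0"
      using tendsto_ennrealI[OF that] by (simp add: ueq)
    \<comment> \<open>The truncated values tend to 0, so they are eventually below 1 and the
      truncation is inactive.\<close>
    moreover have "eventually (\<lambda>n. min 1 (Z (r n) \<omega>) = Z (r n) \<omega>) sequentially"
      using order_tendstoD(2)[OF calculation, of 1] by (auto elim!: eventually_mono simp: min_def split: if_splits)
    ultimately show ?thesis using tendsto_cong by fastforce
  qed
  then show ?thesis using r ae by auto
qed

text \<open>The sigma-algebras generated by \<open>X\<close> and by one coordinate of the increment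
  are contained in \<open>F s\<close> and in the sigma-algebra of the whole vector increment, whose
  independence is part of \<open>brownian_motion\<close>.\<close>

lemma indep_increment:
  assumes W: "brownian_motion M F W" and st: "0 \<le> s" "s < t" and X: "X \<in> borel_measurable (F s)"
  shows "indep_var borel (X :: 'a \<Rightarrow> real) borel (\<lambda>\<omega>. (W t \<omega> - W s \<omega>) $ i)"
proof -
  let ?D = "\<lambda>\<omega>. W t \<omega> - W s \<omega>"
  have ind: "indep_set (sets (F s)) (sets (vimage_algebra (space M) ?D borel))"
    using W st by (simp add: brownian_motion_def)
  have Wm[measurable]: "W t \<in> borel_measurable M" "W s \<in> borel_measurable M"
    using W st by (auto simp: brownian_motion_def intro: adapted_measurable)
  have Xm: "X \<in> borel_measurable M" using F_measurable_M[OF X] .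
  have Dv: "?D \<in> measurable (vimage_algebra (space M) ?D borel) borel"
    by (rule measurable_vimage_algebra1) simp
  have Di: "(\<lambda>\<omega>. ?D \<omega> $ i) \<in> measurable (vimage_algebra (space M) ?D borel) borel"
    by (rule borel_measurable_vec_component[OF Dv])
  have 1: "sigma_sets (space M) {X -` A \<inter> space M |A. A \<in> sets borel} \<subseteq> sets (F s)"
    by (rule sets.sigma_sets_subset'[of _ "F s", simplified])
       (use measurable_sets[OF X] sets.top[of "F s"] in auto)
  have 2: "sigma_sets (space M) {(\<lambda>\<omega>. ?D \<omega> $ i) -` A \<inter> space M |A. A \<in> sets borel}
      \<subseteq> sets (vimage_algebra (space M) ?D borel)"
    by (rule sets.sigma_sets_subset'[of _ "vimage_algebra (space M) ?D borel", simplified])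
       (use measurable_sets[OF Di] sets.top[of "vimage_algebra (space M) ?D borel"] in auto)
  have "indep_set (sigma_sets (space M) {X -` A \<inter> space M |A. A \<in> sets borel})
     (sigma_sets (space M) {(\<lambda>\<omega>. ?D \<omega> $ i) -` A \<inter> space M |A. A \<in> sets borel})"
    using ind unfolding indep_set_def
    by (rule indep_sets_mono_sets) (use 1 2 in \<open>auto split: bool.split\<close>)
  then show ?thesis unfolding indep_var_eq
    using Xm borel_measurable_vec_component[of ?D M i] by simp
qed

lemma increment_moments:
  assumes W: "brownian_motion M F W" and st: "0 \<le> s" "s < t"
  shows "expectation (\<lambda>\<omega>. (W t \<omega> - W s \<omega>) $ i) = 0"
    and "integrable M (\<lambda>\<omega>. (W t \<omega> - W s \<omega>) $ i)"
    and "integrable M (\<lambda>\<omega>. ((W t \<omega> - W s \<omega>) $ i)\<^sup>2)"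
    and "expectation (\<lambda>\<omega>. ((W t \<omega> - W s \<omega>) $ i)\<^sup>2) = t - s"
proof -
  let ?D = "\<lambda>\<omega>. (W t \<omega> - W s \<omega>) $ i"
  have D: "distributed M lborel ?D (normal_density 0 (sqrt (t - s)))"
    using W st by (simp add: brownian_motion_def)
  have pos: "0 < sqrt (t - s)" using st by simp
  show e: "expectation ?D = 0" by (rule normal_distributed_expectation[OF pos D])
  have "variance ?D = (sqrt (t - s))\<^sup>2" by (rule normal_distributed_variance[OF pos D])
  then show "expectation (\<lambda>\<omega>. (?D \<omega>)\<^sup>2) = t - s" unfolding e using st by simp
  have g: "integrable lborel (\<lambda>x. normal_density 0 (sqrt (t - s)) x * x ^ k)" for k
    using integrable_normal_moment[of "sqrt (t-s)" 0 k] pos by simp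
  show "integrable M ?D"
    using distributed_integrable[OF D, of "\<lambda>x. x"] g[of 1] by simp
  show "integrable M (\<lambda>\<omega>. (?D \<omega>)\<^sup>2)"
    using distributed_integrable[OF D, of "\<lambda>x. x^2"] g[of 2] by simp
qed

text \<open>The Ito isometry for finite sums, by induction on the number of steps. The sum so far
  times the next weight is known at \<open>p K\<close>, hence independent of the next increment,
  which has mean zero: the cross term vanishes. Nonnegativity of \<open>p K\<close> and
  measurability of the sum are carried along for the induction.\<close>

lemma discrete_isometry:
  fixes W :: "real \<Rightarrow> 'a \<Rightarrow> real^'n" and p :: "nat \<Rightarrow> real"
  assumes W: "brownian_motion M F W" and p0: "0 \<le> p 0" and p: "\<And>j. j < K \<Longrightarrow> p j < p (Suc j)"
    and \<eta>: "\<And>j. j < K \<Longrightarrow> \<eta> j \<in> borel_measurable (F (p j))"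
    and B: "\<And>j \<omega>. j < K \<Longrightarrow> \<omega> \<in> space M \<Longrightarrow> \<bar>\<eta> j \<omega>\<bar> \<le> B j"
  shows "integrable M (\<lambda>\<omega>. (\<Sum>j<K. \<eta> j \<omega> * (W (p (Suc j)) \<omega> $ i - W (p j) \<omega> $ i))\<^sup>2) \<and>
    expectation (\<lambda>\<omega>. (\<Sum>j<K. \<eta> j \<omega> * (W (p (Suc j)) \<omega> $ i - W (p j) \<omega> $ i))\<^sup>2) =
    (\<Sum>j<K. expectation (\<lambda>\<omega>. (\<eta> j \<omega>)\<^sup>2) * (p (Suc j) - p j)) \<and> 0 \<le> p K \<and>
    (\<lambda>\<omega>. \<Sum>j<K. \<eta> j \<omega> * (W (p (Suc j)) \<omega> $ i - W (p j) \<omega> $ i)) \<in> borel_measurable (F (p K))"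
  using p \<eta> B
proof (induction K)
  case 0
  then show ?case using p0 by simp
next
  case (Suc K)
  let ?A = "\<lambda>\<omega>. \<Sum>j<K. \<eta> j \<omega> * (W (p (Suc j)) \<omega> $ i - W (p j) \<omega> $ i)"
  let ?D = "\<lambda>\<omega>. (W (p (Suc K)) \<omega> - W (p K) \<omega>) $ i"
  have IH: "integrable M (\<lambda>\<omega>. (?A \<omega>)\<^sup>2)"
    "expectation (\<lambda>\<omega>. (?A \<omega>)\<^sup>2) = (\<Sum>j<K. expectation (\<lambda>\<omega>. (\<eta> j \<omega>)\<^sup>2) * (p (Suc j) - p j))"
    "0 \<le> p K" "?A \<in> borel_measurable (F (p K))"
    using Suc by auto
  have lt: "p K < p (Suc K)" using Suc by simp
  note mom = increment_moments[OF W IH(3) lt, of i]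
  have eK: "\<eta> K \<in> borel_measurable (F (p K))" using Suc by simp
  have eKb: "\<bar>\<eta> K \<omega>\<bar> \<le> B K" if "\<omega> \<in> space M" for \<omega> using Suc that by simp
  have Am: "?A \<in> borel_measurable M" and eKm[measurable]: "\<eta> K \<in> borel_measurable M"
    using IH(4) eK by (auto intro: F_measurable_M)
  have Ai: "integrable M ?A"
    by (rule square_integrable_imp_integrable[OF Am IH(1)])
  have Aei: "integrable M (\<lambda>\<omega>. ?A \<omega> * \<eta> K \<omega>)"
    by (rule Bochner_Integration.integrable_bound[OF integrable_mult_right[OF Ai, of "B K"]])
       (use Am eKb in \<open>auto simp: abs_mult mult.commute intro!: AE_I2 mult_right_mono order_trans[OF eKb abs_ge_self]\<close>)
  have ei: "integrable M (\<lambda>\<omega>. (\<eta> K \<omega>)\<^sup>2)"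
    by (rule integrable_const_bound[where B="(B K)\<^sup>2"])
       (use eKb in \<open>auto intro!: AE_I2 power_mono simp: abs_le_square_iff[symmetric] intro: order_trans[OF eKb]\<close>)
  have Aem: "(\<lambda>\<omega>. ?A \<omega> * \<eta> K \<omega>) \<in> borel_measurable (F (p K))" using IH(4) eK by measurable
  have e2m: "(\<lambda>\<omega>. (\<eta> K \<omega>)\<^sup>2) \<in> borel_measurable (F (p K))" using eK by measurable
  note i1 = indep_increment[OF W IH(3) lt Aem, of i]
  have c: "integrable M (\<lambda>\<omega>. (?A \<omega> * \<eta> K \<omega>) * ?D \<omega>)"
    "expectation (\<lambda>\<omega>. (?A \<omega> * \<eta> K \<omega>) * ?D \<omega>) = 0"
    using indep_var_integrable[OF i1 Aei mom(2)] indep_var_lebesgue_integral[OF i1 Aei mom(2)] mom(1)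
    by auto
  have i2: "indep_var borel (\<lambda>\<omega>. (\<eta> K \<omega>)\<^sup>2) borel (\<lambda>\<omega>. (?D \<omega>)\<^sup>2)"
    using indep_var_compose[OF indep_increment[OF W IH(3) lt eK, of i], of "\<lambda>x. x\<^sup>2" borel "\<lambda>x. x\<^sup>2" borel]
    by (simp add: comp_def)
  have d: "integrable M (\<lambda>\<omega>. (\<eta> K \<omega>)\<^sup>2 * (?D \<omega>)\<^sup>2)"
    "expectation (\<lambda>\<omega>. (\<eta> K \<omega>)\<^sup>2 * (?D \<omega>)\<^sup>2) = expectation (\<lambda>\<omega>. (\<eta> K \<omega>)\<^sup>2) * (p (Suc K) - p K)"
    using indep_var_integrable[OF i2 ei mom(3)] indep_var_lebesgue_integral[OF i2 ei mom(3)] mom(4)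
    by auto
  have eq: "(\<Sum>j<Suc K. \<eta> j \<omega> * (W (p (Suc j)) \<omega> $ i - W (p j) \<omega> $ i))\<^sup>2 =
     (?A \<omega>)\<^sup>2 + 2 * ((?A \<omega> * \<eta> K \<omega>) * ?D \<omega>) + (\<eta> K \<omega>)\<^sup>2 * (?D \<omega>)\<^sup>2" for \<omega>
    by (simp add: power2_eq_square algebra_simps)
  have "W (p (Suc K)) \<in> borel_measurable (F (p (Suc K)))" "W (p K) \<in> borel_measurable (F (p K))"
    using W IH(3) lt by (auto simp: brownian_motion_def adapted_on_def)
  then have [measurable]: "W (p (Suc K)) \<in> borel_measurable (F (p (Suc K)))"
    "W (p K) \<in> borel_measurable (F (p (Suc K)))" "?A \<in> borel_measurable (F (p (Suc K)))"
    "\<eta> K \<in> borel_measurable (F (p (Suc K)))"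
    using F_measurable_mono[of "p K" "p (Suc K)"] lt eK IH(4) by auto
  have "(\<lambda>\<omega>. ?A \<omega> + \<eta> K \<omega> * (W (p (Suc K)) \<omega> $ i - W (p K) \<omega> $ i)) \<in> borel_measurable (F (p (Suc K)))"
    by (intro borel_measurable_add borel_measurable_times borel_measurable_diff
        borel_measurable_vec_component) fact+
  then show ?case unfolding eq using IH c d lt by simp
qed

end

section \<open>Square-integrable integrators and partitions\<close>

text \<open>This is what the moment estimates use of a driving process. The weight
  \<open>\<eta> j\<close> is known at the left end of its interval, which makes Brownian increments
  orthogonal, while a bounded drift only enlarges \<open>C\<close>. Nonnegative integrals avoid
  integrability side conditions.\<close>

definition L2_integrator ::
  "'a measure \<Rightarrow> (real \<Rightarrow> 'a measure) \<Rightarrow> real \<Rightarrow> (real \<Rightarrow> 'a \<Rightarrow> real) \<Rightarrow> real \<Rightarrow> bool" where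
  "L2_integrator M F T Y C \<longleftrightarrow> 0 \<le> C \<and> adapted_on F {0..T} Y \<and>
     (\<forall>p K \<eta>. p 0 = 0 \<and> (\<forall>j<K. p j < p (Suc j)) \<and> p K \<le> T \<and>
        (\<forall>j<K. \<eta> j \<in> borel_measurable (F (p j)) \<and> (\<exists>B. \<forall>\<omega>\<in>space M. \<bar>\<eta> j \<omega>\<bar> \<le> B)) \<longrightarrow>
        (\<integral>\<^sup>+\<omega>. ennreal ((\<Sum>j<K. \<eta> j \<omega> * (Y (p (Suc j)) \<omega> - Y (p j) \<omega>))\<^sup>2) \<partial>M)
        \<le> ennreal C * (\<integral>\<^sup>+\<omega>. ennreal (\<Sum>j<K. (\<eta> j \<omega>)\<^sup>2 * (p (Suc j) - p j)) \<partial>M))"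

lemma power2_sum_le: "(a + b)\<^sup>2 \<le> 2 * a\<^sup>2 + 2 * (b::real)\<^sup>2"
  using zero_le_power2[of "a - b"] by (simp add: power2_eq_square algebra_simps)

lemma steps_mono:
  fixes p :: "nat \<Rightarrow> real"
  assumes "\<And>j. j < K \<Longrightarrow> p j < p (Suc j)"
  shows "i \<le> j \<Longrightarrow> j \<le> K \<Longrightarrow> p i \<le> p j"
proof (induction j)
  case (Suc j)
  then show ?case using assms[of j] by (cases "i = Suc j") auto
qed simp

text \<open>Cauchy-Schwarz after writing \<open>d j\<close> as
  \<open>sqrt (d j) * sqrt (d j)\<close>. This is the discrete form of the bound of a squared drift
  integral by \<open>C\<^sup>2 * T\<close> times the energy of the integrand.\<close>

lemma weighted_sum_square_le:
  fixes e d r :: "nat \<Rightarrow> real"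
  assumes d: "\<And>j. j < K \<Longrightarrow> 0 \<le> d j" and r: "\<And>j. j < K \<Longrightarrow> \<bar>r j\<bar> \<le> C * d j"
    and T: "(\<Sum>j<K. d j) \<le> T"
  shows "(\<Sum>j<K. e j * r j)\<^sup>2 \<le> C\<^sup>2 * (T * (\<Sum>j<K. (e j)\<^sup>2 * d j))"
proof -
  have "\<bar>\<Sum>j<K. e j * r j\<bar> \<le> (\<Sum>j<K. C * (sqrt (d j) * (\<bar>e j\<bar> * sqrt (d j))))"
  proof (rule order_trans[OF sum_abs sum_mono])
    fix j assume "j \<in> {..<K}"
    then have j: "j < K" by simp
    have "\<bar>e j * r j\<bar> \<le> \<bar>e j\<bar> * (C * d j)"
      unfolding abs_mult by (rule mult_left_mono[OF r[OF j] abs_ge_zero])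
    also have "C * d j = C * (sqrt (d j) * sqrt (d j))" using d[OF j] by simp
    finally show "\<bar>e j * r j\<bar> \<le> C * (sqrt (d j) * (\<bar>e j\<bar> * sqrt (d j)))"
      by (simp only: ac_simps)
  qed
  then have "\<bar>\<Sum>j<K. e j * r j\<bar>\<^sup>2 \<le> (C * (\<Sum>j<K. sqrt (d j) * (\<bar>e j\<bar> * sqrt (d j))))\<^sup>2"
    unfolding sum_distrib_left[symmetric] by (rule power_mono) simp
  also have "\<dots> \<le> C\<^sup>2 * ((\<Sum>j<K. (sqrt (d j))\<^sup>2) * (\<Sum>j<K. (\<bar>e j\<bar> * sqrt (d j))\<^sup>2))"
    unfolding power_mult_distrib[of C] by (rule mult_left_mono[OF Cauchy_Schwarz_ineq_sum]) simp
  also have "(\<Sum>j<K. (sqrt (d j))\<^sup>2) = (\<Sum>j<K. d j)"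
    using d by (intro sum.cong) simp_all
  also have "(\<Sum>j<K. (\<bar>e j\<bar> * sqrt (d j))\<^sup>2) = (\<Sum>j<K. (e j)\<^sup>2 * d j)"
    using d by (intro sum.cong) (simp_all add: power_mult_distrib)
  also have "C\<^sup>2 * ((\<Sum>j<K. d j) * (\<Sum>j<K. (e j)\<^sup>2 * d j)) \<le> C\<^sup>2 * (T * (\<Sum>j<K. (e j)\<^sup>2 * d j))"
    using d T by (intro mult_left_mono mult_right_mono sum_nonneg mult_nonneg_nonneg) simp_all
  finally show ?thesis by simp
qed

text \<open>The sum splits into a Brownian part, whose second moment is the energy by
  \<open>discrete_isometry\<close>, and a drift part, bounded by
  \<open>weighted_sum_square_le\<close>. The inequality
  \<open>(a + b)\<^sup>2 \<le> 2 * a\<^sup>2 + 2 * b\<^sup>2\<close> doubles both contributions 1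
  and \<open>C\<^sup>2 * T\<close>.\<close>

lemma (in filtered_space) L2_integrator_drift_brownian:
  assumes W: "brownian_motion M F W" and Y: "adapted_on F {0..T} Y" and C: "0 \<le> C" and T: "0 \<le> T"
    and A: "AE \<omega> in M. \<forall>s t. 0 \<le> s \<longrightarrow> s \<le> t \<longrightarrow> t \<le> T \<longrightarrow>
              \<bar>(Y t \<omega> - Y s \<omega>) - (W t \<omega> $ i - W s \<omega> $ i)\<bar> \<le> C * (t - s)"
  shows "L2_integrator M F T Y (2 * C\<^sup>2 * T + 2)"
  unfolding L2_integrator_def
proof (intro conjI allI impI)
  show "0 \<le> 2 * C\<^sup>2 * T + 2" using T by simp
  show "adapted_on F {0..T} Y" by fact
next
  fix p :: "nat \<Rightarrow> real" and K :: nat and \<eta> :: "nat \<Rightarrow> 'a \<Rightarrow> real"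
  assume H: "p 0 = 0 \<and> (\<forall>j<K. p j < p (Suc j)) \<and> p K \<le> T \<and>
        (\<forall>j<K. \<eta> j \<in> borel_measurable (F (p j)) \<and> (\<exists>B. \<forall>\<omega>\<in>space M. \<bar>\<eta> j \<omega>\<bar> \<le> B))"
  then have "\<forall>j. \<exists>B. j < K \<longrightarrow> (\<forall>\<omega>\<in>space M. \<bar>\<eta> j \<omega>\<bar> \<le> B)" by blast
  from choice[OF this] obtain B where
    B: "\<And>j \<omega>. j < K \<Longrightarrow> \<omega> \<in> space M \<Longrightarrow> \<bar>\<eta> j \<omega>\<bar> \<le> B j" by blast
  have st: "p j < p (Suc j)" if "j < K" for j using H that by auto
  have mono: "p i \<le> p j" if "i \<le> j" "j \<le> K" for i j using steps_mono[of K p] st that by blast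
  have em: "\<eta> j \<in> borel_measurable (F (p j))" if "j < K" for j using H that by auto
  have em2[measurable]: "\<eta> j \<in> borel_measurable M" if "j < K" for j using F_measurable_M[OF em[OF that]] .
  let ?XW = "\<lambda>\<omega>. \<Sum>j<K. \<eta> j \<omega> * (W (p (Suc j)) \<omega> $ i - W (p j) \<omega> $ i)"
  let ?q = "\<lambda>\<omega>. \<Sum>j<K. (\<eta> j \<omega>)\<^sup>2 * (p (Suc j) - p j)"
  have iso: "integrable M (\<lambda>\<omega>. (?XW \<omega>)\<^sup>2)"
    "expectation (\<lambda>\<omega>. (?XW \<omega>)\<^sup>2) = (\<Sum>j<K. expectation (\<lambda>\<omega>. (\<eta> j \<omega>)\<^sup>2) * (p (Suc j) - p j))"
    using discrete_isometry[of W p K \<eta> B i, OF W _ st em B] H by simp_all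
  have ei: "integrable M (\<lambda>\<omega>. (\<eta> j \<omega>)\<^sup>2)" if "j < K" for j
  proof (rule integrable_const_bound[where B="(B j)\<^sup>2"])
    show "AE \<omega> in M. norm ((\<eta> j \<omega>)\<^sup>2) \<le> (B j)\<^sup>2"
      using power_mono[OF B[OF that] abs_ge_zero, of _ 2] by (intro AE_I2) simp
    show "(\<lambda>\<omega>. (\<eta> j \<omega>)\<^sup>2) \<in> borel_measurable M" using em2[OF that] by measurable
  qed
  have qi: "integrable M ?q" using ei by (intro Bochner_Integration.integrable_sum) auto
  have q0: "0 \<le> ?q \<omega>" for \<omega> using st by (intro sum_nonneg mult_nonneg_nonneg) (auto intro: less_imp_le)
  have qe: "expectation ?q = (\<Sum>j<K. expectation (\<lambda>\<omega>. (\<eta> j \<omega>)\<^sup>2) * (p (Suc j) - p j))"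
    using ei by (subst Bochner_Integration.integral_sum) auto
  have WW: "(\<integral>\<^sup>+\<omega>. ennreal ((?XW \<omega>)\<^sup>2) \<partial>M) = (\<integral>\<^sup>+\<omega>. ennreal (?q \<omega>) \<partial>M)"
    using iso qi q0 qe by (simp add: nn_integral_eq_integral)
  have "AE \<omega> in M. (\<Sum>j<K. \<eta> j \<omega> * (Y (p (Suc j)) \<omega> - Y (p j) \<omega>))\<^sup>2
      \<le> 2 * (?XW \<omega>)\<^sup>2 + 2 * C\<^sup>2 * T * ?q \<omega>"
    using A
  proof eventually_elim
    case (elim \<omega>)
    let ?R = "\<Sum>j<K. \<eta> j \<omega> * ((Y (p (Suc j)) \<omega> - Y (p j) \<omega>) - (W (p (Suc j)) \<omega> $ i - W (p j) \<omega> $ i))"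
    let ?d = "\<lambda>j. p (Suc j) - p j"
    have R: "?R\<^sup>2 \<le> C\<^sup>2 * (T * ?q \<omega>)"
    proof (rule weighted_sum_square_le)
      fix j assume j: "j < K"
      show "0 \<le> ?d j" using st[OF j] by simp
      have "0 \<le> p j" "p j \<le> p (Suc j)" "p (Suc j) \<le> T"
        using H mono[of 0 j] mono[of j "Suc j"] mono[of "Suc j" K] j by simp_all
      then show "\<bar>Y (p (Suc j)) \<omega> - Y (p j) \<omega> - (W (p (Suc j)) \<omega> $ i - W (p j) \<omega> $ i)\<bar> \<le> C * ?d j"
        using elim by blast
    next
      show "(\<Sum>j<K. ?d j) \<le> T" using H sum_lessThan_telescope[of p K] by simp
    qed
    have "(\<Sum>j<K. \<eta> j \<omega> * (Y (p (Suc j)) \<omega> - Y (p j) \<omega>)) = ?XW \<omega> + ?R"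
      unfolding sum.distrib[symmetric] by (intro sum.cong refl) (simp only: distrib_left[symmetric], simp)
    moreover have "(?XW \<omega> + ?R)\<^sup>2 \<le> 2 * (?XW \<omega>)\<^sup>2 + 2 * ?R\<^sup>2"
      by (rule power2_sum_le)
    ultimately show ?case using R by simp
  qed
  then have "(\<integral>\<^sup>+\<omega>. ennreal ((\<Sum>j<K. \<eta> j \<omega> * (Y (p (Suc j)) \<omega> - Y (p j) \<omega>))\<^sup>2) \<partial>M)
     \<le> (\<integral>\<^sup>+\<omega>. ennreal (2 * (?XW \<omega>)\<^sup>2 + 2 * C\<^sup>2 * T * ?q \<omega>) \<partial>M)"
    by (intro nn_integral_mono_AE) (erule eventually_mono, rule ennreal_leI)
  also have "\<dots> = (\<integral>\<^sup>+\<omega>. ennreal 2 * ennreal ((?XW \<omega>)\<^sup>2) + ennreal (2 * C\<^sup>2 * T) * ennreal (?q \<omega>) \<partial>M)"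
    using q0 T by (intro nn_integral_cong) (simp only: ennreal_plus ennreal_mult zero_le_power2
         mult_nonneg_nonneg zero_le_numeral)
  also have "\<dots> = ennreal 2 * (\<integral>\<^sup>+\<omega>. ennreal ((?XW \<omega>)\<^sup>2) \<partial>M)
     + ennreal (2 * C\<^sup>2 * T) * (\<integral>\<^sup>+\<omega>. ennreal (?q \<omega>) \<partial>M)"
    using borel_measurable_integrable[OF iso(1)] borel_measurable_integrable[OF qi]
    by (subst nn_integral_add) (auto simp: nn_integral_cmult)
  also have "\<dots> = ennreal (2 * C\<^sup>2 * T + 2) * (\<integral>\<^sup>+\<omega>. ennreal (?q \<omega>) \<partial>M)"
    unfolding WW using T by (simp add: ennreal_plus distrib_right add.commute)
  finally show "(\<integral>\<^sup>+\<omega>. ennreal ((\<Sum>j<K. \<eta> j \<omega> * (Y (p (Suc j)) \<omega> - Y (p j) \<omega>))\<^sup>2) \<partial>M)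
     \<le> ennreal (2 * C\<^sup>2 * T + 2) * (\<integral>\<^sup>+\<omega>. ennreal (?q \<omega>) \<partial>M)" .
qed

section \<open>Simple processes on partitions that contain their endpoints\<close>

definition partitions :: "real \<Rightarrow> real set \<Rightarrow> (nat \<Rightarrow> real) \<Rightarrow> nat \<Rightarrow> bool" where
  "partitions t D p K \<longleftrightarrow> p 0 = 0 \<and> p K = t \<and> (\<forall>j<K. p j < p (Suc j)) \<and>
     (\<forall>x\<in>D. 0 \<le> x \<longrightarrow> x \<le> t \<longrightarrow> (\<exists>i\<le>K. p i = x))"

text \<open>Sorting the points of \<open>D\<close> in \<open>[0,t]\<close> together with a uniform
  grid of \<open>n\<close> cells gives the nodes. A gap longer than \<open>t / n\<close> would
  contain a point of the uniform grid.\<close>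

lemma partitions_exist:
  assumes t: "0 \<le> t" and D: "finite D" and n: "0 < n"
  shows "\<exists>p K. partitions t D p K \<and> (\<forall>j<K. p (Suc j) - p j \<le> t / real n)"
proof -
  define E where "E = {x\<in>D. 0 \<le> x \<and> x \<le> t} \<union> {0, t} \<union> (\<lambda>j. t * real j / real n) ` {..n}"
  define xs where "xs = sorted_list_of_set E"
  define K where "K = length xs - 1"
  have fE: "finite E" unfolding E_def using D by auto
  have sE: "set xs = E" and srt: "sorted_wrt (<) xs" and ds: "sorted xs"
    unfolding xs_def using fE by auto
  have E: "0 \<in> E" "t \<in> E" "\<And>x. x \<in> E \<Longrightarrow> 0 \<le> x \<and> x \<le> t"
    unfolding E_def using t n by (auto simp: divide_le_eq mult_left_mono)
  have ne: "xs \<noteq> []" using E(1) sE by auto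
  have len: "length xs = Suc K" unfolding K_def using ne by simp
  have idx: "\<exists>i\<le>K. xs ! i = x" if "x \<in> E" for x
    using that sE len by (metis in_set_conv_nth less_Suc_eq_le)
  have inE: "xs ! i \<in> E" if "i \<le> K" for i using that sE len nth_mem[of i xs] by auto
  have step: "xs ! j < xs ! Suc j" if "j < K" for j
    using srt that len by (auto simp: sorted_wrt_iff_nth_less)
  have mono: "xs ! i \<le> xs ! j" if "i \<le> j" "j \<le> K" for i j
    using sorted_nth_mono[OF ds] that len by auto
  have p0: "xs ! 0 = 0"
  proof -
    obtain i where "i \<le> K" "xs ! i = 0" using idx[OF E(1)] by auto
    then show ?thesis using mono[of 0 i] E(3)[OF inE[of 0]] by auto
  qed
  have pK: "xs ! K = t"
  proof -
    obtain i where "i \<le> K" "xs ! i = t" using idx[OF E(2)] by auto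
    then show ?thesis using mono[of i K] E(3)[OF inE[of K]] by auto
  qed
  have mesh: "xs ! Suc j - xs ! j \<le> t / real n" if j: "j < K" for j
  proof (rule ccontr)
    assume c: "\<not> ?thesis"
    have a: "0 \<le> xs ! j" "xs ! Suc j \<le> t" using E(3) inE[of j] inE[of "Suc j"] j by auto
    have tp: "0 < t" using a step[OF j] by simp
    \<comment> \<open>Index of the first uniform grid point strictly to the right of
      \<open>xs ! j\<close>.\<close>
    define m where "m = nat \<lfloor>xs ! j * n / t\<rfloor> + 1"
    have m1: "xs ! j * n / t < real m" "real m \<le> xs ! j * n / t + 1"
      unfolding m_def using a tp by (auto simp: of_nat_nat) linarith+
    have m2: "xs ! j < t * real m / n" "t * real m / n \<le> xs ! j + t / n"
      using m1 tp n by (auto simp: field_simps)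
    then have m3: "t * real m / n < xs ! Suc j" using c by linarith
    then have "t * real m / n \<le> t" using a by simp
    then have "m \<le> n" using tp n by (simp add: field_simps)
    then have "t * real m / n \<in> E" unfolding E_def by auto
    then obtain i where i: "i \<le> K" "xs ! i = t * real m / n" using idx by blast
    then show False
      using m2 m3 mono[of i j] mono[of "Suc j" i] j by (cases "i \<le> j") auto
  qed
  have "partitions t D ((!) xs) K"
    unfolding partitions_def using p0 pK step idx by (auto simp: E_def)
  then show ?thesis using mesh by blast
qed

definition endpoints :: "'a simple_process \<Rightarrow> real set" where
  "endpoints S = (\<Union>(r, s, \<xi>)\<in>set S. {r, s})"

lemma finite_endpoints [simp]: "finite (endpoints S)"
  unfolding endpoints_def by auto

lemma endpoints_Cons: "endpoints ((r, s, \<xi>) # S) = {r, s} \<union> endpoints S"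
  unfolding endpoints_def by auto

lemma partitions_gap:
  assumes P: "partitions t D p K" and j: "j < K" and x: "x \<in> D" "0 \<le> x" "x < p (Suc j)"
  shows "x \<le> p j"
proof -
  have mono: "p a \<le> p b" if "a \<le> b" "b \<le> K" for a b
    using steps_mono[of K p] P that unfolding partitions_def by blast
  have "x \<le> t" using x mono[of "Suc j" K] j P unfolding partitions_def by auto
  then obtain i where "i \<le> K" "p i = x" using P x unfolding partitions_def by auto
  then show ?thesis using mono[of i j] mono[of "Suc j" i] x j by (cases "i \<le> j") auto
qed

lemma partitions_subset: "partitions t B p K \<Longrightarrow> A \<subseteq> B \<Longrightarrow> partitions t A p K"
  unfolding partitions_def by blast

text \<open>After truncation at \<open>t\<close> both ends of \<open>(r, s]\<close> are nodes
  \<open>p a\<close> and \<open>p b\<close>, and the sum telescopes between them. The indicator is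
  evaluated at the right end of each cell because the interval is open on the left: it selects
  exactly the cells with \<open>a \<le> j < b\<close>.\<close>

lemma elementary_integral_partition:
  assumes P: "partitions t {r, s} p K" and rs: "0 \<le> r" "r \<le> s" and t: "0 \<le> t"
  shows "\<xi> * (Y (min t s) - Y (min t r)) =
    (\<Sum>j<K. \<xi> * indicator {r<..s} (p (Suc j)) * (Y (p (Suc j)) - Y (p j)) :: real)"
proof -
  have p: "p 0 = 0" "p K = t" and st: "\<And>j. j < K \<Longrightarrow> p j < p (Suc j)"
    using P unfolding partitions_def by auto
  have mono: "p a \<le> p b" if "a \<le> b" "b \<le> K" for a b
    using steps_mono[of K p] st that by blast
  have smono: "p a < p b \<longleftrightarrow> a < b" if "a \<le> K" "b \<le> K" for a b
    using st[of a] mono[of "Suc a" b] mono[of b a] that by (cases "a < b") auto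
  have "\<exists>i\<le>K. p i = min t x" if "x \<in> {r, s}" for x
  proof (cases "x \<le> t")
    case True
    moreover have "0 \<le> x" using that rs by auto
    ultimately have "\<exists>i\<le>K. p i = x" using P that unfolding partitions_def by blast
    then show ?thesis using True by (simp add: min_def)
  qed (use p(2) in \<open>auto simp: min_def\<close>)
  then obtain a b where a: "a \<le> K" "p a = min t r" and b: "b \<le> K" "p b = min t s" by blast
  have ab: "a \<le> b" using smono[of b a] a b rs by (auto simp: min_def split: if_splits)
  have ind: "indicator {r<..s} (p (Suc j)) = (if j \<in> {a..<b} then 1 else 0 :: real)" if "j < K" for j
  proof -
    have le: "p (Suc j) \<le> t" using mono[of "Suc j" K] that p by simp
    have "r < p (Suc j) \<longleftrightarrow> p a < p (Suc j)" using le a by (auto simp: min_def)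
    moreover have "p (Suc j) \<le> s \<longleftrightarrow> \<not> p b < p (Suc j)" using le b by (auto simp: min_def)
    ultimately show ?thesis using smono[of a "Suc j"] smono[of b "Suc j"] a b that
      by (auto simp: indicator_def)
  qed
  have "(\<Sum>j<K. \<xi> * indicator {r<..s} (p (Suc j)) * (Y (p (Suc j)) - Y (p j)))
      = (\<Sum>j<K. if j \<in> {a..<b} then \<xi> * (Y (p (Suc j)) - Y (p j)) else 0)"
    using ind by (intro sum.cong) auto
  also have "\<dots> = (\<Sum>j\<in>{a..<b}. \<xi> * (Y (p (Suc j)) - Y (p j)))"
    using b by (subst sum.inter_restrict[symmetric]) (auto intro!: sum.cong)
  also have "\<dots> = \<xi> * (Y (p b) - Y (p a))"
    unfolding sum_distrib_left[symmetric] using sum_Suc_diff'[OF ab, of "\<lambda>j. Y (p j)"] by simp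
  finally show ?thesis using a b by simp
qed

lemma simple_integral_partition:
  assumes S: "is_simple M F S" and P: "partitions t (endpoints S) p K" and t: "0 \<le> t"
  shows "simple_integral S Y t \<omega> =
    (\<Sum>j<K. simple_value S (p (Suc j)) \<omega> * (Y (p (Suc j)) \<omega> - Y (p j) \<omega>))"
  using S P
proof (induction S)
  case Nil
  then show ?case by (simp add: simple_integral_def simple_value_def)
next
  case (Cons q S)
  obtain r s \<xi> where q: "q = (r, s, \<xi>)" by (cases q)
  have PS: "partitions t (endpoints S) p K" and Pq: "partitions t {r, s} p K"
    using partitions_subset[OF Cons.prems(2)] by (auto simp: q endpoints_Cons)
  have "is_simple M F S" using Cons.prems(1) by (simp add: is_simple_def)
  note IH = Cons.IH[OF this PS]
  have "\<xi> \<omega> * (Y (min t s) \<omega> - Y (min t r) \<omega>) =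
      (\<Sum>j<K. \<xi> \<omega> * indicator {r<..s} (p (Suc j)) * (Y (p (Suc j)) \<omega> - Y (p j) \<omega>))"
    using Cons.prems(1) t
    by (intro elementary_integral_partition[of t r s p K "\<xi> \<omega>" "\<lambda>t. Y t \<omega>", OF Pq])
       (auto simp: is_simple_def q)
  then show ?case using IH
    by (simp add: q simple_integral_def simple_value_def sum.distrib[symmetric] algebra_simps)
qed

lemma simple_value_partition:
  assumes S: "is_simple M F S" and P: "partitions t (endpoints S) p K" and j: "j < K"
    and u: "p j < u" "u \<le> p (Suc j)"
  shows "simple_value S u \<omega> = simple_value S (p (Suc j)) \<omega>"
proof -
  have "indicator {r<..s} u = (indicator {r<..s} (p (Suc j)) :: real)" if "(r, s, \<xi>) \<in> set S" for r s \<xi>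
  proof -
    have rs: "0 \<le> r" "r \<le> s" "r \<in> endpoints S" "s \<in> endpoints S"
      using S that unfolding is_simple_def endpoints_def by force+
    then show ?thesis
      using partitions_gap[OF P j, of r] partitions_gap[OF P j, of s] u
      by (auto simp: indicator_def)
  qed
  then show ?thesis unfolding simple_value_def
    by (intro arg_cong[where f=sum_list] map_cong) auto
qed

text \<open>Predictability. If \<open>(r, s]\<close> contains the right node, then
  \<open>r < p (Suc j)\<close>, hence \<open>r \<le> p j\<close> because \<open>r\<close> is itself
  a node; so the coefficient is already known at the left node. Otherwise its indicator
  vanishes.\<close>

lemma (in filtered_space) simple_value_measurable_partition:
  assumes S: "is_simple M F S" and P: "partitions t (endpoints S) p K" and j: "j < K"
  shows "simple_value S (p (Suc j)) \<in> borel_measurable (F (p j)) \<and>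
    (\<exists>B. \<forall>\<omega>\<in>space M. \<bar>simple_value S (p (Suc j)) \<omega>\<bar> \<le> B)"
  using S P
proof (induction S)
  case Nil
  then show ?case by (auto simp: simple_value_def)
next
  case (Cons q S)
  obtain r s \<xi> where q: "q = (r, s, \<xi>)" by (cases q)
  have PS: "partitions t (endpoints S) p K"
    using partitions_subset[OF Cons.prems(2)] by (auto simp: q endpoints_Cons)
  have "is_simple M F S" using Cons.prems(1) by (simp add: is_simple_def)
  note Cons.IH[OF this PS]
  then have IH: "simple_value S (p (Suc j)) \<in> borel_measurable (F (p j))"
    "\<exists>B. \<forall>\<omega>\<in>space M. \<bar>simple_value S (p (Suc j)) \<omega>\<bar> \<le> B" by blast+
  from IH(2) obtain B where B: "\<And>\<omega>. \<omega> \<in> space M \<Longrightarrow> \<bar>simple_value S (p (Suc j)) \<omega>\<bar> \<le> B" by blast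
  have x: "0 \<le> r" "\<xi> \<in> borel_measurable (F r)" "\<exists>B. \<forall>\<omega>\<in>space M. \<bar>\<xi> \<omega>\<bar> \<le> B"
    using Cons.prems by (auto simp: is_simple_def q)
  from x(3) obtain B' where B': "\<And>\<omega>. \<omega> \<in> space M \<Longrightarrow> \<bar>\<xi> \<omega>\<bar> \<le> B'" by blast
  have eq: "simple_value (q # S) (p (Suc j)) =
     (\<lambda>\<omega>. \<xi> \<omega> * indicator {r<..s} (p (Suc j)) + simple_value S (p (Suc j)) \<omega>)"
    by (auto simp: simple_value_def q)
  have xm: "(\<lambda>\<omega>. \<xi> \<omega> * indicator {r<..s} (p (Suc j))) \<in> borel_measurable (F (p j))"
  proof (cases "r < p (Suc j)")
    case True
    then have "r \<le> p j"
      using partitions_gap[OF Cons.prems(2) j, of r] x(1) by (auto simp: q endpoints_Cons)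
    then show ?thesis using F_measurable_mono x(2) by (intro borel_measurable_times) auto
  qed (auto simp: indicator_def)
  have "\<bar>simple_value (q # S) (p (Suc j)) \<omega>\<bar> \<le> B' + B" if "\<omega> \<in> space M" for \<omega>
    unfolding eq using B[OF that] B'[OF that] by (auto simp: indicator_def)
  moreover have "simple_value (q # S) (p (Suc j)) \<in> borel_measurable (F (p j))"
    unfolding eq by (rule borel_measurable_add[OF xm IH(1)])
  ultimately show ?case by blast
qed

section \<open>Energy of discretized and cut integrands\<close>

lemma partition_sum_le_integral:
  fixes p :: "nat \<Rightarrow> real" and a :: "nat \<Rightarrow> real" and v H :: "real \<Rightarrow> real"
  assumes p: "p 0 = 0" "p K = t" and st: "\<And>j. j < K \<Longrightarrow> p j < p (Suc j)"
    and v: "\<And>j s. j < K \<Longrightarrow> p j < s \<Longrightarrow> s \<le> p (Suc j) \<Longrightarrow> v s = a j"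
    and [measurable]: "v \<in> borel_measurable borel" "H \<in> borel_measurable borel"
  shows "ennreal (\<Sum>j<K. if b j then (a j)\<^sup>2 * (p (Suc j) - p j) else 0)
    \<le> 2 * (\<integral>\<^sup>+s\<in>{0..t}. ennreal ((v s - H s)\<^sup>2) \<partial>lborel)
      + 2 * (\<integral>\<^sup>+s\<in>{0..t}. (if \<exists>j<K. b j \<and> p j < s \<and> s \<le> p (Suc j) then ennreal ((H s)\<^sup>2) else 0) \<partial>lborel)"
proof -
  let ?A = "\<lambda>j. {p j<..p (Suc j)}"
  let ?P = "\<lambda>s. \<exists>j<K. b j \<and> p j < s \<and> s \<le> p (Suc j)"
  have mono: "p i \<le> p j" if "i \<le> j" "j \<le> K" for i j using steps_mono[of K p] st that by blast
  have uniq: "i = j" if "i < K" "j < K" "s \<in> ?A i" "s \<in> ?A j" for i j s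
    using mono[of "Suc i" j] mono[of "Suc j" i] that by (cases i j rule: linorder_cases) auto
  have "ennreal (\<Sum>j<K. if b j then (a j)\<^sup>2 * (p (Suc j) - p j) else 0)
      = (\<Sum>j<K. ennreal (if b j then (a j)\<^sup>2 * (p (Suc j) - p j) else 0))"
    using st by (intro sum_ennreal[symmetric]) (auto simp: less_imp_le)
  also have "\<dots> = (\<Sum>j<K. \<integral>\<^sup>+s. ennreal (if b j then (a j)\<^sup>2 else 0) * indicator (?A j) s \<partial>lborel)"
    using st by (intro sum.cong refl) (auto simp: nn_integral_cmult_indicator ennreal_mult[symmetric] less_imp_le)
  also have "\<dots> = (\<integral>\<^sup>+s. (\<Sum>j<K. ennreal (if b j then (a j)\<^sup>2 else 0) * indicator (?A j) s) \<partial>lborel)"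
    by (rule nn_integral_sum[symmetric]) measurable
  also have "\<dots> \<le> (\<integral>\<^sup>+s. 2 * (ennreal ((v s - H s)\<^sup>2) * indicator {0..t} s)
      + 2 * ((if ?P s then ennreal ((H s)\<^sup>2) else 0) * indicator {0..t} s) \<partial>lborel)"
  \<comment> \<open>At each \<open>s\<close> at most one cell contributes. There
    \<open>v s = a j\<close>, and \<open>v\<^sup>2 \<le> 2 * (v - H)\<^sup>2 + 2 * H\<^sup>2\<close>
    separates the approximation error from the integrand; the selection \<open>b\<close> is kept
    only in the second term.\<close>
  proof (rule nn_integral_mono)
    fix s
    show "(\<Sum>j<K. ennreal (if b j then (a j)\<^sup>2 else 0) * indicator (?A j) s)
      \<le> 2 * (ennreal ((v s - H s)\<^sup>2) * indicator {0..t} s)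
      + 2 * ((if ?P s then ennreal ((H s)\<^sup>2) else 0) * indicator {0..t} s)"
    proof (cases "?P s")
      case True
      then obtain i where i: "i < K" "b i" "s \<in> ?A i" by auto
      have "(\<Sum>j<K. ennreal (if b j then (a j)\<^sup>2 else 0) * indicator (?A j) s)
          = (\<Sum>j<K. if j = i then ennreal ((a i)\<^sup>2) else 0)"
      proof (intro sum.cong refl)
        fix j assume "j \<in> {..<K}"
        then have "j \<noteq> i \<Longrightarrow> s \<notin> ?A j" using uniq[OF i(1) _ i(3), of j] by blast
        then show "ennreal (if b j then (a j)\<^sup>2 else 0) * indicator (?A j) s
            = (if j = i then ennreal ((a i)\<^sup>2) else 0)"
          using i by (cases "j = i") simp_all
      qed
      also have "\<dots> = ennreal ((a i)\<^sup>2)" using i by simp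
      also have "\<dots> = ennreal ((v s)\<^sup>2)" using v[of i s] i by simp
      also have "\<dots> \<le> ennreal (2 * (v s - H s)\<^sup>2 + 2 * (H s)\<^sup>2)"
        using power2_sum_le[of "v s - H s" "H s"] by (intro ennreal_leI) simp
      also have "\<dots> = 2 * ennreal ((v s - H s)\<^sup>2) + 2 * ennreal ((H s)\<^sup>2)"
        by (simp add: ennreal_plus ennreal_mult)
      finally have "(\<Sum>j<K. ennreal (if b j then (a j)\<^sup>2 else 0) * indicator (?A j) s)
         \<le> 2 * ennreal ((v s - H s)\<^sup>2) + 2 * ennreal ((H s)\<^sup>2)" .
      moreover have "s \<in> {0..t}" using i p mono[of 0 i] mono[of "Suc i" K] by auto
      ultimately show ?thesis using True by simp
    next
      case False
      then have "(\<Sum>j<K. ennreal (if b j then (a j)\<^sup>2 else 0) * indicator (?A j) s) = 0"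
        by (intro sum.neutral) (auto simp: indicator_def)
      then show ?thesis by simp
    qed
  qed
  also have "\<dots> = 2 * (\<integral>\<^sup>+s\<in>{0..t}. ennreal ((v s - H s)\<^sup>2) \<partial>lborel)
      + 2 * (\<integral>\<^sup>+s\<in>{0..t}. (if ?P s then ennreal ((H s)\<^sup>2) else 0) \<partial>lborel)"
    by (subst nn_integral_add, measurable, measurable, subst nn_integral_cmult, measurable,
        subst nn_integral_cmult, measurable)
  finally show ?thesis .
qed

text \<open>A downward closed subset of \<open>[0,t]\<close> is an initial interval, with or without
  its supremum. This supplies the measurability in time of the localizing events along each
  path.\<close>

lemma down_closed_measurable:
  fixes g :: "real \<Rightarrow> bool"
  assumes g: "\<And>s s'. 0 \<le> s \<Longrightarrow> s \<le> s' \<Longrightarrow> s' \<le> t \<Longrightarrow> g s' \<Longrightarrow> g s"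
  shows "{s\<in>{0..t}. g s} \<in> sets borel"
proof -
  let ?G = "{s\<in>{0..t}. g s}"
  define \<tau> where "\<tau> = Sup ?G"
  have bdd: "bdd_above ?G" by (rule bdd_aboveI[of _ t]) auto
  have "?G = {0..\<tau>} \<or> ?G = {0..<\<tau>} \<or> ?G = {}"
  proof (cases "?G = {}")
    case False
    have up: "s \<le> \<tau>" if "s \<in> ?G" for s unfolding \<tau>_def using bdd that by (intro cSup_upper)
    have lo: "s \<in> ?G" if s: "0 \<le> s" "s < \<tau>" for s
    proof -
      obtain s' where "s' \<in> ?G" "s < s'"
        using s less_cSup_iff[OF False bdd, of s] unfolding \<tau>_def by auto
      then show ?thesis using g[of s s'] s by auto
    qed
    show ?thesis
    proof (cases "\<tau> \<in> ?G")
      case True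
      have "?G = {0..\<tau>}"
      proof (intro equalityI subsetI)
        fix s assume "s \<in> {0..\<tau>}"
        then show "s \<in> ?G" using lo[of s] True by (cases "s = \<tau>") auto
      qed (use up in auto)
      then show ?thesis by simp
    next
      case ne: False
      have "?G = {0..<\<tau>}"
      proof (intro equalityI subsetI)
        fix s assume s: "s \<in> ?G"
        then have "s \<noteq> \<tau>" using ne by blast
        then show "s \<in> {0..<\<tau>}" using up[OF s] s by simp
      qed (use lo in auto)
      then show ?thesis by simp
    qed
  qed auto
  then have "?G \<in> {{0..\<tau>}, {0..<\<tau>}, {}}" by blast
  moreover have "{{0..\<tau>}, {0..<\<tau>}, {}} \<subseteq> sets borel" by simp
  ultimately show ?thesis by blast
qed

text \<open>Switching off at nodes instead of at the exact time when \<open>g\<close> fails lets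
  through at most the rest of one cell. The excess lies in an interval of length \<delta>, where the
  integrand is at most \<open>B\<^sup>2\<close>.\<close>

lemma partition_cut_le_integral:
  fixes p :: "nat \<Rightarrow> real" and H :: "real \<Rightarrow> real"
  assumes [measurable]: "H \<in> borel_measurable borel" and p: "p 0 = 0" "p K = t" and st: "\<And>j. j < K \<Longrightarrow> p j < p (Suc j)"
    and mesh: "\<And>j. j < K \<Longrightarrow> p (Suc j) - p j \<le> \<delta>" and \<delta>: "0 \<le> \<delta>"
    and g: "\<And>s s'. 0 \<le> s \<Longrightarrow> s \<le> s' \<Longrightarrow> s' \<le> t \<Longrightarrow> g s' \<Longrightarrow> g s"
    and B: "\<And>s. 0 \<le> s \<Longrightarrow> s \<le> t \<Longrightarrow> \<bar>H s\<bar> \<le> B"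
  shows "(\<integral>\<^sup>+s\<in>{0..t}. (if \<exists>j<K. g (p j) \<and> p j < s \<and> s \<le> p (Suc j) then ennreal ((H s)\<^sup>2) else 0) \<partial>lborel)
    \<le> (\<integral>\<^sup>+s\<in>{0..t}. (if g s then ennreal ((H s)\<^sup>2) else 0) \<partial>lborel) + ennreal (B\<^sup>2 * \<delta>)"
proof -
  let ?P = "\<lambda>s. \<exists>j<K. g (p j) \<and> p j < s \<and> s \<le> p (Suc j)"
  have mono: "p i \<le> p j" if "i \<le> j" "j \<le> K" for i j using steps_mono[of K p] st that by blast
  \<comment> \<open>The time at which \<open>g\<close> fails. If the set is empty, this value is
    arbitrary, but then no node satisfies \<open>g\<close> and \<open>?P\<close> is false
    everywhere.\<close>
  define \<tau> where "\<tau> = Sup {s\<in>{0..t}. g s}"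
  have bdd: "bdd_above {s\<in>{0..t}. g s}" by (rule bdd_aboveI[of _ t]) auto
  have gm: "(\<lambda>s. (if g s then ennreal ((H s)\<^sup>2) else 0) * indicator {0..t} s) \<in> borel_measurable borel"
  proof -
    have [measurable]: "{s\<in>{0..t}. g s} \<in> sets borel" by (rule down_closed_measurable[OF g])
    have "(\<lambda>s. (if g s then ennreal ((H s)\<^sup>2) else 0) * indicator {0..t} s)
        = (\<lambda>s. ennreal ((H s)\<^sup>2) * indicator {s\<in>{0..t}. g s} s)"
      by (auto simp: indicator_def fun_eq_iff)
    also have "\<dots> \<in> borel_measurable borel" by measurable
    finally show ?thesis .
  qed
  have pt: "(if ?P s then ennreal ((H s)\<^sup>2) else 0) * indicator {0..t} s
     \<le> (if g s then ennreal ((H s)\<^sup>2) else 0) * indicator {0..t} s + ennreal (B\<^sup>2) * indicator {\<tau>..\<tau>+\<delta>} s" for s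
  proof (cases "?P s \<and> s \<in> {0..t} \<and> \<not> g s")
    case True
    then obtain j where j: "j < K" "g (p j)" "p j < s" "s \<le> p (Suc j)" and s: "s \<in> {0..t}" "\<not> g s"
      by blast
    have "p j \<in> {s\<in>{0..t}. g s}" using j p mono[of 0 j] mono[of j K] by auto
    then have 1: "p j \<le> \<tau>" unfolding \<tau>_def using bdd by (rule cSup_upper)
    have "s' \<le> s" if "s' \<in> {s\<in>{0..t}. g s}" for s'
      using that g[of s s'] s by fastforce
    then have 2: "\<tau> \<le> s" unfolding \<tau>_def
      using \<open>p j \<in> {s\<in>{0..t}. g s}\<close> by (intro cSup_least) blast+
    have "s \<le> \<tau> + \<delta>" using 1 j mesh[OF j(1)] by simp
    moreover have "(H s)\<^sup>2 \<le> B\<^sup>2" using B[of s] s by (simp add: abs_le_square_iff[symmetric])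
    ultimately show ?thesis using True 2 by (simp add: ennreal_leI)
  qed (auto simp: indicator_def)
  have "(\<integral>\<^sup>+s\<in>{0..t}. (if ?P s then ennreal ((H s)\<^sup>2) else 0) \<partial>lborel)
     \<le> (\<integral>\<^sup>+s. (if g s then ennreal ((H s)\<^sup>2) else 0) * indicator {0..t} s
        + ennreal (B\<^sup>2) * indicator {\<tau>..\<tau>+\<delta>} s \<partial>lborel)"
    by (intro nn_integral_mono pt)
  also have "\<dots> = (\<integral>\<^sup>+s\<in>{0..t}. (if g s then ennreal ((H s)\<^sup>2) else 0) \<partial>lborel)
      + ennreal (B\<^sup>2) * emeasure lborel {\<tau>..\<tau>+\<delta>}"
    using gm by (subst nn_integral_add) (auto simp: nn_integral_cmult_indicator)
  also have "ennreal (B\<^sup>2) * emeasure lborel {\<tau>..\<tau>+\<delta>} = ennreal (B\<^sup>2 * \<delta>)"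
    using \<delta> by (simp add: ennreal_mult)
  finally show ?thesis .
qed


text \<open>The minimum carries the induction: if term \<open>K\<close> is kept, the terms kept
  before it are bounded by the full sum before \<open>K\<close>, and adding \<open>c K\<close> gives
  a partial sum that the condition bounds by \<open>Q\<close>.\<close>

lemma truncated_sum_le:
  fixes c :: "nat \<Rightarrow> real"
  assumes c: "\<And>j. 0 \<le> c j" and Q: "0 \<le> Q"
  shows "(\<Sum>j<K. if b j \<and> (\<Sum>i\<le>j. c i) \<le> Q then c j else 0) \<le> min Q (\<Sum>j<K. c j)"
proof (induction K)
  case 0
  then show ?case using Q by simp
next
  case (Suc K)
  have "(\<Sum>j<K. c j) \<le> (\<Sum>j<Suc K. c j)" using c[of K] by simp
  then show ?case
    using Suc c[of K] by (cases "b K \<and> (\<Sum>i\<le>K. c i) \<le> Q") (auto simp: lessThan_Suc_atMost[symmetric])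
qed

section \<open>Measurability, and almost sure approximation of stochastic integrals\<close>

lemma (in filtered_space) simple_value_joint_measurable:
  assumes "is_simple M F S"
  shows "(\<lambda>(t, \<omega>). simple_value S t \<omega>) \<in> borel_measurable (borel \<Otimes>\<^sub>M M)"
  using assms
proof (induction S)
  case (Cons q S)
  obtain r s \<xi> where q: "q = (r, s, \<xi>)" by (cases q)
  have [measurable]: "\<xi> \<in> borel_measurable M"
    using Cons.prems F_measurable_M by (auto simp: is_simple_def q)
  have "is_simple M F S" using Cons.prems(1) by (simp add: is_simple_def)
  note [measurable] = Cons.IH[OF this]
  have "(\<lambda>(t, \<omega>). simple_value (q # S) t \<omega>) =
     (\<lambda>(t, \<omega>). \<xi> \<omega> * indicator {r<..s} t + simple_value S t \<omega>)"
    by (auto simp: simple_value_def q)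
  then show ?case by simp
next
  case Nil
  have "simple_value [] = (\<lambda>t (\<omega> :: 'a). 0)" by (simp add: simple_value_def fun_eq_iff)
  then show ?case by (simp only: case_prod_beta borel_measurable_const)
qed

lemma (in filtered_space) simple_value_path_measurable:
  assumes S: "is_simple M F S" and \<omega>: "\<omega> \<in> space M"
  shows "(\<lambda>s. simple_value S s \<omega>) \<in> borel_measurable borel"
  using measurable_compose[OF measurable_Pair2'[OF \<omega>] simple_value_joint_measurable[OF S]] by simp

lemma joint_measurable_path:
  fixes H :: "real \<Rightarrow> 'a \<Rightarrow> real"
  assumes H: "(\<lambda>(t, \<omega>). H t \<omega>) \<in> borel_measurable (restrict_space borel {0..T} \<Otimes>\<^sub>M M)"
    and \<omega>: "\<omega> \<in> space M"
  shows "(\<lambda>s. indicator {0..T} s * H s \<omega>) \<in> borel_measurable borel"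
proof -
  have "(\<lambda>s. H s \<omega>) \<in> borel_measurable (restrict_space borel {0..T})"
    using measurable_compose[OF measurable_Pair2'[OF \<omega>] H] by simp
  then show ?thesis by (subst (asm) borel_measurable_restrict_space_iff) (auto simp: mult.commute)
qed

lemma (in filtered_space) simple_integral_measurable:
  assumes "is_simple M F S" and Y: "adapted_on F {0..T} Y" and t: "t \<in> {0..T}"
  shows "simple_integral S Y t \<in> borel_measurable M"
  using assms(1)
proof (induction S)
  case Nil
  have "simple_integral [] Y t = (\<lambda>_. 0)" by (simp add: simple_integral_def fun_eq_iff)
  then show ?case by simp
next
  case (Cons q S)
  obtain r s \<xi> where q: "q = (r, s, \<xi>)" by (cases q)
  have x[measurable]: "\<xi> \<in> borel_measurable M" and rs: "0 \<le> r" "r \<le> s"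
    using Cons.prems F_measurable_M by (auto simp: is_simple_def q)
  have "is_simple M F S" using Cons.prems(1) by (simp add: is_simple_def)
  note [measurable] = Cons.IH[OF this]
  have [measurable]: "Y (min t s) \<in> borel_measurable M" "Y (min t r) \<in> borel_measurable M"
    using adapted_measurable[OF Y] t rs by auto
  have "simple_integral (q # S) Y t =
     (\<lambda>\<omega>. \<xi> \<omega> * (Y (min t s) \<omega> - Y (min t r) \<omega>) + simple_integral S Y t \<omega>)"
    by (auto simp: simple_integral_def q)
  then show ?case by simp
qed

text \<open>Measurability of partial integrals for the sigma-finite restriction of Lebesgue measure
  to \<open>[0,T]\<close>, applied to the joint measurability in
  \<open>is_stoch_integral\<close>.\<close>

lemma (in filtered_space) L2_distance_measurable:
  assumes S: "is_simple M F S"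
    and H: "(\<lambda>(t, \<omega>). H t \<omega>) \<in> borel_measurable (restrict_space borel {0..T} \<Otimes>\<^sub>M M)"
  shows "(\<lambda>\<omega>. \<integral>\<^sup>+t\<in>{0..T}. ennreal ((simple_value S t \<omega> - H t \<omega>)\<^sup>2) \<partial>lborel) \<in> borel_measurable M"
proof -
  let ?L = "restrict_space lborel {0..T}"
  interpret L: sigma_finite_measure ?L
    by (rule sigma_finite_measure_restrict_space) (auto intro: sigma_finite_lborel)
  have sets: "sets (restrict_space borel {0..T} \<Otimes>\<^sub>M M) = sets (?L \<Otimes>\<^sub>M M)"
    by (intro sets_pair_measure_cong) (auto simp: sets_restrict_space)
  have Hm: "(\<lambda>(t, \<omega>). H t \<omega>) \<in> borel_measurable (?L \<Otimes>\<^sub>M M)"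
    using H measurable_cong_sets[OF sets refl] by blast
  have "(\<lambda>x. (fst x, snd x)) \<in> measurable (?L \<Otimes>\<^sub>M M) (borel \<Otimes>\<^sub>M M)"
    by (intro measurable_Pair measurable_compose[OF measurable_fst measurable_restrict_space1]) simp_all
  from measurable_compose[OF this simple_value_joint_measurable[OF S]]
  have Sm: "(\<lambda>(t, \<omega>). simple_value S t \<omega>) \<in> borel_measurable (?L \<Otimes>\<^sub>M M)" by (simp add: case_prod_beta)
  have "(\<lambda>(t, \<omega>). ennreal ((simple_value S t \<omega> - H t \<omega>)\<^sup>2)) \<in> borel_measurable (?L \<Otimes>\<^sub>M M)"
    using Sm Hm unfolding case_prod_beta by measurable
  from measurable_pair_swap[OF this]
  have "(\<lambda>\<omega>. \<integral>\<^sup>+t. ennreal ((simple_value S t \<omega> - H t \<omega>)\<^sup>2) \<partial>?L) \<in> borel_measurable M"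
    by (intro L.borel_measurable_nn_integral) (simp add: case_prod_beta)
  then show ?thesis by (subst (asm) nn_integral_restrict_space) auto
qed

text \<open>Two nested extractions of subsequences, first for the distances of the integrands and
  then for the integrals. The sequence obtained may depend on the fixed time
  \<open>t\<close>.\<close>

lemma (in filtered_space) stoch_integral_AE_approximation:
  assumes I: "is_stoch_integral M F T Y H I" and Y: "adapted_on F {0..T} Y" and t: "t \<in> {0..T}"
  shows "\<exists>S. (\<forall>n. is_simple M F (S n)) \<and>
    (AE \<omega> in M. (\<lambda>n. \<integral>\<^sup>+s\<in>{0..T}. ennreal ((simple_value (S n) s \<omega> - H s \<omega>)\<^sup>2) \<partial>lborel) \<longlonglongrightarrow> 0) \<and>
    (AE \<omega> in M. (\<lambda>n. simple_integral (S n) Y t \<omega>) \<longlonglongrightarrow> I t \<omega>)"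
proof -
  obtain S where S: "\<And>n. is_simple M F (S n)"
    and c1: "tends_to_0_in_prob M
          (\<lambda>n \<omega>. \<integral>\<^sup>+t\<in>{0..T}. ennreal ((simple_value (S n) t \<omega> - H t \<omega>)\<^sup>2) \<partial>lborel)" (is "tends_to_0_in_prob M ?Z")
    and c2: "tends_to_0_in_prob M (\<lambda>n \<omega>. ennreal \<bar>simple_integral (S n) Y t \<omega> - I t \<omega>\<bar>)" (is "tends_to_0_in_prob M ?W")
    and Hm: "(\<lambda>(t, \<omega>). H t \<omega>) \<in> borel_measurable (restrict_space borel {0..T} \<Otimes>\<^sub>M M)"
    and Ia: "adapted_on F {0..T} I"
    using I t unfolding is_stoch_integral_def by blast
  have Zm: "?Z n \<in> borel_measurable M" for n by (rule L2_distance_measurable[OF S Hm])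
  have [measurable]: "simple_integral (S n) Y t \<in> borel_measurable M" "I t \<in> borel_measurable M" for n
    using simple_integral_measurable[OF S Y t] adapted_measurable[OF Ia t] by auto
  obtain r1 :: "nat \<Rightarrow> nat" where r1: "strict_mono r1" "AE \<omega> in M. (\<lambda>n. ?Z (r1 n) \<omega>) \<longlonglongrightarrow> 0"
    using in_prob_imp_AE_subseq[of ?Z, OF Zm c1] by blast
  have "tends_to_0_in_prob M (\<lambda>n. ?W (r1 n))"
    unfolding tends_to_0_in_prob_def
  proof (intro allI impI)
    fix e :: ennreal assume "0 < e"
    then have "(\<lambda>n. emeasure M {\<omega>\<in>space M. ?W n \<omega> > e}) \<longlonglongrightarrow> 0"
      using c2 unfolding tends_to_0_in_prob_def by blast
    from LIMSEQ_subseq_LIMSEQ[OF this r1(1)]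
    show "(\<lambda>n. emeasure M {\<omega>\<in>space M. ?W (r1 n) \<omega> > e}) \<longlonglongrightarrow> 0" by (simp add: comp_def)
  qed
  then obtain r2 :: "nat \<Rightarrow> nat" where r2: "strict_mono r2" "AE \<omega> in M. (\<lambda>n. ?W (r1 (r2 n)) \<omega>) \<longlonglongrightarrow> 0"
    using in_prob_imp_AE_subseq[of "\<lambda>n. ?W (r1 n)"] by auto
  have "AE \<omega> in M. (\<lambda>n. ?Z (r1 (r2 n)) \<omega>) \<longlonglongrightarrow> 0"
    using r1(2)
  proof eventually_elim
    case (elim \<omega>)
    from LIMSEQ_subseq_LIMSEQ[OF this r2(1)] show ?case by (simp add: comp_def)
  qed
  moreover have "AE \<omega> in M. (\<lambda>n. simple_integral (S (r1 (r2 n))) Y t \<omega>) \<longlonglongrightarrow> I t \<omega>"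
    using r2(2)
  proof eventually_elim
    case (elim \<omega>)
    then have "(\<lambda>n. \<bar>simple_integral (S (r1 (r2 n))) Y t \<omega> - I t \<omega>\<bar>) \<longlonglongrightarrow> 0"
      by (subst (asm) ennreal_0[symmetric], subst (asm) tendsto_ennreal_iff) auto
    then show ?case by (simp add: tendsto_rabs_zero_iff LIM_zero_iff)
  qed
  ultimately show ?thesis using S by (intro exI[of _ "\<lambda>n. S (r1 (r2 n))"]) auto
qed

section \<open>Localized second moments of stochastic integrals\<close>

text \<open>
  Localization without stopping times.  The event \<open>g s\<close> decreases in \<open>s\<close>, so on \<open>g t\<close> the
  approximating integrals are unchanged when their integrands are switched off after the first
  partition point at which \<open>g\<close> fails, and also when they are switched off once their energy
  exceeds a bound \<open>Q\<close> that it eventually respects.  The integrands so modified are dominated, so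
  that Fatou's lemma applies in both directions.
\<close>

lemma (in filtered_space) localized_stoch_integral_bound:
  assumes Y: "L2_integrator M F T Y C" and I: "is_stoch_integral M F T Y H I" and t: "t \<in> {0..T}"
    and gm: "\<And>s. 0 \<le> s \<Longrightarrow> s \<le> T \<Longrightarrow> {\<omega>\<in>space M. g s \<omega>} \<in> sets (F s)"
    and g: "\<And>s s' \<omega>. 0 \<le> s \<Longrightarrow> s \<le> s' \<Longrightarrow> s' \<le> T \<Longrightarrow> g s' \<omega> \<Longrightarrow> g s \<omega>"
    and Hc: "AE \<omega> in M. continuous_on {0..T} (\<lambda>s. H s \<omega>)"
    and HR: "AE \<omega> in M. \<forall>s\<in>{0..T}. g s \<omega> \<longrightarrow> \<bar>H s \<omega>\<bar> \<le> R"
  shows "(\<integral>\<^sup>+\<omega>. (if g t \<omega> then ennreal ((I t \<omega>)\<^sup>2) else 0) \<partial>M)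
    \<le> (\<integral>\<^sup>+\<omega>. ennreal (2 * C) * (\<integral>\<^sup>+s\<in>{0..t}. (if g s \<omega> then ennreal ((H s \<omega>)\<^sup>2) else 0) \<partial>lborel) \<partial>M)"
proof -
  have C: "0 \<le> C" and Ya: "adapted_on F {0..T} Y" using Y by (auto simp: L2_integrator_def)
  have t0: "0 \<le> t" "t \<le> T" using t by auto
  obtain S where S: "\<And>n. is_simple M F (S n)"
    and Z: "AE \<omega> in M. (\<lambda>n. \<integral>\<^sup>+s\<in>{0..T}. ennreal ((simple_value (S n) s \<omega> - H s \<omega>)\<^sup>2) \<partial>lborel) \<longlonglongrightarrow> 0"
    and SI: "AE \<omega> in M. (\<lambda>n. simple_integral (S n) Y t \<omega>) \<longlonglongrightarrow> I t \<omega>"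
    using stoch_integral_AE_approximation[OF I Ya t] by blast
  let ?Z = "\<lambda>n \<omega>. \<integral>\<^sup>+s\<in>{0..T}. ennreal ((simple_value (S n) s \<omega> - H s \<omega>)\<^sup>2) \<partial>lborel"
  let ?G = "\<lambda>\<omega>. \<integral>\<^sup>+s\<in>{0..t}. (if g s \<omega> then ennreal ((H s \<omega>)\<^sup>2) else 0) \<partial>lborel"
  have Hm: "(\<lambda>(t, \<omega>). H t \<omega>) \<in> borel_measurable (restrict_space borel {0..T} \<Otimes>\<^sub>M M)"
    using I by (simp add: is_stoch_integral_def)
  note Hp = joint_measurable_path[OF Hm]
  note Sp = simple_value_path_measurable[OF S]
  have "\<exists>p K. partitions t (endpoints (S n)) p K \<and> (\<forall>j<K. p (Suc j) - p j \<le> t / real (Suc n))" for n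
    by (rule partitions_exist) (use t0 in auto)
  then obtain p K where P: "\<And>n. partitions t (endpoints (S n)) (p n) (K n)"
    and mesh: "\<And>n j. j < K n \<Longrightarrow> p n (Suc j) - p n j \<le> t / real (Suc n)" by metis
  have p0: "p n 0 = 0" and pK: "p n (K n) = t" and st: "j < K n \<Longrightarrow> p n j < p n (Suc j)" for n j
    using P[of n] unfolding partitions_def by auto
  have mono: "p n i \<le> p n j" if "i \<le> j" "j \<le> K n" for n i j
    using steps_mono[of "K n" "p n"] st that by blast
  have pin: "0 \<le> p n j" "p n j \<le> t" if "j \<le> K n" for n j
    using mono[of 0 j n] mono[of j "K n" n] that p0 pK by auto
  define \<sigma> where "\<sigma> n j \<omega> = simple_value (S n) (p n (Suc j)) \<omega>" for n j \<omega>
  define d where "d n j = p n (Suc j) - p n j" for n j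
  \<comment> \<open>On \<open>g t\<close> the energy of \<open>S n\<close> is at most
    \<open>2 * ?Z n \<omega> + 2 * (R\<^sup>2 * t)\<close>, and \<open>?Z n \<omega>\<close> is
    eventually below 1/2.\<close>
  define Q where "Q = 2 * (R\<^sup>2 * t) + 1"
  \<comment> \<open>Both switches use only information available at \<open>p n j\<close>: the energy
    sum, including its term of index \<open>j\<close>, involves values known at nodes up to
    \<open>p n j\<close>. Hence the modified weights are still admissible in
    \<open>L2_integrator\<close>.\<close>
  define \<eta> where "\<eta> n j \<omega> = (if g (p n j) \<omega> \<and> (\<Sum>i\<le>j. (\<sigma> n i \<omega>)\<^sup>2 * d n i) \<le> Q then \<sigma> n j \<omega> else 0)" for n j \<omega>
  define X where "X n \<omega> = (\<Sum>j<K n. \<eta> n j \<omega> * (Y (p n (Suc j)) \<omega> - Y (p n j) \<omega>))" for n \<omega>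
  define q where "q n \<omega> = (\<Sum>j<K n. (\<eta> n j \<omega>)\<^sup>2 * d n j)" for n \<omega>
  have d0: "0 \<le> d n j" if "j < K n" for n j using st[OF that] by (simp add: d_def)
  have Q0: "0 \<le> Q" unfolding Q_def using t0 by simp

  have \<sigma>m: "\<sigma> n j \<in> borel_measurable (F (p n j))" if "j < K n" for n j
    using simple_value_measurable_partition[OF S P that] unfolding \<sigma>_def by blast
  have \<eta>m: "\<eta> n j \<in> borel_measurable (F (p n j))" if j: "j < K n" for n j
  proof -
    have s: "\<sigma> n i \<in> borel_measurable (F (p n j))" if "i \<le> j" for i
      using F_measurable_mono[OF mono[of i j n] \<sigma>m[of i n]] that j by auto
    have 1: "(\<lambda>\<omega>. \<Sum>i\<le>j. (\<sigma> n i \<omega>)\<^sup>2 * d n i) \<in> borel_measurable (F (p n j))"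
      using s by (intro borel_measurable_sum borel_measurable_times borel_measurable_power) auto
    have "{\<omega>\<in>space M. (\<Sum>i\<le>j. (\<sigma> n i \<omega>)\<^sup>2 * d n i) \<le> Q} \<in> sets (F (p n j))"
      using borel_measurable_le[OF 1 borel_measurable_const[of Q]] by simp
    moreover have "{\<omega>\<in>space M. g (p n j) \<omega>} \<in> sets (F (p n j))"
      using gm[of "p n j"] pin[of j n] j t0 by auto
    ultimately have "{\<omega>\<in>space (F (p n j)). g (p n j) \<omega> \<and> (\<Sum>i\<le>j. (\<sigma> n i \<omega>)\<^sup>2 * d n i) \<le> Q} \<in> sets (F (p n j))"
      using sets.sets_Collect_conj[of "F (p n j)"] by simp
    then show ?thesis unfolding \<eta>_def using s[of j] by (intro measurable_If) auto
  qed
  have \<eta>M: "\<eta> n j \<in> borel_measurable M" if "j < K n" for n j using F_measurable_M[OF \<eta>m[OF that]] .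
  have \<eta>b: "\<exists>B. \<forall>\<omega>\<in>space M. \<bar>\<eta> n j \<omega>\<bar> \<le> B" if j: "j < K n" for n j
  proof -
    obtain B where B: "\<forall>\<omega>\<in>space M. \<bar>\<sigma> n j \<omega>\<bar> \<le> B"
      using simple_value_measurable_partition[OF S P j] unfolding \<sigma>_def by blast
    have "\<bar>\<eta> n j \<omega>\<bar> \<le> \<bar>\<sigma> n j \<omega>\<bar>" for \<omega> unfolding \<eta>_def by simp
    then show ?thesis using B by (meson order_trans)
  qed
  have YM: "Y (p n j) \<in> borel_measurable M" if "j \<le> K n" for n j
    using adapted_measurable[OF Ya] pin[OF that] t0 by auto
  have Xm[measurable]: "X n \<in> borel_measurable M" for n
    unfolding X_def using \<eta>M YM
    by (intro borel_measurable_sum borel_measurable_times borel_measurable_diff) auto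
  have qm[measurable]: "q n \<in> borel_measurable M" for n
    unfolding q_def using \<eta>M
    by (intro borel_measurable_sum borel_measurable_times borel_measurable_power borel_measurable_const) auto
  have Xq: "(\<integral>\<^sup>+\<omega>. ennreal ((X n \<omega>)\<^sup>2) \<partial>M) \<le> (\<integral>\<^sup>+\<omega>. ennreal C * ennreal (q n \<omega>) \<partial>M)" for n
  proof -
    have "(\<integral>\<^sup>+\<omega>. ennreal ((X n \<omega>)\<^sup>2) \<partial>M) \<le> ennreal C * (\<integral>\<^sup>+\<omega>. ennreal (q n \<omega>) \<partial>M)"
      unfolding X_def q_def d_def using Y[unfolded L2_integrator_def, THEN conjunct2, THEN conjunct2, rule_format,
        of "p n" "K n" "\<eta> n"] p0 pK st \<eta>m \<eta>b t0 by simp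
    then show ?thesis by (simp add: nn_integral_cmult)
  qed

  have qval: "q n \<omega> = (\<Sum>j<K n. if g (p n j) \<omega> \<and> (\<Sum>i\<le>j. (\<sigma> n i \<omega>)\<^sup>2 * d n i) \<le> Q then (\<sigma> n j \<omega>)\<^sup>2 * d n j else 0)" for n \<omega>
    unfolding q_def \<eta>_def by (intro sum.cong) auto
  \<comment> \<open>Extension by 0 beyond the last cell, where \<open>d n j\<close> has no sign, so
    that \<open>truncated_sum_le\<close> applies.\<close>
  define c where "c n \<omega> j = (if j < K n then (\<sigma> n j \<omega>)\<^sup>2 * d n j else 0)" for n \<omega> j
  have c0: "0 \<le> c n \<omega> j" for n \<omega> j unfolding c_def using d0 by simp
  have cs: "(\<Sum>i\<le>j. (\<sigma> n i \<omega>)\<^sup>2 * d n i) = (\<Sum>i\<le>j. c n \<omega> i)" if "j < K n" for n \<omega> j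
    unfolding c_def using that by (intro sum.cong) auto
  have qc: "q n \<omega> = (\<Sum>j<K n. if g (p n j) \<omega> \<and> (\<Sum>i\<le>j. c n \<omega> i) \<le> Q then c n \<omega> j else 0)" for n \<omega>
    unfolding qval by (intro sum.cong refl) (auto simp: cs, auto simp: c_def)
  have qQ: "q n \<omega> \<le> Q" for n \<omega>
    unfolding qc using truncated_sum_le[where c="c n \<omega>" and b="\<lambda>j. g (p n j) \<omega>" and K="K n", OF c0 Q0] by simp
  have qle: "q n \<omega> \<le> (\<Sum>j<K n. if g (p n j) \<omega> then (\<sigma> n j \<omega>)\<^sup>2 * (p n (Suc j) - p n j) else 0)" for n \<omega>
    unfolding qval using d0 by (intro sum_mono) (auto simp: d_def)

  \<comment> \<open>Used twice: with all cells selected, to see that the energy switch is eventually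
    inactive, and with the cells whose left node satisfies \<open>g\<close>, to bound the energy of
    the cut weights.\<close>
  have energy: "ennreal (\<Sum>j<K n. if b j then (\<sigma> n j \<omega>)\<^sup>2 * (p n (Suc j) - p n j) else 0)
      \<le> 2 * ?Z n \<omega> + 2 * (\<integral>\<^sup>+s\<in>{0..t}. (if \<exists>j<K n. b j \<and> p n j < s \<and> s \<le> p n (Suc j) then
          ennreal ((indicator {0..T} s * H s \<omega>)\<^sup>2) else 0) \<partial>lborel)"
    if \<omega>: "\<omega> \<in> space M" for n \<omega> and b :: "nat \<Rightarrow> bool"
  proof -
    have "ennreal (\<Sum>j<K n. if b j then (\<sigma> n j \<omega>)\<^sup>2 * (p n (Suc j) - p n j) else 0)
      \<le> 2 * (\<integral>\<^sup>+s\<in>{0..t}. ennreal ((simple_value (S n) s \<omega> - indicator {0..T} s * H s \<omega>)\<^sup>2) \<partial>lborel)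
        + 2 * (\<integral>\<^sup>+s\<in>{0..t}. (if \<exists>j<K n. b j \<and> p n j < s \<and> s \<le> p n (Suc j) then
          ennreal ((indicator {0..T} s * H s \<omega>)\<^sup>2) else 0) \<partial>lborel)"
    proof (rule partition_sum_le_integral[OF p0 pK st _ Sp[OF \<omega>] Hp[OF \<omega>]])
      fix j s assume "j < K n" "p n j < s" "s \<le> p n (Suc j)"
      then show "simple_value (S n) s \<omega> = \<sigma> n j \<omega>"
        unfolding \<sigma>_def by (rule simple_value_partition[OF S P])
    qed
    also have "(\<integral>\<^sup>+s\<in>{0..t}. ennreal ((simple_value (S n) s \<omega> - indicator {0..T} s * H s \<omega>)\<^sup>2) \<partial>lborel) \<le> ?Z n \<omega>"
      using t0 by (intro nn_integral_mono) (auto simp: indicator_def)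
    finally show ?thesis by (simp add: add_right_mono mult_left_mono)
  qed

  \<comment> \<open>On \<open>g t\<close> both switches are eventually inactive, so
    \<open>X n\<close> coincides with the simple integral and converges to \<open>I t\<close>; off
    \<open>g t\<close> the left side is 0.\<close>
  have lim1: "AE \<omega> in M. (if g t \<omega> then ennreal ((I t \<omega>)\<^sup>2) else 0) \<le> liminf (\<lambda>n. ennreal ((X n \<omega>)\<^sup>2))"
    using Z SI HR AE_space
  proof eventually_elim
    case (elim \<omega>)
    show ?case
    proof (cases "g t \<omega>")
      case True
      have gs: "g s \<omega>" if "0 \<le> s" "s \<le> t" for s using g[of s t \<omega>] that t0 True by auto
      have "eventually (\<lambda>n. ?Z n \<omega> < ennreal (1/2)) sequentially"
      proof (rule order_tendstoD(2)[OF elim(1)])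
        show "0 < ennreal (1/2)" by (subst ennreal_0[symmetric], subst ennreal_less_iff) auto
      qed
      then have "eventually (\<lambda>n. X n \<omega> = simple_integral (S n) Y t \<omega>) sequentially"
      proof eventually_elim
        case (elim n)
        have "ennreal (\<Sum>j<K n. c n \<omega> j) = ennreal (\<Sum>j<K n. if True then (\<sigma> n j \<omega>)\<^sup>2 * (p n (Suc j) - p n j) else 0)"
          unfolding c_def d_def by (intro arg_cong[where f=ennreal] sum.cong) auto
        also have "\<dots> \<le> 2 * ?Z n \<omega> + 2 * (\<integral>\<^sup>+s\<in>{0..t}. (if \<exists>j<K n. True \<and> p n j < s \<and> s \<le> p n (Suc j) then
            ennreal ((indicator {0..T} s * H s \<omega>)\<^sup>2) else 0) \<partial>lborel)"
          by (rule energy) fact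
        also have "\<dots> \<le> 2 * ennreal (1/2) + 2 * (\<integral>\<^sup>+s\<in>{0..t}. ennreal (R\<^sup>2) \<partial>lborel)"
        proof (intro add_mono mult_left_mono nn_integral_mono)
          show "?Z n \<omega> \<le> ennreal (1/2)" using elim by simp
          fix s
          have "(H s \<omega>)\<^sup>2 \<le> R\<^sup>2" if "s \<in> {0..t}"
            using \<open>\<forall>s\<in>{0..T}. g s \<omega> \<longrightarrow> \<bar>H s \<omega>\<bar> \<le> R\<close> gs[of s] that t0 power_mono[of "\<bar>H s \<omega>\<bar>" R 2] by auto
          then show "(if \<exists>j<K n. True \<and> p n j < s \<and> s \<le> p n (Suc j) then
            ennreal ((indicator {0..T} s * H s \<omega>)\<^sup>2) else 0) * indicator {0..t} s \<le> ennreal (R\<^sup>2) * indicator {0..t} s"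
            using t0 by (auto simp: indicator_def intro!: ennreal_leI)
        qed simp_all
        also have "2 * ennreal (1/2) = ennreal 1"
          by (subst ennreal_numeral[symmetric], subst ennreal_mult[symmetric]) auto
        also have "(\<integral>\<^sup>+s\<in>{0..t}. ennreal (R\<^sup>2) \<partial>lborel) = ennreal (R\<^sup>2 * t)"
          using t0 by (simp add: nn_integral_cmult_indicator ennreal_mult)
        also have "ennreal 1 + 2 * ennreal (R\<^sup>2 * t) = ennreal Q"
          unfolding Q_def using t0 by (simp add: ennreal_plus ennreal_mult add.commute)
        finally have sQ: "(\<Sum>j<K n. c n \<omega> j) \<le> Q" using Q0 by (simp add: ennreal_le_iff)
        have "\<eta> n j \<omega> = \<sigma> n j \<omega>" if j: "j < K n" for j
        proof -
          have "(\<Sum>i\<le>j. c n \<omega> i) \<le> (\<Sum>j<K n. c n \<omega> j)"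
            using j c0 by (intro sum_mono2) auto
          then show ?thesis unfolding \<eta>_def cs[OF j] using sQ gs[of "p n j"] pin[of j n] j by simp
        qed
        then show ?case
          unfolding X_def simple_integral_partition[OF S P t0(1), of n Y \<omega>] \<sigma>_def
          by (intro sum.cong) auto
      qed
      then have "(\<lambda>n. X n \<omega>) \<longlonglongrightarrow> I t \<omega>"
        using elim(2) tendsto_cong[of "\<lambda>n. X n \<omega>" "\<lambda>n. simple_integral (S n) Y t \<omega>"] by blast
      then have "(\<lambda>n. ennreal ((X n \<omega>)\<^sup>2)) \<longlonglongrightarrow> ennreal ((I t \<omega>)\<^sup>2)"
        by (intro tendsto_ennrealI tendsto_power)
      from lim_imp_Liminf[OF _ this] show ?thesis using True by simp
    qed simp
  qed

  have lim2: "AE \<omega> in M. limsup (\<lambda>n. ennreal C * ennreal (q n \<omega>)) \<le> ennreal (2 * C) * ?G \<omega>"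
    using Z Hc AE_space
  proof eventually_elim
    case (elim \<omega>)
    have "compact ((\<lambda>s. H s \<omega>) ` {0..T})" by (rule compact_continuous_image[OF elim(2)]) simp
    \<comment> \<open>This bound depends on the path. It only multiplies the mesh and disappears in
      the limit, whereas the uniform bound \<open>R\<close> on the localizing event enters through
      \<open>Q\<close>.\<close>
    then obtain B where B: "\<And>s. 0 \<le> s \<Longrightarrow> s \<le> T \<Longrightarrow> \<bar>H s \<omega>\<bar> \<le> B"
      using compact_imp_bounded bounded_real by (metis atLeastAtMost_iff imageI)
    let ?e = "\<lambda>n. ennreal (B\<^sup>2 * (t / real (Suc n)))"
    have up: "ennreal C * ennreal (q n \<omega>) \<le> ennreal C * (2 * ?Z n \<omega> + 2 * (?G \<omega> + ?e n))" for n
    proof (rule mult_left_mono)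
      have "ennreal (q n \<omega>) \<le> ennreal (\<Sum>j<K n. if g (p n j) \<omega> then (\<sigma> n j \<omega>)\<^sup>2 * (p n (Suc j) - p n j) else 0)"
        using qle by (rule ennreal_leI)
      also have "\<dots> \<le> 2 * ?Z n \<omega> + 2 * (\<integral>\<^sup>+s\<in>{0..t}. (if \<exists>j<K n. g (p n j) \<omega> \<and> p n j < s \<and> s \<le> p n (Suc j) then
          ennreal ((indicator {0..T} s * H s \<omega>)\<^sup>2) else 0) \<partial>lborel)"
        by (rule energy) fact
      also have "(\<integral>\<^sup>+s\<in>{0..t}. (if \<exists>j<K n. g (p n j) \<omega> \<and> p n j < s \<and> s \<le> p n (Suc j) then
          ennreal ((indicator {0..T} s * H s \<omega>)\<^sup>2) else 0) \<partial>lborel)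
        \<le> (\<integral>\<^sup>+s\<in>{0..t}. (if g s \<omega> then ennreal ((indicator {0..T} s * H s \<omega>)\<^sup>2) else 0) \<partial>lborel) + ?e n"
        using B g t0 by (intro partition_cut_le_integral[where g="\<lambda>s. g s \<omega>", OF Hp[OF elim(3)] p0 pK st mesh])
            auto
      also have "(\<integral>\<^sup>+s\<in>{0..t}. (if g s \<omega> then ennreal ((indicator {0..T} s * H s \<omega>)\<^sup>2) else 0) \<partial>lborel) = ?G \<omega>"
        using t0 by (intro nn_integral_cong) (auto simp: indicator_def)
      finally show "ennreal (q n \<omega>) \<le> 2 * ?Z n \<omega> + 2 * (?G \<omega> + ?e n)"
        by (simp add: add_left_mono mult_left_mono)
    qed simp
    have "(\<lambda>n. B\<^sup>2 * (t / real (Suc n))) \<longlonglongrightarrow> B\<^sup>2 * 0"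
      by (intro tendsto_mult tendsto_const LIMSEQ_Suc[OF lim_const_over_n])
    then have "?e \<longlonglongrightarrow> 0" using tendsto_ennrealI[of "\<lambda>n. B\<^sup>2 * (t / real (Suc n))" 0] by simp
    then have "(\<lambda>n. ennreal C * (2 * ?Z n \<omega> + 2 * (?G \<omega> + ?e n))) \<longlonglongrightarrow> ennreal C * (2 * 0 + 2 * (?G \<omega> + 0))"
      by (intro ennreal_tendsto_cmult tendsto_add tendsto_const elim(1)) simp_all
    then have "limsup (\<lambda>n. ennreal C * (2 * ?Z n \<omega> + 2 * (?G \<omega> + ?e n))) = ennreal C * (2 * ?G \<omega>)"
      using lim_imp_Limsup[of sequentially] by simp
    moreover have "limsup (\<lambda>n. ennreal C * ennreal (q n \<omega>)) \<le> limsup (\<lambda>n. ennreal C * (2 * ?Z n \<omega> + 2 * (?G \<omega> + ?e n)))"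
      by (rule Limsup_mono) (use up in simp)
    ultimately show ?case using C by (simp add: ennreal_mult mult_ac)
  qed

  \<comment> \<open>Fatou's lemma for the integrals and the reverse Fatou lemma for the energies,
    joined for each \<open>n\<close> by the bound of \<open>L2_integrator\<close>. The reverse form
    is justified by the constant majorant \<open>C * Q\<close>, which has finite integral over a
    probability space.\<close>
  have "(\<integral>\<^sup>+\<omega>. (if g t \<omega> then ennreal ((I t \<omega>)\<^sup>2) else 0) \<partial>M) \<le> (\<integral>\<^sup>+\<omega>. liminf (\<lambda>n. ennreal ((X n \<omega>)\<^sup>2)) \<partial>M)"
    by (rule nn_integral_mono_AE[OF lim1])
  also have "\<dots> \<le> liminf (\<lambda>n. \<integral>\<^sup>+\<omega>. ennreal ((X n \<omega>)\<^sup>2) \<partial>M)"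
    by (rule nn_integral_liminf) measurable
  also have "\<dots> \<le> liminf (\<lambda>n. \<integral>\<^sup>+\<omega>. ennreal C * ennreal (q n \<omega>) \<partial>M)"
    by (rule Liminf_mono) (use Xq in simp)
  also have "\<dots> \<le> limsup (\<lambda>n. \<integral>\<^sup>+\<omega>. ennreal C * ennreal (q n \<omega>) \<partial>M)"
    by (rule Liminf_le_Limsup) simp
  also have "\<dots> \<le> (\<integral>\<^sup>+\<omega>. limsup (\<lambda>n. ennreal C * ennreal (q n \<omega>)) \<partial>M)"
  proof (rule nn_integral_limsup[where w="\<lambda>_. ennreal (C * Q)"])
    show "AE \<omega> in M. ennreal C * ennreal (q n \<omega>) \<le> ennreal (C * Q)" for n
      using qQ C Q0 by (intro AE_I2) (simp add: ennreal_mult ennreal_leI mult_left_mono)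
    show "(\<integral>\<^sup>+\<omega>. ennreal (C * Q) \<partial>M) < \<infinity>" by (simp add: emeasure_space_1)
  qed measurable
  also have "\<dots> \<le> (\<integral>\<^sup>+\<omega>. ennreal (2 * C) * ?G \<omega> \<partial>M)"
    by (rule nn_integral_mono_AE[OF lim2])
  finally show ?thesis .
qed

section \<open>Localized time integrals and second moments of stochastic differentials\<close>

lemma power2_sum3_le: "(a + b + c)\<^sup>2 \<le> 3 * (a\<^sup>2 + b\<^sup>2 + (c::real)\<^sup>2)"
  using zero_le_power2[of "a - b"] zero_le_power2[of "b - c"] zero_le_power2[of "a - c"]
  by (simp add: power2_eq_square algebra_simps)

lemma set_integral_square_le:
  fixes f :: "real \<Rightarrow> real"
  assumes f: "continuous_on {0..t} f" and t: "0 \<le> t"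
  shows "ennreal ((LINT s:{0..t}|lborel. f s)\<^sup>2) \<le> ennreal t * (\<integral>\<^sup>+s\<in>{0..t}. ennreal ((f s)\<^sup>2) \<partial>lborel)"
proof -
  let ?I = "indicator {0..t} :: real \<Rightarrow> real"
  have m: "(\<lambda>s. ?I s * f s) \<in> borel_measurable lborel"
    using borel_measurable_continuous_on_indicator[OF _ f] by simp
  have sq: "ennreal (x\<^sup>2) = (ennreal \<bar>x\<bar>)\<^sup>2" for x :: real by (simp add: ennreal_power)
  have i: "integrable lborel (\<lambda>s. ?I s * f s)"
    using borel_integrable_atLeastAtMost'[OF f] by (simp add: set_integrable_def)
  have "ennreal ((LINT s:{0..t}|lborel. f s)\<^sup>2) = (ennreal (norm (\<integral>s. ?I s * f s \<partial>lborel)))\<^sup>2"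
    unfolding sq by (simp add: set_lebesgue_integral_def)
  also have "\<dots> \<le> (\<integral>\<^sup>+s. ennreal (norm (?I s * f s)) \<partial>lborel)\<^sup>2"
    by (rule power_mono[OF integral_norm_bound_ennreal[OF i]]) simp
  also have "\<dots> = (\<integral>\<^sup>+s. ennreal (norm (?I s * f s)) * ennreal (?I s) \<partial>lborel)\<^sup>2"
    by (intro arg_cong[where f="\<lambda>x. x\<^sup>2"] nn_integral_cong) (auto simp: indicator_def)
  also have "\<dots> \<le> (\<integral>\<^sup>+s. (ennreal (norm (?I s * f s)))\<^sup>2 \<partial>lborel) * (\<integral>\<^sup>+s. (ennreal (?I s))\<^sup>2 \<partial>lborel)"
    using m by (intro Cauchy_Schwarz_nn_integral) auto
  also have "(\<integral>\<^sup>+s. (ennreal (?I s))\<^sup>2 \<partial>lborel) = (\<integral>\<^sup>+s. indicator {0..t} s \<partial>lborel)"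
    by (intro nn_integral_cong) (auto simp: indicator_def)
  also have "\<dots> = ennreal t" using t by simp
  also have "(\<integral>\<^sup>+s. (ennreal (norm (?I s * f s)))\<^sup>2 \<partial>lborel) = (\<integral>\<^sup>+s\<in>{0..t}. ennreal ((f s)\<^sup>2) \<partial>lborel)"
    by (intro nn_integral_cong) (auto simp: indicator_def sq)
  finally show ?thesis by (simp add: mult.commute)
qed

text \<open>Fatou's lemma for step functions that take the value at the left node of each cell. If
  \<open>g s\<close> holds, it holds at the left node too, and continuity makes the node values tend
  to \<open>\<phi> s\<close>. Left sums involve only deterministic times, at which measurability in
  \<omega> and moment bounds are available.\<close>

lemma integral_le_liminf_left_sums:
  fixes \<phi> :: "real \<Rightarrow> real"
  assumes t: "0 \<le> t" and c: "continuous_on {0..t} \<phi>"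
    and g: "\<And>s s'. 0 \<le> s \<Longrightarrow> s \<le> s' \<Longrightarrow> s' \<le> t \<Longrightarrow> g s' \<Longrightarrow> g s"
  shows "(\<integral>\<^sup>+s\<in>{0..t}. (if g s then ennreal (\<phi> s) else 0) \<partial>lborel)
    \<le> liminf (\<lambda>n. \<Sum>j<Suc n. ennreal (t / real (Suc n)) *
        (if g (t * real j / real (Suc n)) then ennreal (\<phi> (t * real j / real (Suc n))) else 0))"
proof -
  let ?h = "\<lambda>s. if g s then ennreal (\<phi> s) else 0"
  let ?p = "\<lambda>n j. t * real j / real (Suc n)"
  define f where "f n s = (\<Sum>j<Suc n. ?h (?p n j) * indicator {?p n j..<?p n (Suc j)} s)" for n s
  have fm: "f n \<in> borel_measurable lborel" for n unfolding f_def by measurable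
  have pt: "?h s * indicator {0..<t} s \<le> liminf (\<lambda>n. f n s)" for s
  proof (cases "s \<in> {0..<t} \<and> g s")
    case True
    then have s: "0 \<le> s" "s < t" "g s" by auto
    \<comment> \<open>Index of the uniform cell that contains \<open>s\<close>; \<open>r n\<close>
      below is the left node of that cell.\<close>
    define j where "j n = nat \<lfloor>s * real (Suc n) / t\<rfloor>" for n
    define r where "r n = ?p n (j n)" for n
    have j1: "real (j n) \<le> s * real (Suc n) / t" "s * real (Suc n) / t < real (j n) + 1" for n
    proof -
      have "0 \<le> s * real (Suc n) / t" using s by simp
      then show "real (j n) \<le> s * real (Suc n) / t" "s * real (Suc n) / t < real (j n) + 1"
        unfolding j_def by (simp_all add: of_nat_nat)
    qed
    have r1: "r n \<le> s" "s < r n + t / real (Suc n)" "s < ?p n (Suc (j n))" "0 \<le> r n" for n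
    proof -
      obtain m where m: "m = real (Suc n)" "0 < m" by simp
      have "real (j n) * t \<le> s * m" "s * m < (real (j n) + 1) * t"
        using j1[of n] s m by (simp_all only: pos_le_divide_eq pos_divide_less_eq)
      then show "r n \<le> s" "s < r n + t / real (Suc n)" "s < ?p n (Suc (j n))" "0 \<le> r n"
        unfolding r_def m(1)[symmetric] using m(2) s by (auto simp: field_simps)
    qed
    have jn: "j n < Suc n" for n
    proof -
      have "s * real (Suc n) < t * real (Suc n)" using s by (intro mult_strict_right_mono) simp_all
      then have "s * real (Suc n) / t < real (Suc n)" using s by (simp add: pos_divide_less_eq mult.commute)
      then show ?thesis using j1(1)[of n] by linarith
    qed
    have rlim: "r \<longlonglongrightarrow> s"
    proof (rule tendsto_sandwich)
      show "eventually (\<lambda>n. s - t / real (Suc n) \<le> r n) sequentially"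
        using r1(2) by (intro always_eventually allI) (smt (verit))
      show "eventually (\<lambda>n. r n \<le> s) sequentially" using r1(1) by simp
      have "(\<lambda>n. s - t / real (Suc n)) \<longlonglongrightarrow> s - 0"
        by (intro tendsto_diff tendsto_const LIMSEQ_Suc[OF lim_const_over_n])
      then show "(\<lambda>n. s - t / real (Suc n)) \<longlonglongrightarrow> s" by simp
    qed simp
    have "(\<lambda>n. \<phi> (r n)) \<longlonglongrightarrow> \<phi> s"
      using c rlim by (rule continuous_on_tendsto_compose)
        (use s r1 in \<open>auto intro!: always_eventually order_trans[OF r1(1)]\<close>)
    then have lim: "(\<lambda>n. ennreal (\<phi> (r n))) \<longlonglongrightarrow> ennreal (\<phi> s)" by (rule tendsto_ennrealI)
    have "ennreal (\<phi> (r n)) \<le> f n s" for n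
    proof -
      have "g (r n)" using g[of "r n" s] s r1 by auto
      moreover have "s \<in> {?p n (j n)..<?p n (Suc (j n))}" using r1[of n] unfolding r_def by simp
      ultimately have "ennreal (\<phi> (r n)) = ?h (?p n (j n)) * indicator {?p n (j n)..<?p n (Suc (j n))} s"
        unfolding r_def by simp
      also have "\<dots> \<le> f n s"
        unfolding f_def using jn[of n] by (intro member_le_sum) auto
      finally show ?thesis .
    qed
    then have "liminf (\<lambda>n. ennreal (\<phi> (r n))) \<le> liminf (\<lambda>n. f n s)" by (intro Liminf_mono) simp
    moreover have "liminf (\<lambda>n. ennreal (\<phi> (r n))) = ennreal (\<phi> s)"
      by (rule lim_imp_Liminf[OF _ lim]) simp
    ultimately show ?thesis using s by simp
  qed auto
  \<comment> \<open>The end point \<open>t\<close> lies in none of the half-open cells; it is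
    discarded as a null set.\<close>
  have "(\<integral>\<^sup>+s\<in>{0..t}. ?h s \<partial>lborel) = (\<integral>\<^sup>+s\<in>{0..<t}. ?h s \<partial>lborel)"
    using AE_lborel_singleton[of t]
    by (intro nn_integral_cong_AE) (auto elim!: eventually_mono simp: indicator_def)
  also have "\<dots> \<le> (\<integral>\<^sup>+s. liminf (\<lambda>n. f n s) \<partial>lborel)"
    by (intro nn_integral_mono pt)
  also have "\<dots> \<le> liminf (\<lambda>n. \<integral>\<^sup>+s. f n s \<partial>lborel)" by (rule nn_integral_liminf[OF fm])
  also have "(\<lambda>n. \<integral>\<^sup>+s. f n s \<partial>lborel) = (\<lambda>n. \<Sum>j<Suc n. ennreal (t / real (Suc n)) * ?h (?p n j))"
  proof
    fix n
    have "(\<integral>\<^sup>+s. f n s \<partial>lborel) = (\<Sum>j<Suc n. \<integral>\<^sup>+s. ?h (?p n j) * indicator {?p n j..<?p n (Suc j)} s \<partial>lborel)"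
      unfolding f_def by (rule nn_integral_sum) measurable
    also have "\<dots> = (\<Sum>j<Suc n. ennreal (t / real (Suc n)) * ?h (?p n j))"
    proof (intro sum.cong refl)
      fix j
      have "?p n (Suc j) - ?p n j = t / real (Suc n)" by (simp add: add_divide_distrib distrib_left)
      moreover have "?p n j \<le> ?p n (Suc j)" using t by (intro divide_right_mono mult_left_mono) auto
      ultimately have "emeasure lborel {?p n j..<?p n (Suc j)} = ennreal (t / real (Suc n))" by simp
      then show "(\<integral>\<^sup>+s. ?h (?p n j) * indicator {?p n j..<?p n (Suc j)} s \<partial>lborel)
          = ennreal (t / real (Suc n)) * ?h (?p n j)"
        by (subst nn_integral_cmult_indicator) (simp_all add: mult.commute)
    qed
    finally show "(\<integral>\<^sup>+s. f n s \<partial>lborel) = (\<Sum>j<Suc n. ennreal (t / real (Suc n)) * ?h (?p n j))" .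
  qed
  finally show ?thesis .
qed

text \<open>An increasing function dominates its left sums: \<open>1 + x \<le> exp x\<close> bounds
  each term by an increment of \<open>exp (l * s) / l\<close>, and the increments telescope.\<close>

lemma left_sum_exp_le:
  assumes t: "0 \<le> t" and l: "0 < (l::real)"
  shows "(\<Sum>j<Suc n. t / real (Suc n) * exp (l * (t * real j / real (Suc n)))) \<le> exp (l * t) / l"
proof -
  let ?e = "\<lambda>j. exp (l * (t * real j / real (Suc n)))"
  have "t / real (Suc n) * ?e j \<le> (?e (Suc j) - ?e j) / l" for j
  proof -
    have "l * (t * real (Suc j) / real (Suc n)) = l * (t * real j / real (Suc n)) + l * (t / real (Suc n))"
      by (simp add: add_divide_distrib distrib_left)
    then have "?e (Suc j) = ?e j * exp (l * (t / real (Suc n)))" by (simp only: exp_add)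
    moreover have "1 + l * (t / real (Suc n)) \<le> exp (l * (t / real (Suc n)))" by (rule exp_ge_add_one_self)
    ultimately have "?e j * (1 + l * (t / real (Suc n))) \<le> ?e (Suc j)" by simp
    then have "l * (t / real (Suc n) * ?e j) \<le> ?e (Suc j) - ?e j" by (simp add: algebra_simps)
    then show ?thesis using l by (simp add: pos_le_divide_eq mult.commute)
  qed
  then have "(\<Sum>j<Suc n. t / real (Suc n) * ?e j) \<le> (\<Sum>j<Suc n. (?e (Suc j) - ?e j) / l)"
    by (rule sum_mono)
  also have "\<dots> = (?e (Suc n) - ?e 0) / l"
    unfolding sum_divide_distrib[symmetric] by (subst sum_lessThan_telescope) simp
  also have "\<dots> \<le> exp (l * t) / l" using l by (intro divide_right_mono) auto
  finally show ?thesis .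
qed

text \<open>
  The majorant \<open>Gh\<close> is needed because the inner integral is not known to be measurable in \<open>\<omega>\<close>.
\<close>

lemma (in filtered_space) localized_time_integral:
  fixes \<phi> :: "real \<Rightarrow> 'a \<Rightarrow> real"
  assumes t: "0 \<le> t" "t \<le> T" and \<phi>m: "\<And>s. 0 \<le> s \<Longrightarrow> s \<le> T \<Longrightarrow> \<phi> s \<in> borel_measurable M"
    and gm: "\<And>s. 0 \<le> s \<Longrightarrow> s \<le> T \<Longrightarrow> {\<omega>\<in>space M. g s \<omega>} \<in> sets M"
    and g: "\<And>s s' \<omega>. 0 \<le> s \<Longrightarrow> s \<le> s' \<Longrightarrow> s' \<le> T \<Longrightarrow> g s' \<omega> \<Longrightarrow> g s \<omega>"
    and c: "AE \<omega> in M. continuous_on {0..T} (\<lambda>s. \<phi> s \<omega>)"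
    and bound: "\<And>s. 0 \<le> s \<Longrightarrow> s \<le> T \<Longrightarrow>
        (\<integral>\<^sup>+\<omega>. (if g s \<omega> then ennreal (\<phi> s \<omega>) else 0) \<partial>M) \<le> ennreal (m * exp (l * s))"
    and m: "0 \<le> m" and l: "0 < l"
  shows "\<exists>Gh\<in>borel_measurable M.
    (AE \<omega> in M. (\<integral>\<^sup>+s\<in>{0..t}. (if g s \<omega> then ennreal (\<phi> s \<omega>) else 0) \<partial>lborel) \<le> Gh \<omega>) \<and>
    (\<integral>\<^sup>+\<omega>. Gh \<omega> \<partial>M) \<le> ennreal (m * exp (l * t) / l)"
proof -
  let ?h = "\<lambda>s \<omega>. if g s \<omega> then ennreal (\<phi> s \<omega>) else 0"
  let ?p = "\<lambda>n j. t * real j / real (Suc n)"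
  let ?S = "\<lambda>n \<omega>. \<Sum>j<Suc n. ennreal (t / real (Suc n)) * ?h (?p n j) \<omega>"
  have p: "0 \<le> ?p n j" "?p n j \<le> T" if "j < Suc n" for n j
  proof -
    show "0 \<le> ?p n j" using t by simp
    have "?p n j \<le> t * real (Suc n) / real (Suc n)"
      using t that by (intro divide_right_mono mult_left_mono) auto
    then show "?p n j \<le> T" using t by simp
  qed
  have hm: "?h s \<in> borel_measurable M" if "0 \<le> s" "s \<le> T" for s
    using gm[OF that] \<phi>m[OF that] by (intro measurable_If) auto
  have hp: "?h (?p n j) \<in> borel_measurable M" if "j \<in> {..<Suc n}" for n j
    using that by (intro hm p) simp_all
  have Sm: "?S n \<in> borel_measurable M" for n
    by (intro borel_measurable_sum borel_measurable_times_ennreal borel_measurable_const hp)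
  have "(\<integral>\<^sup>+\<omega>. ?S n \<omega> \<partial>M) \<le> ennreal (m * exp (l * t) / l)" for n
  proof -
    have "(\<integral>\<^sup>+\<omega>. ?S n \<omega> \<partial>M) = (\<Sum>j<Suc n. \<integral>\<^sup>+\<omega>. ennreal (t / real (Suc n)) * ?h (?p n j) \<omega> \<partial>M)"
      by (intro nn_integral_sum borel_measurable_times_ennreal borel_measurable_const hp)
    also have "\<dots> = (\<Sum>j<Suc n. ennreal (t / real (Suc n)) * (\<integral>\<^sup>+\<omega>. ?h (?p n j) \<omega> \<partial>M))"
      by (intro sum.cong refl nn_integral_cmult hp)
    also have "\<dots> \<le> (\<Sum>j<Suc n. ennreal (t / real (Suc n)) * ennreal (m * exp (l * ?p n j)))"
      by (intro sum_mono mult_left_mono bound p) simp_all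
    also have "\<dots> = (\<Sum>j<Suc n. ennreal (m * (t / real (Suc n) * exp (l * ?p n j))))"
      using t m by (intro sum.cong refl) (simp add: ennreal_mult[symmetric] mult_ac)
    also have "\<dots> = ennreal (\<Sum>j<Suc n. m * (t / real (Suc n) * exp (l * ?p n j)))"
      using t m by (intro sum_ennreal) simp
    also have "(\<Sum>j<Suc n. m * (t / real (Suc n) * exp (l * ?p n j)))
        = m * (\<Sum>j<Suc n. t / real (Suc n) * exp (l * ?p n j))"
      by (rule sum_distrib_left[symmetric])
    also have "ennreal \<dots> \<le> ennreal (m * (exp (l * t) / l))"
      by (intro ennreal_leI mult_left_mono left_sum_exp_le t l m)
    finally show ?thesis by simp
  qed
  then have "liminf (\<lambda>n. \<integral>\<^sup>+\<omega>. ?S n \<omega> \<partial>M) \<le> liminf (\<lambda>n. ennreal (m * exp (l * t) / l))"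
    by (intro Liminf_mono) simp
  then have "liminf (\<lambda>n. \<integral>\<^sup>+\<omega>. ?S n \<omega> \<partial>M) \<le> ennreal (m * exp (l * t) / l)"
    by (simp add: Liminf_const)
  moreover have "(\<integral>\<^sup>+\<omega>. liminf (\<lambda>n. ?S n \<omega>) \<partial>M) \<le> liminf (\<lambda>n. \<integral>\<^sup>+\<omega>. ?S n \<omega> \<partial>M)"
    by (rule nn_integral_liminf[OF Sm])
  moreover have "AE \<omega> in M. (\<integral>\<^sup>+s\<in>{0..t}. ?h s \<omega> \<partial>lborel) \<le> liminf (\<lambda>n. ?S n \<omega>)"
    using c
  proof eventually_elim
    case (elim \<omega>)
    show ?case
      using t g by (intro integral_le_liminf_left_sums[where g="\<lambda>s. g s \<omega>"] continuous_on_subset[OF elim]) auto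
  qed
  ultimately show ?thesis
    using Sm by (intro bexI[of _ "\<lambda>\<omega>. liminf (\<lambda>n. ?S n \<omega>)"] conjI)
      (auto intro: order_trans borel_measurable_liminf)
qed

text \<open>Replacing \<open>h\<close> by its majorant comes first; the factor \<beta> is then
  pulled out of an integral whose integrand is measurable, because \<phi> is continuous and the cut
  is an initial interval.\<close>

lemma cut_integral_cmult_le:
  fixes \<phi> h :: "real \<Rightarrow> real"
  assumes c: "continuous_on {0..t} \<phi>"
    and g: "\<And>s s'. 0 \<le> s \<Longrightarrow> s \<le> s' \<Longrightarrow> s' \<le> t \<Longrightarrow> g s' \<Longrightarrow> g s"
    and \<beta>: "0 \<le> \<beta>" and h: "\<And>s. (h s)\<^sup>2 \<le> \<beta> * \<phi> s"
  shows "(\<integral>\<^sup>+s\<in>{0..t}. (if g s then ennreal ((h s)\<^sup>2) else 0) \<partial>lborel)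
    \<le> ennreal \<beta> * (\<integral>\<^sup>+s\<in>{0..t}. (if g s then ennreal (\<phi> s) else 0) \<partial>lborel)"
proof -
  have [measurable]: "{s\<in>{0..t}. g s} \<in> sets borel" by (rule down_closed_measurable[OF g])
  have [measurable]: "(\<lambda>s. indicator {0..t} s * \<phi> s) \<in> borel_measurable borel"
    using borel_measurable_continuous_on_indicator[OF _ c] by simp
  have eq: "(\<lambda>s. (if g s then ennreal (\<phi> s) else 0) * indicator {0..t} s)
      = (\<lambda>s. ennreal (indicator {0..t} s * \<phi> s) * indicator {s\<in>{0..t}. g s} s)"
    by (auto simp: indicator_def fun_eq_iff)
  have m: "(\<lambda>s. (if g s then ennreal (\<phi> s) else 0) * indicator {0..t} s) \<in> borel_measurable lborel"
    unfolding eq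
    by (intro borel_measurable_times_ennreal measurable_compose[OF _ measurable_ennreal] borel_measurable_indicator)
       (use \<open>{s\<in>{0..t}. g s} \<in> sets borel\<close> \<open>(\<lambda>s. indicator {0..t} s * \<phi> s) \<in> borel_measurable borel\<close>
        in simp_all)
  have "ennreal ((h s)\<^sup>2) \<le> ennreal \<beta> * ennreal (\<phi> s)" for s
    using ennreal_leI[OF h[of s]] \<beta> by (simp add: ennreal_mult')
  then have "(\<integral>\<^sup>+s\<in>{0..t}. (if g s then ennreal ((h s)\<^sup>2) else 0) \<partial>lborel)
    \<le> (\<integral>\<^sup>+s. ennreal \<beta> * ((if g s then ennreal (\<phi> s) else 0) * indicator {0..t} s) \<partial>lborel)"
    by (intro nn_integral_mono) (auto simp: indicator_def)
  also have "\<dots> = ennreal \<beta> * (\<integral>\<^sup>+s\<in>{0..t}. (if g s then ennreal (\<phi> s) else 0) \<partial>lborel)"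
    by (rule nn_integral_cmult[OF m])
  finally show ?thesis .
qed

text \<open>The factor 3 comes from squaring a sum of three terms. Cauchy-Schwarz in time gives
  \<open>T\<close> for the drift; for the integrals, \<open>CARD('k)\<close> enters once from
  squaring their sum and once from counting them, and \<open>2 * C\<close> is the constant of
  \<open>localized_stoch_integral_bound\<close>. The bound \<open>R\<close> secures the hypotheses
  of that lemma but does not enter the estimate.\<close>

lemma (in filtered_space) localized_stoch_diff_bound:
  fixes Y :: "'k::finite \<Rightarrow> real \<Rightarrow> 'a \<Rightarrow> real"
  assumes X: "has_stoch_diff M F T X a b Y" and Y: "\<And>k. L2_integrator M F T (Y k) C"
    and t: "0 \<le> t" "t \<le> T"
    and gm: "\<And>s. 0 \<le> s \<Longrightarrow> s \<le> T \<Longrightarrow> {\<omega>\<in>space M. g s \<omega>} \<in> sets (F s)"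
    and g: "\<And>s s' \<omega>. 0 \<le> s \<Longrightarrow> s \<le> s' \<Longrightarrow> s' \<le> T \<Longrightarrow> g s' \<omega> \<Longrightarrow> g s \<omega>"
    and ac: "AE \<omega> in M. continuous_on {0..T} (\<lambda>s. a s \<omega>)"
    and bc: "\<And>k. AE \<omega> in M. continuous_on {0..T} (\<lambda>s. b k s \<omega>)"
    and \<beta>: "0 \<le> \<beta>" and adom: "\<And>s \<omega>. (a s \<omega>)\<^sup>2 \<le> \<beta> * \<phi> s \<omega>" and bdom: "\<And>k s \<omega>. (b k s \<omega>)\<^sup>2 \<le> \<beta> * \<phi> s \<omega>"
    and \<phi>c: "AE \<omega> in M. continuous_on {0..T} (\<lambda>s. \<phi> s \<omega>)"
    and \<phi>R: "AE \<omega> in M. \<forall>s\<in>{0..T}. g s \<omega> \<longrightarrow> \<phi> s \<omega> \<le> R"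
    and Gh[measurable]: "Gh \<in> borel_measurable M"
    and G: "AE \<omega> in M. (\<integral>\<^sup>+s\<in>{0..t}. (if g s \<omega> then ennreal (\<phi> s \<omega>) else 0) \<partial>lborel) \<le> Gh \<omega>"
  shows "(\<integral>\<^sup>+\<omega>. (if g t \<omega> then ennreal ((X t \<omega>)\<^sup>2) else 0) \<partial>M)
    \<le> ennreal 3 * ((\<integral>\<^sup>+\<omega>. ennreal ((X 0 \<omega>)\<^sup>2) \<partial>M)
        + ennreal (\<beta> * (T + (real CARD('k))\<^sup>2 * (2 * C))) * (\<integral>\<^sup>+\<omega>. Gh \<omega> \<partial>M))"
proof -
  have C: "0 \<le> C" using Y by (auto simp: L2_integrator_def)
  obtain I where I: "\<And>k. is_stoch_integral M F T (Y k) (b k) (I k)"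
    and XI: "AE \<omega> in M. X t \<omega> = X 0 \<omega> + (LINT s:{0..t}|lborel. a s \<omega>) + (\<Sum>k\<in>UNIV. I k t \<omega>)"
  proof -
    have "\<exists>I. (\<forall>k. is_stoch_integral M F T (Y k) (b k) (I k)) \<and>
        (\<forall>t\<in>{0..T}. AE \<omega> in M. X t \<omega> = X 0 \<omega> + (LINT s:{0..t}|lborel. a s \<omega>) + (\<Sum>k\<in>UNIV. I k t \<omega>))"
      using X unfolding has_stoch_diff_def by blast
    then show thesis using that t by (meson atLeastAtMost_iff)
  qed
  have Xa: "adapted_on F {0..T} X" using X by (simp add: has_stoch_diff_def)
  have [measurable]: "X 0 \<in> borel_measurable M" "X t \<in> borel_measurable M"
    using adapted_measurable[OF Xa] t by auto
  have Im[measurable]: "I k t \<in> borel_measurable M" for k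
    using I[of k] adapted_measurable[of "{0..T}" "I k" t] t by (auto simp: is_stoch_integral_def)
  have gM: "{\<omega>\<in>space M. g s \<omega>} \<in> sets M" if "0 \<le> s" "s \<le> T" for s
    using gm[OF that] subalg[of s] by (auto simp: subalgebra_def)
  let ?G = "\<lambda>\<omega>. \<integral>\<^sup>+s\<in>{0..t}. (if g s \<omega> then ennreal (\<phi> s \<omega>) else 0) \<partial>lborel"
  let ?J = "\<lambda>k \<omega>. if g t \<omega> then ennreal ((I k t \<omega>)\<^sup>2) else 0"
  let ?n = "real CARD('k)"
  have Jm: "?J k \<in> borel_measurable M" for k
    using gM t by (intro measurable_If) auto
  have J: "(\<integral>\<^sup>+\<omega>. ?J k \<omega> \<partial>M) \<le> ennreal (2 * C * \<beta>) * (\<integral>\<^sup>+\<omega>. Gh \<omega> \<partial>M)" for k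
  proof -
    have bR: "AE \<omega> in M. \<forall>s\<in>{0..T}. g s \<omega> \<longrightarrow> \<bar>b k s \<omega>\<bar> \<le> sqrt (\<beta> * R)"
      using \<phi>R
    proof eventually_elim
      case (elim \<omega>)
      show ?case
      proof (intro ballI impI)
        fix s assume "s \<in> {0..T}" "g s \<omega>"
        then have "\<beta> * \<phi> s \<omega> \<le> \<beta> * R" using elim \<beta> by (intro mult_left_mono) auto
        then have "(b k s \<omega>)\<^sup>2 \<le> \<beta> * R" using bdom[of k s \<omega>] by simp
        then show "\<bar>b k s \<omega>\<bar> \<le> sqrt (\<beta> * R)" using real_le_rsqrt[of "\<bar>b k s \<omega>\<bar>"] by simp
      qed
    qed
    have "(\<integral>\<^sup>+\<omega>. ?J k \<omega> \<partial>M) \<le> (\<integral>\<^sup>+\<omega>. ennreal (2 * C) *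
        (\<integral>\<^sup>+s\<in>{0..t}. (if g s \<omega> then ennreal ((b k s \<omega>)\<^sup>2) else 0) \<partial>lborel) \<partial>M)"
      using t g by (intro localized_stoch_integral_bound[OF Y I _ gm _ bc bR]) auto
    also have "\<dots> \<le> (\<integral>\<^sup>+\<omega>. ennreal (2 * C * \<beta>) * Gh \<omega> \<partial>M)"
    proof (rule nn_integral_mono_AE)
      show "AE \<omega> in M. ennreal (2 * C) *
        (\<integral>\<^sup>+s\<in>{0..t}. (if g s \<omega> then ennreal ((b k s \<omega>)\<^sup>2) else 0) \<partial>lborel) \<le> ennreal (2 * C * \<beta>) * Gh \<omega>"
        using \<phi>c G
      proof eventually_elim
        case (elim \<omega>)
        have "(\<integral>\<^sup>+s\<in>{0..t}. (if g s \<omega> then ennreal ((b k s \<omega>)\<^sup>2) else 0) \<partial>lborel) \<le> ennreal \<beta> * ?G \<omega>"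
          using t g bdom \<beta>
          by (intro cut_integral_cmult_le[where g="\<lambda>s. g s \<omega>"] continuous_on_subset[OF elim(1)]) auto
        also have "\<dots> \<le> ennreal \<beta> * Gh \<omega>" by (rule mult_left_mono[OF elim(2)]) simp
        finally show ?case
          using C \<beta> by (auto simp: ennreal_mult mult.assoc intro!: mult_left_mono)
      qed
    qed
    finally show ?thesis by (simp add: nn_integral_cmult)
  qed
  have X3: "AE \<omega> in M. (if g t \<omega> then ennreal ((X t \<omega>)\<^sup>2) else 0)
      \<le> ennreal 3 * (ennreal ((X 0 \<omega>)\<^sup>2) + ennreal (T * \<beta>) * Gh \<omega> + ennreal ?n * (\<Sum>k\<in>UNIV. ?J k \<omega>))"
    using XI \<phi>c G ac
  proof eventually_elim
    case (elim \<omega>)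
    show ?case
    proof (cases "g t \<omega>")
      case True
      \<comment> \<open>On \<open>g t\<close> the cut is inactive throughout \<open>[0,t]\<close>,
        so the drift may be integrated with the cut inserted.\<close>
      have gs: "g s \<omega>" if "s \<in> {0..t}" for s using g[of s t \<omega>] that t True by auto
      let ?y = "LINT s:{0..t}|lborel. a s \<omega>"
      let ?z = "\<lambda>k. I k t \<omega>"
      have "ennreal (?y\<^sup>2) \<le> ennreal t * (\<integral>\<^sup>+s\<in>{0..t}. ennreal ((a s \<omega>)\<^sup>2) \<partial>lborel)"
        using t by (intro set_integral_square_le continuous_on_subset[OF elim(4)]) auto
      also have "(\<integral>\<^sup>+s\<in>{0..t}. ennreal ((a s \<omega>)\<^sup>2) \<partial>lborel)
          = (\<integral>\<^sup>+s\<in>{0..t}. (if g s \<omega> then ennreal ((a s \<omega>)\<^sup>2) else 0) \<partial>lborel)"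
        using gs by (intro nn_integral_cong) (auto simp: indicator_def)
      also have "\<dots> \<le> ennreal \<beta> * ?G \<omega>"
        using t g adom \<beta>
        by (intro cut_integral_cmult_le[where g="\<lambda>s. g s \<omega>"] continuous_on_subset[OF elim(2)]) auto
      also have "\<dots> \<le> ennreal \<beta> * Gh \<omega>" by (rule mult_left_mono[OF elim(3)]) simp
      also have "ennreal t * (ennreal \<beta> * Gh \<omega>) \<le> ennreal T * (ennreal \<beta> * Gh \<omega>)"
        using t by (intro mult_right_mono ennreal_leI) simp_all
      finally have y: "ennreal (?y\<^sup>2) \<le> ennreal (T * \<beta>) * Gh \<omega>"
        using t \<beta> by (simp add: ennreal_mult mult.assoc mult_left_mono)
      have "(X t \<omega>)\<^sup>2 \<le> 3 * ((X 0 \<omega>)\<^sup>2 + ?y\<^sup>2 + (\<Sum>k\<in>UNIV. ?z k)\<^sup>2)"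
        unfolding elim(1) by (rule power2_sum3_le)
      also have "\<dots> \<le> 3 * ((X 0 \<omega>)\<^sup>2 + ?y\<^sup>2 + ?n * (\<Sum>k\<in>UNIV. (?z k)\<^sup>2))"
        using sum_squared_le_sum_of_squares[of ?z UNIV] by (simp add: mult.commute)
      finally have "ennreal ((X t \<omega>)\<^sup>2) \<le> ennreal (3 * ((X 0 \<omega>)\<^sup>2 + ?y\<^sup>2 + ?n * (\<Sum>k\<in>UNIV. (?z k)\<^sup>2)))"
        by (rule ennreal_leI)
      also have "\<dots> = ennreal 3 * (ennreal ((X 0 \<omega>)\<^sup>2) + ennreal (?y\<^sup>2) + ennreal ?n * (\<Sum>k\<in>UNIV. ennreal ((?z k)\<^sup>2)))"
        by (simp only: ennreal_mult ennreal_plus sum_ennreal zero_le_power2 sum_nonneg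
            mult_nonneg_nonneg add_nonneg_nonneg of_nat_0_le_iff zero_le_numeral)
      also have "\<dots> \<le> ennreal 3 * (ennreal ((X 0 \<omega>)\<^sup>2) + ennreal (T * \<beta>) * Gh \<omega> + ennreal ?n * (\<Sum>k\<in>UNIV. ?J k \<omega>))"
        using True y by (intro mult_left_mono add_mono) simp_all
      finally show ?thesis using True by simp
    qed simp
  qed
  have "(\<integral>\<^sup>+\<omega>. (if g t \<omega> then ennreal ((X t \<omega>)\<^sup>2) else 0) \<partial>M)
     \<le> (\<integral>\<^sup>+\<omega>. ennreal 3 * (ennreal ((X 0 \<omega>)\<^sup>2) + ennreal (T * \<beta>) * Gh \<omega> + ennreal ?n * (\<Sum>k\<in>UNIV. ?J k \<omega>)) \<partial>M)"
    by (rule nn_integral_mono_AE[OF X3])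
  also have "\<dots> = ennreal 3 * ((\<integral>\<^sup>+\<omega>. ennreal ((X 0 \<omega>)\<^sup>2) \<partial>M) + ennreal (T * \<beta>) * (\<integral>\<^sup>+\<omega>. Gh \<omega> \<partial>M)
      + ennreal ?n * (\<Sum>k\<in>UNIV. \<integral>\<^sup>+\<omega>. ?J k \<omega> \<partial>M))"
    using Jm by (simp add: nn_integral_add nn_integral_cmult nn_integral_sum borel_measurable_sum)
  also have "\<dots> \<le> ennreal 3 * ((\<integral>\<^sup>+\<omega>. ennreal ((X 0 \<omega>)\<^sup>2) \<partial>M) + ennreal (T * \<beta>) * (\<integral>\<^sup>+\<omega>. Gh \<omega> \<partial>M)
      + ennreal ?n * (\<Sum>k\<in>(UNIV::'k set). ennreal (2 * C * \<beta>) * (\<integral>\<^sup>+\<omega>. Gh \<omega> \<partial>M)))"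
    by (intro mult_left_mono add_left_mono sum_mono J) simp_all
  also have "ennreal ?n * (\<Sum>k\<in>(UNIV::'k set). ennreal (2 * C * \<beta>) * (\<integral>\<^sup>+\<omega>. Gh \<omega> \<partial>M))
      = ennreal (?n * (?n * (2 * C * \<beta>))) * (\<integral>\<^sup>+\<omega>. Gh \<omega> \<partial>M)"
    using C \<beta> by (simp add: ennreal_mult ennreal_of_nat_eq_real_of_nat mult.assoc)
  also have "(\<integral>\<^sup>+\<omega>. ennreal ((X 0 \<omega>)\<^sup>2) \<partial>M) + ennreal (T * \<beta>) * (\<integral>\<^sup>+\<omega>. Gh \<omega> \<partial>M)
      + ennreal (?n * (?n * (2 * C * \<beta>))) * (\<integral>\<^sup>+\<omega>. Gh \<omega> \<partial>M)
      = (\<integral>\<^sup>+\<omega>. ennreal ((X 0 \<omega>)\<^sup>2) \<partial>M)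
        + (ennreal (T * \<beta>) + ennreal (?n * (?n * (2 * C * \<beta>)))) * (\<integral>\<^sup>+\<omega>. Gh \<omega> \<partial>M)"
    by (simp only: distrib_right add.assoc)
  also have "ennreal (T * \<beta>) + ennreal (?n * (?n * (2 * C * \<beta>)))
      = ennreal (T * \<beta> + ?n * (?n * (2 * C * \<beta>)))"
    using C \<beta> t by (intro ennreal_plus[symmetric]) simp_all
  also have "T * \<beta> + ?n * (?n * (2 * C * \<beta>)) = \<beta> * (T + ?n\<^sup>2 * (2 * C))"
    by (simp add: power2_eq_square algebra_simps)
  finally show ?thesis .
qed

section \<open>Linearity\<close>

text \<open>If neither \<open>Z n\<close> nor \<open>Z' n\<close> exceeds a suitable
  \<open>d\<close>, then \<open>W n\<close> does not exceed \<open>e\<close>. The event for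
  \<open>W n\<close> thus lies in the union of two measurable events of vanishing
  probability.\<close>

lemma (in filtered_space) tends_to_0_in_prob_dominated:
  assumes Z: "tends_to_0_in_prob M Z" "tends_to_0_in_prob M Z'"
    and [measurable]: "\<And>n. Z n \<in> borel_measurable M" "\<And>n. Z' n \<in> borel_measurable M"
    and c: "0 \<le> c" "0 \<le> c'"
    and dom: "\<And>n \<omega>. \<omega> \<in> space M \<Longrightarrow> W n \<omega> \<le> ennreal c * Z n \<omega> + ennreal c' * Z' n \<omega>"
  shows "tends_to_0_in_prob M W"
  unfolding tends_to_0_in_prob_def
proof (intro allI impI)
  fix e :: ennreal assume e: "0 < e"
  \<comment> \<open>The level \<open>e\<close> may be infinite, in which case \<open>r = 1\<close>
    serves.\<close>
  obtain r where r: "0 < r" "ennreal r \<le> e"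
    using e by (cases e) (auto intro: that[of 1])
  define d where "d = r / (c + c' + 1)"
  have d: "0 < d" unfolding d_def using r c by simp
  have cd: "c * d + c' * d \<le> r"
  proof -
    have "(c + c' + 1) * d = r" unfolding d_def using c by simp
    then show ?thesis using d by (simp add: algebra_simps)
  qed
  let ?A = "\<lambda>n. {\<omega>\<in>space M. Z n \<omega> > ennreal d}" and ?B = "\<lambda>n. {\<omega>\<in>space M. Z' n \<omega> > ennreal d}"
  have "W n \<omega> \<le> e" if \<omega>: "\<omega> \<in> space M" "\<not> Z n \<omega> > ennreal d" "\<not> Z' n \<omega> > ennreal d" for n \<omega>
  proof -
    have "W n \<omega> \<le> ennreal c * ennreal d + ennreal c' * ennreal d"
      by (rule order_trans[OF dom[OF \<omega>(1)]], intro add_mono mult_left_mono)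
         (use \<omega> in \<open>simp_all add: not_less\<close>)
    also have "\<dots> = ennreal (c * d + c' * d)" using c d by (simp add: ennreal_mult)
    also have "\<dots> \<le> e" using ennreal_leI[OF cd] r(2) by order
    finally show ?thesis .
  qed
  then have "{\<omega>\<in>space M. W n \<omega> > e} \<subseteq> ?A n \<union> ?B n" for n by fastforce
  then have le: "emeasure M {\<omega>\<in>space M. W n \<omega> > e} \<le> emeasure M (?A n) + emeasure M (?B n)" for n
  proof -
    have AB: "?A n \<in> sets M" "?B n \<in> sets M" by measurable
    show ?thesis
      by (rule order_trans[OF emeasure_mono[OF \<open>{\<omega>\<in>space M. W n \<omega> > e} \<subseteq> ?A n \<union> ?B n\<close> sets.Un[OF AB]]
            emeasure_subadditive[OF AB]])
  qed
  have "(\<lambda>n. emeasure M (?A n) + emeasure M (?B n)) \<longlonglongrightarrow> 0 + 0"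
  proof (rule tendsto_add)
    have "0 < ennreal d" using d by simp
    then show "(\<lambda>n. emeasure M (?A n)) \<longlonglongrightarrow> 0" "(\<lambda>n. emeasure M (?B n)) \<longlonglongrightarrow> 0"
      using Z unfolding tends_to_0_in_prob_def by blast+
  qed
  then show "(\<lambda>n. emeasure M {\<omega>\<in>space M. W n \<omega> > e}) \<longlonglongrightarrow> 0"
    by (intro tendsto_sandwich[of "\<lambda>_. 0", OF _ always_eventually[OF allI[OF le]]]) simp_all
qed

lemma (in filtered_space) L2_distance_path_measurable:
  assumes S: "is_simple M F S"
    and H: "(\<lambda>(t, \<omega>). H t \<omega>) \<in> borel_measurable (restrict_space borel {0..T} \<Otimes>\<^sub>M M)"
    and \<omega>: "\<omega> \<in> space M"
  shows "(\<lambda>t. ennreal ((simple_value S t \<omega> - H t \<omega>)\<^sup>2) * indicator {0..T} t) \<in> borel_measurable lborel"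
proof -
  have "(\<lambda>t. ennreal ((simple_value S t \<omega> - H t \<omega>)\<^sup>2) * indicator {0..T} t)
      = (\<lambda>t. ennreal ((simple_value S t \<omega> - indicator {0..T} t * H t \<omega>)\<^sup>2) * indicator {0..T} t)"
    by (auto simp: indicator_def fun_eq_iff)
  also have "\<dots> \<in> borel_measurable lborel"
    by (intro borel_measurable_times_ennreal measurable_compose[OF _ measurable_ennreal]
          borel_measurable_power borel_measurable_diff borel_measurable_indicator)
       (use simple_value_path_measurable[OF S \<omega>] joint_measurable_path[OF H \<omega>] in simp_all)
  finally show ?thesis .
qed

lemma adapted_on_lincomb:
  fixes X X' :: "real \<Rightarrow> 'a \<Rightarrow> real"
  assumes "adapted_on F A X" "adapted_on F A X'"
  shows "adapted_on F A (\<lambda>t \<omega>. a * X t \<omega> + b * X' t \<omega>)"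
  unfolding adapted_on_def
proof
  fix t assume "t \<in> A"
  then have "X t \<in> borel_measurable (F t)" "X' t \<in> borel_measurable (F t)"
    using assms by (simp_all add: adapted_on_def)
  then show "(\<lambda>\<omega>. a * X t \<omega> + b * X' t \<omega>) \<in> borel_measurable (F t)"
    by (intro borel_measurable_add borel_measurable_times borel_measurable_const)
qed

definition scale_simple :: "real \<Rightarrow> 'a simple_process \<Rightarrow> 'a simple_process" where
  "scale_simple a S = map (\<lambda>(r, s, \<xi>). (r, s, \<lambda>\<omega>. a * \<xi> \<omega>)) S"

lemma is_simple_scale: "is_simple M F S \<Longrightarrow> is_simple M F (scale_simple a S)"
proof -
  have b: "\<exists>B'. \<forall>\<omega>\<in>A. \<bar>a * \<xi> \<omega>\<bar> \<le> B'" if "\<exists>B. \<forall>\<omega>\<in>A. \<bar>\<xi> \<omega>\<bar> \<le> B" for A and \<xi> :: "'a \<Rightarrow> real"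
  proof -
    obtain B where "\<forall>\<omega>\<in>A. \<bar>\<xi> \<omega>\<bar> \<le> B" using \<open>\<exists>B. _\<close> by blast
    then show ?thesis by (intro exI[of _ "\<bar>a\<bar> * B"]) (auto simp: abs_mult intro: mult_left_mono)
  qed
  assume "is_simple M F S"
  then show ?thesis
    unfolding is_simple_def scale_simple_def by (auto intro!: b borel_measurable_times)
qed

lemma simple_value_scale: "simple_value (scale_simple a S) t \<omega> = a * simple_value S t \<omega>"
  by (induction S) (auto simp: simple_value_def scale_simple_def algebra_simps)

lemma simple_integral_scale: "simple_integral (scale_simple a S) Y t \<omega> = a * simple_integral S Y t \<omega>"
  by (induction S) (auto simp: simple_integral_def scale_simple_def algebra_simps)

lemma is_simple_append: "is_simple M F S \<Longrightarrow> is_simple M F S' \<Longrightarrow> is_simple M F (S @ S')"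
  by (auto simp: is_simple_def)

lemma simple_value_append: "simple_value (S @ S') t \<omega> = simple_value S t \<omega> + simple_value S' t \<omega>"
  by (simp add: simple_value_def)

lemma simple_integral_append:
  "simple_integral (S @ S') Y t \<omega> = simple_integral S Y t \<omega> + simple_integral S' Y t \<omega>"
  by (simp add: simple_integral_def)

text \<open>Scaled approximations are added by concatenating their lists, on which value and
  integral are additive. The distances are controlled by \<open>power2_sum_le\<close> for the
  integrands and by the triangle inequality for the integrals.\<close>

lemma (in filtered_space) is_stoch_integral_lincomb:
  assumes I: "is_stoch_integral M F T Y H I" and I': "is_stoch_integral M F T Y H' I'"
    and Y: "adapted_on F {0..T} Y"
  shows "is_stoch_integral M F T Y (\<lambda>t \<omega>. a * H t \<omega> + b * H' t \<omega>) (\<lambda>t \<omega>. a * I t \<omega> + b * I' t \<omega>)"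
proof -
  have Hm: "(\<lambda>(t, \<omega>). H t \<omega>) \<in> borel_measurable (restrict_space borel {0..T} \<Otimes>\<^sub>M M)"
    and Hm': "(\<lambda>(t, \<omega>). H' t \<omega>) \<in> borel_measurable (restrict_space borel {0..T} \<Otimes>\<^sub>M M)"
    using I I' by (auto simp: is_stoch_integral_def)
  obtain S where S: "\<And>n. is_simple M F (S n)"
    and c: "tends_to_0_in_prob M
          (\<lambda>n \<omega>. \<integral>\<^sup>+t\<in>{0..T}. ennreal ((simple_value (S n) t \<omega> - H t \<omega>)\<^sup>2) \<partial>lborel)"
    and d: "\<And>t. t \<in> {0..T} \<Longrightarrow> tends_to_0_in_prob M (\<lambda>n \<omega>. ennreal \<bar>simple_integral (S n) Y t \<omega> - I t \<omega>\<bar>)"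
    using I unfolding is_stoch_integral_def by blast
  obtain S' where S': "\<And>n. is_simple M F (S' n)"
    and c': "tends_to_0_in_prob M
          (\<lambda>n \<omega>. \<integral>\<^sup>+t\<in>{0..T}. ennreal ((simple_value (S' n) t \<omega> - H' t \<omega>)\<^sup>2) \<partial>lborel)"
    and d': "\<And>t. t \<in> {0..T} \<Longrightarrow> tends_to_0_in_prob M (\<lambda>n \<omega>. ennreal \<bar>simple_integral (S' n) Y t \<omega> - I' t \<omega>\<bar>)"
    using I' unfolding is_stoch_integral_def by blast
  define R where "R n = scale_simple a (S n) @ scale_simple b (S' n)" for n
  have Rv: "simple_value (R n) t \<omega> = a * simple_value (S n) t \<omega> + b * simple_value (S' n) t \<omega>" for n t \<omega>
    by (simp add: R_def simple_value_append simple_value_scale)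
  have Ri: "simple_integral (R n) Y t \<omega> = a * simple_integral (S n) Y t \<omega> + b * simple_integral (S' n) Y t \<omega>" for n t \<omega>
    by (simp add: R_def simple_integral_append simple_integral_scale)
  have Rs: "is_simple M F (R n)" for n
    unfolding R_def by (intro is_simple_append is_simple_scale S S')
  have 1: "tends_to_0_in_prob M (\<lambda>n \<omega>. \<integral>\<^sup>+t\<in>{0..T}.
      ennreal ((simple_value (R n) t \<omega> - (a * H t \<omega> + b * H' t \<omega>))\<^sup>2) \<partial>lborel)"
  proof (rule tends_to_0_in_prob_dominated[OF c c' L2_distance_measurable[OF S Hm] L2_distance_measurable[OF S' Hm'],
        of "2 * a\<^sup>2" "2 * b\<^sup>2"])
    fix n \<omega> assume \<omega>: "\<omega> \<in> space M"
    let ?f = "\<lambda>t. ennreal ((simple_value (S n) t \<omega> - H t \<omega>)\<^sup>2) * indicator {0..T} t"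
    let ?f' = "\<lambda>t. ennreal ((simple_value (S' n) t \<omega> - H' t \<omega>)\<^sup>2) * indicator {0..T} t"
    have m: "?f \<in> borel_measurable lborel" and m': "?f' \<in> borel_measurable lborel"
      by (rule L2_distance_path_measurable[OF S Hm \<omega>], rule L2_distance_path_measurable[OF S' Hm' \<omega>])
    have "(\<integral>\<^sup>+t\<in>{0..T}. ennreal ((simple_value (R n) t \<omega> - (a * H t \<omega> + b * H' t \<omega>))\<^sup>2) \<partial>lborel)
       \<le> (\<integral>\<^sup>+t. ennreal (2 * a\<^sup>2) * ?f t + ennreal (2 * b\<^sup>2) * ?f' t \<partial>lborel)"
    proof (rule nn_integral_mono)
      fix t
      let ?x = "simple_value (S n) t \<omega> - H t \<omega>" and ?y = "simple_value (S' n) t \<omega> - H' t \<omega>"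
      have "simple_value (R n) t \<omega> - (a * H t \<omega> + b * H' t \<omega>) = a * ?x + b * ?y"
        unfolding Rv by (simp add: algebra_simps)
      then have "(simple_value (R n) t \<omega> - (a * H t \<omega> + b * H' t \<omega>))\<^sup>2 \<le> 2 * a\<^sup>2 * ?x\<^sup>2 + 2 * b\<^sup>2 * ?y\<^sup>2"
        using power2_sum_le[of "a * ?x" "b * ?y"] by (simp add: power_mult_distrib)
      from ennreal_leI[OF this]
      have "ennreal ((simple_value (R n) t \<omega> - (a * H t \<omega> + b * H' t \<omega>))\<^sup>2)
          \<le> ennreal (2 * a\<^sup>2) * ennreal (?x\<^sup>2) + ennreal (2 * b\<^sup>2) * ennreal (?y\<^sup>2)"
        by (simp only: ennreal_plus ennreal_mult zero_le_power2 mult_nonneg_nonneg zero_le_numeral)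
      then show "ennreal ((simple_value (R n) t \<omega> - (a * H t \<omega> + b * H' t \<omega>))\<^sup>2) * indicator {0..T} t
          \<le> ennreal (2 * a\<^sup>2) * ?f t + ennreal (2 * b\<^sup>2) * ?f' t"
        by (auto simp: indicator_def)
    qed
    also have "\<dots> = ennreal (2 * a\<^sup>2) * (\<integral>\<^sup>+t. ?f t \<partial>lborel) + ennreal (2 * b\<^sup>2) * (\<integral>\<^sup>+t. ?f' t \<partial>lborel)"
      using nn_integral_add[OF borel_measurable_times_ennreal[OF borel_measurable_const m]
          borel_measurable_times_ennreal[OF borel_measurable_const m'], of "ennreal (2 * a\<^sup>2)" "ennreal (2 * b\<^sup>2)"]
      by (simp only: nn_integral_cmult[OF m] nn_integral_cmult[OF m'])
    finally show "(\<integral>\<^sup>+t\<in>{0..T}. ennreal ((simple_value (R n) t \<omega> - (a * H t \<omega> + b * H' t \<omega>))\<^sup>2) \<partial>lborel)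
      \<le> ennreal (2 * a\<^sup>2) * (\<integral>\<^sup>+t. ?f t \<partial>lborel) + ennreal (2 * b\<^sup>2) * (\<integral>\<^sup>+t. ?f' t \<partial>lborel)" .
  qed simp_all
  have 2: "tends_to_0_in_prob M (\<lambda>n \<omega>. ennreal \<bar>simple_integral (R n) Y t \<omega> - (a * I t \<omega> + b * I' t \<omega>)\<bar>)"
    if t: "t \<in> {0..T}" for t
  proof (rule tends_to_0_in_prob_dominated[OF d[OF t] d'[OF t], of "\<bar>a\<bar>" "\<bar>b\<bar>"])
    have [measurable]: "simple_integral (S n) Y t \<in> borel_measurable M" "I t \<in> borel_measurable M"
      "simple_integral (S' n) Y t \<in> borel_measurable M" "I' t \<in> borel_measurable M" for n
      using simple_integral_measurable[OF S Y t] simple_integral_measurable[OF S' Y t]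
        I I' adapted_measurable[OF _ t] by (auto simp: is_stoch_integral_def)
    show "(\<lambda>\<omega>. ennreal \<bar>simple_integral (S n) Y t \<omega> - I t \<omega>\<bar>) \<in> borel_measurable M"
      "(\<lambda>\<omega>. ennreal \<bar>simple_integral (S' n) Y t \<omega> - I' t \<omega>\<bar>) \<in> borel_measurable M" for n
      by measurable
    fix n \<omega>
    let ?x = "simple_integral (S n) Y t \<omega> - I t \<omega>" and ?y = "simple_integral (S' n) Y t \<omega> - I' t \<omega>"
    have "simple_integral (R n) Y t \<omega> - (a * I t \<omega> + b * I' t \<omega>) = a * ?x + b * ?y"
      unfolding Ri by (simp add: algebra_simps)
    then have "\<bar>simple_integral (R n) Y t \<omega> - (a * I t \<omega> + b * I' t \<omega>)\<bar> \<le> \<bar>a\<bar> * \<bar>?x\<bar> + \<bar>b\<bar> * \<bar>?y\<bar>"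
      using abs_triangle_ineq[of "a * ?x" "b * ?y"] by (simp add: abs_mult)
    from ennreal_leI[OF this]
    show "ennreal \<bar>simple_integral (R n) Y t \<omega> - (a * I t \<omega> + b * I' t \<omega>)\<bar>
        \<le> ennreal \<bar>a\<bar> * ennreal \<bar>?x\<bar> + ennreal \<bar>b\<bar> * ennreal \<bar>?y\<bar>"
      by (simp add: ennreal_mult)
  qed simp_all
  have "(\<lambda>(t, \<omega>). a * H t \<omega> + b * H' t \<omega>) \<in> borel_measurable (restrict_space borel {0..T} \<Otimes>\<^sub>M M)"
    using Hm Hm' unfolding case_prod_beta by (intro borel_measurable_add borel_measurable_times borel_measurable_const)
  moreover have "adapted_on F {0..T} (\<lambda>t \<omega>. a * H t \<omega> + b * H' t \<omega>)"
    "adapted_on F {0..T} (\<lambda>t \<omega>. a * I t \<omega> + b * I' t \<omega>)"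
  proof -
    have "adapted_on F {0..T} H" "adapted_on F {0..T} H'" "adapted_on F {0..T} I" "adapted_on F {0..T} I'"
      using I I' by (simp_all add: is_stoch_integral_def)
    then show "adapted_on F {0..T} (\<lambda>t \<omega>. a * H t \<omega> + b * H' t \<omega>)"
      "adapted_on F {0..T} (\<lambda>t \<omega>. a * I t \<omega> + b * I' t \<omega>)"
      by (simp_all only: adapted_on_lincomb)
  qed
  moreover have "AE \<omega> in M. continuous_on {0..T} (\<lambda>t. a * I t \<omega> + b * I' t \<omega>)"
  proof -
    have "AE \<omega> in M. continuous_on {0..T} (\<lambda>t. I t \<omega>)" "AE \<omega> in M. continuous_on {0..T} (\<lambda>t. I' t \<omega>)"
      using I I' by (auto simp: is_stoch_integral_def)
    then show ?thesis by eventually_elim (intro continuous_intros)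
  qed
  ultimately show ?thesis unfolding is_stoch_integral_def using 1 2 Rs by blast
qed

lemma (in filtered_space) has_stoch_diff_lincomb:
  fixes Y :: "'k::finite \<Rightarrow> real \<Rightarrow> 'a \<Rightarrow> real"
  assumes X: "has_stoch_diff M F T X \<alpha> \<beta> Y" and X': "has_stoch_diff M F T X' \<alpha>' \<beta>' Y"
    and Y: "\<And>k. adapted_on F {0..T} (Y k)"
  shows "has_stoch_diff M F T (\<lambda>t \<omega>. a * X t \<omega> + b * X' t \<omega>) (\<lambda>t \<omega>. a * \<alpha> t \<omega> + b * \<alpha>' t \<omega>)
    (\<lambda>k t \<omega>. a * \<beta> k t \<omega> + b * \<beta>' k t \<omega>) Y"
proof -
  obtain I where I: "\<And>k. is_stoch_integral M F T (Y k) (\<beta> k) (I k)"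
    and XI: "\<And>t. t \<in> {0..T} \<Longrightarrow> AE \<omega> in M. X t \<omega> = X 0 \<omega> + (LINT s:{0..t}|lborel. \<alpha> s \<omega>) + (\<Sum>k\<in>UNIV. I k t \<omega>)"
    using X unfolding has_stoch_diff_def by blast
  obtain I' where I': "\<And>k. is_stoch_integral M F T (Y k) (\<beta>' k) (I' k)"
    and XI': "\<And>t. t \<in> {0..T} \<Longrightarrow> AE \<omega> in M. X' t \<omega> = X' 0 \<omega> + (LINT s:{0..t}|lborel. \<alpha>' s \<omega>) + (\<Sum>k\<in>UNIV. I' k t \<omega>)"
    using X' unfolding has_stoch_diff_def by blast
  have si: "AE \<omega> in M. set_integrable lborel {0..T} (\<lambda>s. \<alpha> s \<omega>)"
    "AE \<omega> in M. set_integrable lborel {0..T} (\<lambda>s. \<alpha>' s \<omega>)"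
    and co: "AE \<omega> in M. continuous_on {0..T} (\<lambda>t. X t \<omega>)" "AE \<omega> in M. continuous_on {0..T} (\<lambda>t. X' t \<omega>)"
    using X X' by (auto simp: has_stoch_diff_def)
  have "adapted_on F {0..T} (\<lambda>t \<omega>. a * X t \<omega> + b * X' t \<omega>)"
  proof -
    have "adapted_on F {0..T} X" "adapted_on F {0..T} X'"
      using X X' by (simp_all add: has_stoch_diff_def)
    then show ?thesis by (rule adapted_on_lincomb)
  qed
  moreover have "AE \<omega> in M. continuous_on {0..T} (\<lambda>t. a * X t \<omega> + b * X' t \<omega>)"
    using co by eventually_elim (intro continuous_intros)
  moreover have "AE \<omega> in M. set_integrable lborel {0..T} (\<lambda>t. a * \<alpha> t \<omega> + b * \<alpha>' t \<omega>)"
    using si by eventually_elim (intro set_integral_add set_integrable_mult_right, simp_all)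
  moreover have "is_stoch_integral M F T (Y k) (\<lambda>t \<omega>. a * \<beta> k t \<omega> + b * \<beta>' k t \<omega>) (\<lambda>t \<omega>. a * I k t \<omega> + b * I' k t \<omega>)" for k
    by (rule is_stoch_integral_lincomb[OF I I' Y])
  moreover have "AE \<omega> in M. a * X t \<omega> + b * X' t \<omega> = a * X 0 \<omega> + b * X' 0 \<omega>
      + (LINT s:{0..t}|lborel. a * \<alpha> s \<omega> + b * \<alpha>' s \<omega>) + (\<Sum>k\<in>UNIV. a * I k t \<omega> + b * I' k t \<omega>)"
    if t: "t \<in> {0..T}" for t
    using XI[OF t] XI'[OF t] si
  proof eventually_elim
    case (elim \<omega>)
    have s: "set_integrable lborel {0..t} (\<lambda>s. \<alpha> s \<omega>)" "set_integrable lborel {0..t} (\<lambda>s. \<alpha>' s \<omega>)"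
      using set_integrable_subset[OF elim(3)] set_integrable_subset[OF elim(4)] t by auto
    have "(LINT s:{0..t}|lborel. a * \<alpha> s \<omega> + b * \<alpha>' s \<omega>)
        = a * (LINT s:{0..t}|lborel. \<alpha> s \<omega>) + b * (LINT s:{0..t}|lborel. \<alpha>' s \<omega>)"
      using s by (subst set_integral_add(2)) auto
    moreover have "(\<Sum>k\<in>UNIV. a * I k t \<omega> + b * I' k t \<omega>) = a * (\<Sum>k\<in>UNIV. I k t \<omega>) + b * (\<Sum>k\<in>UNIV. I' k t \<omega>)"
      by (simp add: sum.distrib sum_distrib_left)
    ultimately show ?case unfolding elim(1,2) by (simp add: algebra_simps)
  qed
  ultimately show ?thesis
    unfolding has_stoch_diff_def by (intro conjI exI[of _ "\<lambda>k t \<omega>. a * I k t \<omega> + b * I' k t \<omega>"]) auto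
qed

section \<open>Linear stochastic differential equations\<close>

text \<open>Carries a bound from rational times to all times. Only times up to \<open>s\<close> are
  allowed, so \<open>s\<close> is approached from the left, and \<open>s = 0\<close> is treated by
  itself as a rational point.\<close>

lemma continuous_on_le_from_rationals:
  fixes \<phi> :: "real \<Rightarrow> real"
  assumes c: "continuous_on {0..T} \<phi>" and q: "\<And>q. q \<in> \<rat> \<Longrightarrow> 0 \<le> q \<Longrightarrow> q \<le> s \<Longrightarrow> \<phi> q \<le> R"
    and s: "s \<in> {0..T}"
  shows "\<phi> s \<le> R"
proof (cases "s = 0")
  case True
  then show ?thesis using q[of 0] by simp
next
  case False
  then have s0: "0 < s" using s by simp
  show ?thesis
  proof (rule ccontr)
    assume "\<not> ?thesis"
    then have e: "0 < \<phi> s - R" by simp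
    then obtain d where d: "0 < d" "\<And>x. x \<in> {0..T} \<Longrightarrow> dist x s < d \<Longrightarrow> dist (\<phi> x) (\<phi> s) < \<phi> s - R"
      using c s unfolding continuous_on_iff by blast
    have "max 0 (s - d) < s" using s0 d by simp
    then obtain x where x: "x \<in> \<rat>" "max 0 (s - d) < x" "x < s" using Rats_dense_in_real by blast
    then have "dist (\<phi> x) (\<phi> s) < \<phi> s - R" using s by (intro d(2)) (auto simp: dist_real_def)
    then show False using q[of x] x by (auto simp: dist_real_def abs_less_iff)
  qed
qed

text \<open>Gronwall's argument in the norm weighted by \<open>exp (- l * s)\<close>, in which one
  use of the integral equation halves the previous bound up to a constant. In \<kappa>, the number
  of components enters once through Cauchy-Schwarz on a matrix row and once through summation over
  the components; the other factors are those of \<open>localized_stoch_diff_bound\<close>.\<close>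

lemma (in filtered_space) linear_sde_second_moment:
  fixes Y :: "'k::finite \<Rightarrow> real \<Rightarrow> 'a \<Rightarrow> real" and V :: "real \<Rightarrow> 'a \<Rightarrow> 'i \<Rightarrow> real"
  assumes J: "finite J" and T: "0 \<le> T"
    and sde: "\<And>i. i \<in> J \<Longrightarrow> has_stoch_diff M F T (\<lambda>t \<omega>. V t \<omega> i) (\<lambda>t \<omega>. \<Sum>j\<in>J. A0 i j * V t \<omega> j)
        (\<lambda>k t \<omega>. \<Sum>j\<in>J. A k i j * V t \<omega> j) Y"
    and Y: "\<And>k. L2_integrator M F T (Y k) C"
    and a0: "\<And>i j. i \<in> J \<Longrightarrow> j \<in> J \<Longrightarrow> \<bar>A0 i j\<bar> \<le> a"
    and a: "\<And>k i j. i \<in> J \<Longrightarrow> j \<in> J \<Longrightarrow> \<bar>A k i j\<bar> \<le> a"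
    and D: "AE \<omega> in M. (\<Sum>i\<in>J. (V 0 \<omega> i)\<^sup>2) \<le> D" and D0: "0 \<le> D"
    and t: "t \<in> {0..T}"
  defines "\<kappa> \<equiv> 3 * (real (card J))\<^sup>2 * a\<^sup>2 * (T + (real CARD('k))\<^sup>2 * (2 * C))"
  shows "(\<integral>\<^sup>+\<omega>. ennreal (\<Sum>i\<in>J. (V t \<omega> i)\<^sup>2) \<partial>M) \<le> ennreal (6 * exp (2 * (\<kappa> + 1) * T) * D)"
proof -
  have C: "0 \<le> C" using Y by (auto simp: L2_integrator_def)
  have \<kappa>0: "0 \<le> \<kappa>" unfolding \<kappa>_def using C T by simp
  let ?N = "real (card J)"
  define \<phi> where "\<phi> s \<omega> = (\<Sum>i\<in>J. (V s \<omega> i)\<^sup>2)" for s \<omega>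
  define \<beta> where "\<beta> = ?N * a\<^sup>2"
  \<comment> \<open>Chosen so that \<open>\<kappa> / l \<le> 1 / 2\<close>; adding 1 keeps
    \<open>l\<close> positive when \<kappa> vanishes.\<close>
  define l where "l = 2 * (\<kappa> + 1)"
  have l0: "0 < l" unfolding l_def using \<kappa>0 by simp
  have \<beta>0: "0 \<le> \<beta>" unfolding \<beta>_def by simp
  have \<phi>0: "0 \<le> \<phi> s \<omega>" for s \<omega> unfolding \<phi>_def by (intro sum_nonneg) simp
  have dom: "(\<Sum>j\<in>J. B j * V s \<omega> j)\<^sup>2 \<le> \<beta> * \<phi> s \<omega>" if B: "\<And>j. j \<in> J \<Longrightarrow> \<bar>B j\<bar> \<le> a" for B s \<omega>
  proof -
    have "(\<Sum>j\<in>J. (B j)\<^sup>2) \<le> (\<Sum>j\<in>J. a\<^sup>2)"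
      using power_mono[OF B abs_ge_zero, of _ 2] by (intro sum_mono) simp
    then have "(\<Sum>j\<in>J. (B j)\<^sup>2) \<le> \<beta>" by (simp add: \<beta>_def)
    then have "(\<Sum>j\<in>J. (B j)\<^sup>2) * \<phi> s \<omega> \<le> \<beta> * \<phi> s \<omega>" by (rule mult_right_mono[OF _ \<phi>0])
    moreover have "(\<Sum>j\<in>J. B j * V s \<omega> j)\<^sup>2 \<le> (\<Sum>j\<in>J. (B j)\<^sup>2) * \<phi> s \<omega>"
      unfolding \<phi>_def by (rule Cauchy_Schwarz_ineq_sum)
    ultimately show ?thesis by simp
  qed
  have Vad: "adapted_on F {0..T} (\<lambda>t \<omega>. V t \<omega> i)"
    and Vc: "AE \<omega> in M. continuous_on {0..T} (\<lambda>t. V t \<omega> i)" if "i \<in> J" for i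
    using sde[OF that] by (auto simp: has_stoch_diff_def)
  have VcJ: "AE \<omega> in M. \<forall>i\<in>J. continuous_on {0..T} (\<lambda>t. V t \<omega> i)"
    using Vc J by (intro AE_finite_allI) auto
  have \<phi>c: "AE \<omega> in M. continuous_on {0..T} (\<lambda>s. \<phi> s \<omega>)"
    using VcJ unfolding \<phi>_def by eventually_elim (intro continuous_intros, auto)
  have linc: "AE \<omega> in M. continuous_on {0..T} (\<lambda>s. \<Sum>j\<in>J. B j * V s \<omega> j)" for B
    using VcJ by eventually_elim (intro continuous_intros, auto)
  have \<phi>F: "\<phi> s \<in> borel_measurable (F s)" if "0 \<le> s" "s \<le> T" for s
    unfolding \<phi>_def using Vad that by (intro borel_measurable_sum borel_measurable_power) (auto simp: adapted_on_def)
  have \<phi>m: "\<phi> s \<in> borel_measurable M" if "0 \<le> s" "s \<le> T" for s using F_measurable_M[OF \<phi>F[OF that]] .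

  \<comment> \<open>Rational times make this event a countable intersection, hence an element of
    \<open>F s\<close>; by continuity it still controls every time up to \<open>s\<close>. It
    decreases in \<open>s\<close> by construction.\<close>
  define g where "g R s \<omega> \<longleftrightarrow> (\<forall>q\<in>\<rat>. 0 \<le> q \<longrightarrow> q \<le> s \<longrightarrow> \<phi> q \<omega> \<le> R)" for R s \<omega>
  have gF: "{\<omega>\<in>space M. g R s \<omega>} \<in> sets (F s)" if s: "0 \<le> s" "s \<le> T" for R s
  proof -
    let ?Q = "{q\<in>\<rat>. 0 \<le> q \<and> q \<le> s}"
    have Q0: "0 \<in> ?Q" using s by simp
    have "countable ?Q" by (rule countable_subset[OF _ countable_rat]) auto
    moreover have "{\<omega>\<in>space M. \<phi> q \<omega> \<le> R} \<in> sets (F s)" if "q \<in> ?Q" for q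
    proof -
      have "\<phi> q \<in> borel_measurable (F s)"
        using that s by (intro F_measurable_mono[OF _ \<phi>F]) auto
      from borel_measurable_le[OF this borel_measurable_const[of R]] show ?thesis by simp
    qed
    ultimately have "(\<Inter>q\<in>?Q. {\<omega>\<in>space M. \<phi> q \<omega> \<le> R}) \<in> sets (F s)"
      using Q0 by (intro sets.countable_INT') blast+
    also have "(\<Inter>q\<in>?Q. {\<omega>\<in>space M. \<phi> q \<omega> \<le> R}) = {\<omega>\<in>space M. g R s \<omega>}"
      using Q0 unfolding g_def by blast
    finally show ?thesis .
  qed
  have gM: "{\<omega>\<in>space M. g R s \<omega>} \<in> sets M" if "0 \<le> s" "s \<le> T" for R s
    using gF[OF that] subalg[of s] by (auto simp: subalgebra_def)
  have gmono: "0 \<le> s \<Longrightarrow> s \<le> s' \<Longrightarrow> s' \<le> T \<Longrightarrow> g R s' \<omega> \<Longrightarrow> g R s \<omega>" for R s s' \<omega>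
    unfolding g_def by auto
  have g\<phi>: "AE \<omega> in M. \<forall>s\<in>{0..T}. g R s \<omega> \<longrightarrow> \<phi> s \<omega> \<le> R" for R
    using \<phi>c
  proof eventually_elim
    case (elim \<omega>)
    then show ?case unfolding g_def using continuous_on_le_from_rationals[OF elim] by blast
  qed
  define u where "u R s = (\<integral>\<^sup>+\<omega>. (if g R s \<omega> then ennreal (\<phi> s \<omega>) else 0) \<partial>M)" for R s

  have X0: "(\<Sum>i\<in>J. \<integral>\<^sup>+\<omega>. ennreal ((V 0 \<omega> i)\<^sup>2) \<partial>M) \<le> ennreal D"
  proof -
    have [measurable]: "(\<lambda>\<omega>. V 0 \<omega> i) \<in> borel_measurable M" if "i \<in> J" for i
      using adapted_measurable[OF Vad[OF that], of 0] T by simp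
    have "(\<Sum>i\<in>J. \<integral>\<^sup>+\<omega>. ennreal ((V 0 \<omega> i)\<^sup>2) \<partial>M) = (\<integral>\<^sup>+\<omega>. (\<Sum>i\<in>J. ennreal ((V 0 \<omega> i)\<^sup>2)) \<partial>M)"
      by (rule nn_integral_sum[symmetric]) measurable
    also have "\<dots> \<le> (\<integral>\<^sup>+\<omega>. ennreal D \<partial>M)"
      using D by (intro nn_integral_mono_AE) (auto elim!: eventually_mono intro!: ennreal_leI)
    finally show ?thesis by (simp add: emeasure_space_1)
  qed

  \<comment> \<open>A bound \<open>m\<close> in the weighted norm improves to
    \<open>3 * D + m / 2\<close>: integrating \<open>exp (l * s)\<close> in time gains the factor
    \<open>1 / l\<close>.\<close>
  have step: "u R s \<le> ennreal ((3 * D + m / 2) * exp (l * s))"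
    if s: "0 \<le> s" "s \<le> T" and m: "0 \<le> m" and b: "\<And>s. 0 \<le> s \<Longrightarrow> s \<le> T \<Longrightarrow> u R s \<le> ennreal (m * exp (l * s))" for R m s
  proof -
    obtain Gh where Gh: "Gh \<in> borel_measurable M"
      "AE \<omega> in M. (\<integral>\<^sup>+r\<in>{0..s}. (if g R r \<omega> then ennreal (\<phi> r \<omega>) else 0) \<partial>lborel) \<le> Gh \<omega>"
      "(\<integral>\<^sup>+\<omega>. Gh \<omega> \<partial>M) \<le> ennreal (m * exp (l * s) / l)"
    proof -
      have "\<exists>Gh\<in>borel_measurable M.
        (AE \<omega> in M. (\<integral>\<^sup>+r\<in>{0..s}. (if g R r \<omega> then ennreal (\<phi> r \<omega>) else 0) \<partial>lborel) \<le> Gh \<omega>) \<and>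
        (\<integral>\<^sup>+\<omega>. Gh \<omega> \<partial>M) \<le> ennreal (m * exp (l * s) / l)"
        by (rule localized_time_integral[where g="g R"]) (fact s \<phi>m gM gmono \<phi>c b[unfolded u_def] m l0)+
      then show thesis using that by blast
    qed
    let ?c = "ennreal (\<beta> * (T + (real CARD('k))\<^sup>2 * (2 * C))) * (\<integral>\<^sup>+\<omega>. Gh \<omega> \<partial>M)"
    have comp: "(\<integral>\<^sup>+\<omega>. (if g R s \<omega> then ennreal ((V s \<omega> i)\<^sup>2) else 0) \<partial>M)
        \<le> ennreal 3 * ((\<integral>\<^sup>+\<omega>. ennreal ((V 0 \<omega> i)\<^sup>2) \<partial>M) + ?c)" if i: "i \<in> J" for i
    proof (rule localized_stoch_diff_bound[where g="g R" and R=R])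
      show "(\<Sum>j\<in>J. A0 i j * V s \<omega> j)\<^sup>2 \<le> \<beta> * \<phi> s \<omega>" for s \<omega>
        by (rule dom) (rule a0[OF i])
      show "(\<Sum>j\<in>J. A k i j * V s \<omega> j)\<^sup>2 \<le> \<beta> * \<phi> s \<omega>" for k s \<omega>
        by (rule dom) (rule a[OF i])
    qed (fact sde[OF i] Y s gF gmono linc \<beta>0 \<phi>c g\<phi> Gh(1,2))+
    have Vm: "(\<lambda>\<omega>. if g R s \<omega> then ennreal ((V s \<omega> i)\<^sup>2) else 0) \<in> borel_measurable M" if "i \<in> J" for i
      using gM[OF s] adapted_measurable[OF Vad[OF that], of s] s by (intro measurable_If) auto
    have "u R s = (\<integral>\<^sup>+\<omega>. (\<Sum>i\<in>J. if g R s \<omega> then ennreal ((V s \<omega> i)\<^sup>2) else 0) \<partial>M)"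
      unfolding u_def \<phi>_def by (intro nn_integral_cong) (simp add: sum_ennreal)
    also have "\<dots> = (\<Sum>i\<in>J. \<integral>\<^sup>+\<omega>. (if g R s \<omega> then ennreal ((V s \<omega> i)\<^sup>2) else 0) \<partial>M)"
      by (rule nn_integral_sum[OF Vm])
    also have "\<dots> \<le> (\<Sum>i\<in>J. ennreal 3 * ((\<integral>\<^sup>+\<omega>. ennreal ((V 0 \<omega> i)\<^sup>2) \<partial>M) + ?c))"
      by (rule sum_mono[OF comp])
    also have "\<dots> = ennreal 3 * ((\<Sum>i\<in>J. \<integral>\<^sup>+\<omega>. ennreal ((V 0 \<omega> i)\<^sup>2) \<partial>M) + of_nat (card J) * ?c)"
      by (simp only: sum_distrib_left[symmetric] sum.distrib sum_constant, simp only: mult_ac)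
    also have "\<dots> \<le> ennreal 3 * (ennreal D + of_nat (card J) *
        (ennreal (\<beta> * (T + (real CARD('k))\<^sup>2 * (2 * C))) * ennreal (m * exp (l * s) / l)))"
      by (intro mult_left_mono add_mono X0 Gh(3)) simp_all
    also have "\<dots> = ennreal (3 * (D + ?N * (\<beta> * (T + (real CARD('k))\<^sup>2 * (2 * C)) * (m * exp (l * s) / l))))"
      unfolding ennreal_of_nat_eq_real_of_nat using \<beta>0 C T D0 m l0
      by (simp only: ennreal_plus ennreal_mult mult_nonneg_nonneg add_nonneg_nonneg of_nat_0_le_iff
          zero_le_numeral zero_le_power2 exp_ge_zero divide_nonneg_pos)
    also have "3 * (D + ?N * (\<beta> * (T + (real CARD('k))\<^sup>2 * (2 * C)) * (m * exp (l * s) / l)))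
        = 3 * D + \<kappa> / l * (m * exp (l * s))"
      unfolding \<kappa>_def \<beta>_def by (simp add: power2_eq_square algebra_simps add_divide_distrib)
    also have "\<dots> \<le> 3 * D * exp (l * s) + 1 / 2 * (m * exp (l * s))"
    proof (intro add_mono mult_right_mono)
      have "1 \<le> exp (l * s)" using l0 s by simp
      then show "3 * D \<le> 3 * D * exp (l * s)" using D0 mult_left_mono[of 1 "exp (l * s)" "3 * D"] by simp
      show "\<kappa> / l \<le> 1 / 2" unfolding l_def using \<kappa>0 by (simp add: field_simps)
    qed (use m in simp)
    also have "\<dots> = (3 * D + m / 2) * exp (l * s)" by (simp add: algebra_simps)
    finally show ?thesis by (simp add: ennreal_leI)
  qed

  \<comment> \<open>The iteration starts from the bound \<open>R\<close>, valid because \<phi> is at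
    most \<open>R\<close> on the event. The fixed point of the map from \<open>m\<close> to
    \<open>3 * D + m / 2\<close> is \<open>6 * D\<close>, and the distance to it is halved in each
    round; letting \<open>n\<close> tend to infinity removes \<open>R\<close>.\<close>
  have iter: "u R s \<le> ennreal ((6 * D + R / 2 ^ n) * exp (l * s))" if "0 \<le> R" "0 \<le> s" "s \<le> T" for R s n
    using that(2,3)
  proof (induction n arbitrary: s)
    case 0
    have "u R s \<le> (\<integral>\<^sup>+\<omega>. ennreal R \<partial>M)"
      unfolding u_def
      by (rule nn_integral_mono_AE, use g\<phi>[of R] in eventually_elim) (use 0 in \<open>auto intro: ennreal_leI\<close>)
    also have "\<dots> = ennreal R" by (simp add: emeasure_space_1)
    also have "R \<le> (6 * D + R / 2 ^ 0) * exp (l * s)"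
    proof -
      have "1 \<le> exp (l * s)" using l0 0 by simp
      then have "R * 1 \<le> (6 * D + R) * exp (l * s)" using D0 that(1) by (intro mult_mono) auto
      then show ?thesis by simp
    qed
    finally show ?case by (simp add: ennreal_leI)
  next
    case (Suc n)
    have "u R s \<le> ennreal ((3 * D + (6 * D + R / 2 ^ n) / 2) * exp (l * s))"
      using Suc.prems that(1) D0 by (intro step Suc.IH) auto
    also have "3 * D + (6 * D + R / 2 ^ n) / 2 = 6 * D + R / 2 ^ Suc n" by simp
    finally show ?case .
  qed
  have uT: "u R s \<le> ennreal (6 * D * exp (l * T))" if R: "0 \<le> R" and s: "0 \<le> s" "s \<le> T" for R s
  proof -
    have "(\<lambda>n. (6 * D + R * (1 / 2) ^ n) * exp (l * s)) \<longlonglongrightarrow> (6 * D + R * 0) * exp (l * s)"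
      by (intro tendsto_mult tendsto_add tendsto_const LIMSEQ_power_zero) simp
    then have "(\<lambda>n. ennreal ((6 * D + R / 2 ^ n) * exp (l * s))) \<longlonglongrightarrow> ennreal (6 * D * exp (l * s))"
      by (intro tendsto_ennrealI) (simp add: power_one_over)
    then have "u R s \<le> ennreal (6 * D * exp (l * s))"
      using iter[OF R s] by (intro LIMSEQ_le_const) auto
    also have "\<dots> \<le> ennreal (6 * D * exp (l * T))"
      using D0 s l0 by (intro ennreal_leI mult_left_mono) auto
    finally show ?thesis .
  qed

  have t0: "0 \<le> t" "t \<le> T" using t by auto
  have gm: "(\<lambda>\<omega>. if g (real n) t \<omega> then ennreal (\<phi> t \<omega>) else 0) \<in> borel_measurable M" for n
    using gM[OF t0] \<phi>m[OF t0] by (intro measurable_If) auto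
  \<comment> \<open>Each continuous path is bounded on \<open>[0,T]\<close>, so it eventually lies
    in the events with bound \<open>n\<close>. Fatou's lemma then transfers the uniform bound to the
    full second moment.\<close>
  have "AE \<omega> in M. ennreal (\<phi> t \<omega>) \<le> liminf (\<lambda>n. if g (real n) t \<omega> then ennreal (\<phi> t \<omega>) else 0)"
    using \<phi>c
  proof eventually_elim
    case (elim \<omega>)
    have "compact ((\<lambda>s. \<phi> s \<omega>) ` {0..T})" by (rule compact_continuous_image[OF elim]) simp
    then obtain B where B: "\<And>s. 0 \<le> s \<Longrightarrow> s \<le> T \<Longrightarrow> \<bar>\<phi> s \<omega>\<bar> \<le> B"
      using compact_imp_bounded bounded_real by (metis atLeastAtMost_iff imageI)
    have "eventually (\<lambda>n. g (real n) t \<omega>) sequentially"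
    proof -
      have "g (real n) t \<omega>" if "nat \<lceil>B\<rceil> \<le> n" for n
      proof -
        have "B \<le> real n" using that by linarith
        then show ?thesis unfolding g_def using B t0 by (smt (verit))
      qed
      then show ?thesis unfolding eventually_sequentially by blast
    qed
    then have "eventually (\<lambda>n. ennreal (\<phi> t \<omega>) \<le> (if g (real n) t \<omega> then ennreal (\<phi> t \<omega>) else 0)) sequentially"
      by eventually_elim simp
    then show ?case by (rule Liminf_bounded)
  qed
  then have "(\<integral>\<^sup>+\<omega>. ennreal (\<phi> t \<omega>) \<partial>M)
      \<le> (\<integral>\<^sup>+\<omega>. liminf (\<lambda>n. if g (real n) t \<omega> then ennreal (\<phi> t \<omega>) else 0) \<partial>M)"
    by (rule nn_integral_mono_AE)
  also have "\<dots> \<le> liminf (\<lambda>n. u (real n) t)" unfolding u_def by (rule nn_integral_liminf[OF gm])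
  also have "\<dots> \<le> liminf (\<lambda>n. ennreal (6 * D * exp (l * T)))"
    by (rule Liminf_mono) (simp add: uT t0)
  also have "\<dots> = ennreal (6 * exp (l * T) * D)" by (simp add: Liminf_const mult_ac)
  finally show ?thesis unfolding \<phi>_def l_def .
qed

section \<open>Perturbed schemes\<close>

text \<open>The pair is indexed by the disjoint sum of two copies of \<open>S\<close>, whence
  \<open>2 * card S\<close> in \<kappa>. Division of the defect by \<epsilon> is harmless because
  its entries are at most \<open>\<epsilon> * a\<close>, so one bound \<open>a\<close> holds for
  every block.\<close>

lemma (in filtered_space) perturbed_scheme_second_moment:
  fixes Y :: "'k::finite \<Rightarrow> real \<Rightarrow> 'a \<Rightarrow> real" and U Ut :: "real \<Rightarrow> 'a \<Rightarrow> 'i \<Rightarrow> real"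
  assumes S: "finite S" and T: "0 \<le> T" and \<epsilon>: "0 < \<epsilon>"
    and U: "\<And>i. i \<in> S \<Longrightarrow> has_stoch_diff M F T (\<lambda>t \<omega>. U t \<omega> i) (\<lambda>t \<omega>. mvec S L0 (U t \<omega>) i)
        (\<lambda>k t \<omega>. mvec S (L k) (U t \<omega>) i) Y"
    and Ut: "\<And>i. i \<in> S \<Longrightarrow> has_stoch_diff M F T (\<lambda>t \<omega>. Ut t \<omega> i) (\<lambda>t \<omega>. mvec S Lt0 (Ut t \<omega>) i)
        (\<lambda>k t \<omega>. mvec S (Lt k) (Ut t \<omega>) i) Y"
    and Y: "\<And>k. L2_integrator M F T (Y k) C"
    and bounds0: "\<And>i j. i \<in> S \<Longrightarrow> j \<in> S \<Longrightarrow> \<bar>L0 i j\<bar> \<le> a \<and> \<bar>Lt0 i j\<bar> \<le> a \<and> \<bar>L0 i j - Lt0 i j\<bar> \<le> \<epsilon> * a"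
    and bounds: "\<And>k i j. i \<in> S \<Longrightarrow> j \<in> S \<Longrightarrow> \<bar>L k i j\<bar> \<le> a \<and> \<bar>Lt k i j\<bar> \<le> a \<and> \<bar>L k i j - Lt k i j\<bar> \<le> \<epsilon> * a"
    and a: "0 \<le> a"
    and U0: "AE \<omega> in M. \<forall>i\<in>S. U 0 \<omega> i = U0 i"
    and init: "AE \<omega> in M. (\<Sum>i\<in>S. (U 0 \<omega> i - Ut 0 \<omega> i)\<^sup>2) \<le> \<epsilon>\<^sup>2 * (\<Sum>i\<in>S. (U 0 \<omega> i)\<^sup>2)"
    and t: "t \<in> {0..T}"
  defines "\<kappa> \<equiv> 3 * (2 * real (card S))\<^sup>2 * a\<^sup>2 * (T + (real CARD('k))\<^sup>2 * (2 * C))"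
  shows "(\<integral>\<^sup>+\<omega>. ennreal (\<Sum>i\<in>S. (U t \<omega> i - Ut t \<omega> i)\<^sup>2) \<partial>M)
    \<le> ennreal (6 * exp (2 * (\<kappa> + 1) * T) * (2 * \<epsilon>\<^sup>2 * (\<Sum>i\<in>S. (U0 i)\<^sup>2)))"
proof -
  let ?J = "S <+> S"
  define V where "V t \<omega> = case_sum (\<lambda>i. U t \<omega> i - Ut t \<omega> i) (\<lambda>i. \<epsilon> * U t \<omega> i)" for t \<omega>
  \<comment> \<open>Block upper triangular: \<open>Kt\<close> and the scaled defect in the upper
    row, 0 and \<open>K\<close> in the lower row.\<close>
  define P where "P K Kt = case_sum (\<lambda>i. case_sum (\<lambda>j. Kt i j) (\<lambda>j. (K i j - Kt i j) / \<epsilon>))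
      (\<lambda>i. case_sum (\<lambda>j. 0) (\<lambda>j. K i j))" for K Kt :: "'i \<Rightarrow> 'i \<Rightarrow> real"
  have P1: "(\<Sum>j\<in>?J. P K Kt (Inl i) j * V t \<omega> j) = 1 * mvec S K (U t \<omega>) i + (-1) * mvec S Kt (Ut t \<omega>) i" for K Kt i t \<omega>
  proof -
    have "(\<Sum>j\<in>?J. P K Kt (Inl i) j * V t \<omega> j)
        = (\<Sum>j\<in>S. Kt i j * (U t \<omega> j - Ut t \<omega> j) + (K i j - Kt i j) / \<epsilon> * (\<epsilon> * U t \<omega> j))"
      using S by (simp add: P_def V_def sum.Plus sum.distrib)
    also have "\<dots> = (\<Sum>j\<in>S. K i j * U t \<omega> j - Kt i j * Ut t \<omega> j)"
    proof (intro sum.cong refl)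
      fix j
      have "(K i j - Kt i j) / \<epsilon> * (\<epsilon> * U t \<omega> j) = (K i j - Kt i j) * U t \<omega> j" using \<epsilon> by simp
      then show "Kt i j * (U t \<omega> j - Ut t \<omega> j) + (K i j - Kt i j) / \<epsilon> * (\<epsilon> * U t \<omega> j)
          = K i j * U t \<omega> j - Kt i j * Ut t \<omega> j"
        by (simp only: left_diff_distrib right_diff_distrib)
    qed
    finally show ?thesis by (simp add: mvec_def sum_subtractf)
  qed
  \<comment> \<open>The zero summand puts the scaled copy of \<open>U\<close> into the two-term form
    of \<open>has_stoch_diff_lincomb\<close>.\<close>
  have P2: "(\<Sum>j\<in>?J. P K Kt (Inr i) j * V t \<omega> j) = \<epsilon> * mvec S K (U t \<omega>) i + 0 * mvec S K (U t \<omega>) i" for K Kt i t \<omega>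
    using S by (simp add: P_def V_def sum.Plus mvec_def sum_distrib_left algebra_simps)
  have Ya: "adapted_on F {0..T} (Y k)" for k using Y[of k] by (simp add: L2_integrator_def)
  have sde: "has_stoch_diff M F T (\<lambda>t \<omega>. V t \<omega> i) (\<lambda>t \<omega>. \<Sum>j\<in>?J. P L0 Lt0 i j * V t \<omega> j)
      (\<lambda>k t \<omega>. \<Sum>j\<in>?J. P (L k) (Lt k) i j * V t \<omega> j) Y" if i: "i \<in> ?J" for i
  proof (cases i)
    case (Inl i')
    then have i': "i' \<in> S" using i by auto
    have "(\<lambda>t \<omega>. V t \<omega> i) = (\<lambda>t \<omega>. 1 * U t \<omega> i' + (-1) * Ut t \<omega> i')" by (simp add: V_def Inl)
    then show ?thesis
      unfolding Inl P1 using has_stoch_diff_lincomb[OF U[OF i'] Ut[OF i'] Ya, of 1 "-1"] Inl by simp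
  next
    case (Inr i')
    then have i': "i' \<in> S" using i by auto
    have "(\<lambda>t \<omega>. V t \<omega> i) = (\<lambda>t \<omega>. \<epsilon> * U t \<omega> i' + 0 * U t \<omega> i')" by (simp add: V_def Inr)
    then show ?thesis
      unfolding Inr P2 using has_stoch_diff_lincomb[OF U[OF i'] U[OF i'] Ya, of \<epsilon> 0] Inr by simp
  qed
  have Pb: "\<bar>P K Kt i j\<bar> \<le> a"
    if K: "\<And>i j. i \<in> S \<Longrightarrow> j \<in> S \<Longrightarrow> \<bar>K i j\<bar> \<le> a \<and> \<bar>Kt i j\<bar> \<le> a \<and> \<bar>K i j - Kt i j\<bar> \<le> \<epsilon> * a"
      and ij: "i \<in> ?J" "j \<in> ?J" for K Kt i j
  proof -
    have "\<bar>(K i j - Kt i j) / \<epsilon>\<bar> \<le> a" if "i \<in> S" "j \<in> S" for i j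
      using K[OF that] \<epsilon> by (simp add: abs_divide pos_divide_le_eq mult.commute)
    then show ?thesis using K ij a unfolding P_def by (auto split: sum.split)
  qed
  \<comment> \<open>Half of this bounds the squared initial error, the other half is the squared
    initial value of \<open>\<epsilon> * U\<close>.\<close>
  let ?D = "2 * \<epsilon>\<^sup>2 * (\<Sum>i\<in>S. (U0 i)\<^sup>2)"
  have VV: "(\<Sum>i\<in>?J. (V t \<omega> i)\<^sup>2) = (\<Sum>i\<in>S. (U t \<omega> i - Ut t \<omega> i)\<^sup>2) + \<epsilon>\<^sup>2 * (\<Sum>i\<in>S. (U t \<omega> i)\<^sup>2)" for t \<omega>
    using S by (simp add: V_def sum.Plus power_mult_distrib sum_distrib_left)
  have D: "AE \<omega> in M. (\<Sum>i\<in>?J. (V 0 \<omega> i)\<^sup>2) \<le> ?D"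
    using U0 init
  proof eventually_elim
    case (elim \<omega>)
    have "(\<Sum>i\<in>S. (U 0 \<omega> i)\<^sup>2) = (\<Sum>i\<in>S. (U0 i)\<^sup>2)" using elim(1) by (intro sum.cong) auto
    then show ?case using elim(2) unfolding VV by simp
  qed
  have D0: "0 \<le> ?D" by (intro mult_nonneg_nonneg sum_nonneg) auto
  have "(\<integral>\<^sup>+\<omega>. ennreal (\<Sum>i\<in>S. (U t \<omega> i - Ut t \<omega> i)\<^sup>2) \<partial>M) \<le> (\<integral>\<^sup>+\<omega>. ennreal (\<Sum>i\<in>?J. (V t \<omega> i)\<^sup>2) \<partial>M)"
    unfolding VV by (intro nn_integral_mono ennreal_leI) (simp add: sum_nonneg)
  also have "\<dots> \<le> ennreal (6 * exp (2 * ((3 * (real (card ?J))\<^sup>2 * a\<^sup>2 * (T + (real CARD('k))\<^sup>2 * (2 * C))) + 1) * T) * ?D)"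
  proof (rule linear_sde_second_moment[OF _ T sde Y _ _ D D0 t])
    show "finite ?J" using S by simp
    show "\<bar>P L0 Lt0 i j\<bar> \<le> a" if "i \<in> ?J" "j \<in> ?J" for i j
      by (rule Pb[OF bounds0 that])
    show "\<bar>P (L k) (Lt k) i j\<bar> \<le> a" if "i \<in> ?J" "j \<in> ?J" for k i j
      by (rule Pb[OF bounds that])
  qed
  also have "real (card ?J) = 2 * real (card S)" using S by (simp add: card_Plus)
  finally show ?thesis unfolding \<kappa>_def .
qed

text \<open>Boundedness of \<open>h\<close> makes the drift of \<open>y\<close> Lipschitz in time
  with constant \<open>Ch\<close>, so \<open>L2_integrator_drift_brownian\<close> applies to every
  component. Continuity of \<open>h\<close> and of the signal paths gives the integrability needed
  to split the drift integral at an intermediate time.\<close>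

lemma signal_model_L2_integrator:
  fixes f h :: "real^'d \<Rightarrow> real^'d" and G :: "real^'d \<Rightarrow> real^'m^'d"
  assumes sm: "signal_model M F T f h G \<rho> v w x y" and sa: "standing_assumptions f h G \<rho>" and T: "0 \<le> T"
  shows "\<exists>C. \<forall>k. L2_integrator M F T (\<lambda>t \<omega>. y t \<omega> $ k) C"
proof -
  interpret filtered_space M F
    using sm by unfold_locales (simp add: signal_model_def)
  have W: "brownian_motion M F w" and ya: "adapted_on F {0..T} y"
    and y: "AE \<omega> in M. \<forall>t\<in>{0..T}.
        y t \<omega> = y 0 \<omega> + (LINT s:{0..t}|lborel. h (x s \<omega>)) + (w t \<omega> - w 0 \<omega>)"
    using sm by (auto simp: signal_model_def)
  have "AE \<omega> in M. continuous_on {0..T} (\<lambda>t. x t \<omega> $ i)" for i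
    using sm by (auto simp: signal_model_def has_stoch_diff_def)
  then have xi: "AE \<omega> in M. \<forall>i\<in>UNIV. continuous_on {0..T} (\<lambda>t. x t \<omega> $ i)"
    by (intro AE_finite_allI) auto
  obtain Ch where Ch: "\<And>x. norm (h x) < Ch" using sa by (auto simp: standing_assumptions_def)
  have Ch0: "0 \<le> Ch" using Ch[of 0] norm_ge_zero[of "h 0"] by linarith
  have "continuous_on UNIV (\<lambda>x. h x $ i)" for i
  proof -
    have "\<forall>x. (\<lambda>x. h x $ i) differentiable (at x)"
      using sa by (auto simp: standing_assumptions_def)
    then show ?thesis by (simp add: continuous_on_eq_continuous_at differentiable_imp_continuous_within)
  qed
  then have "continuous_on UNIV (\<lambda>x. \<chi> i. h x $ i)" by (rule continuous_on_vec_lambda)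
  then have hc: "continuous_on UNIV h" by simp
  have drift: "AE \<omega> in M. \<forall>s t. 0 \<le> s \<longrightarrow> s \<le> t \<longrightarrow> t \<le> T \<longrightarrow>
      \<bar>(y t \<omega> $ k - y s \<omega> $ k) - (w t \<omega> $ k - w s \<omega> $ k)\<bar> \<le> Ch * (t - s)" for k
    using y xi
  proof eventually_elim
    case (elim \<omega>)
    have "continuous_on {0..T} (\<lambda>t. \<chi> i. x t \<omega> $ i)" using elim(2) by (intro continuous_on_vec_lambda) auto
    then have xc: "continuous_on {0..T} (\<lambda>t. x t \<omega>)" by simp
    have "continuous_on {0..T} (\<lambda>s. h (x s \<omega>))"
      using continuous_on_compose2[OF hc xc] by simp
    then have int: "set_integrable lborel {0..T} (\<lambda>s. h (x s \<omega>))"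
      by (rule borel_integrable_atLeastAtMost')
    show ?case
    proof (intro allI impI)
      fix s t assume st: "0 \<le> s" "s \<le> t" "t \<le> T"
      let ?A = "\<lambda>t. LINT s:{0..t}|lborel. h (x s \<omega>)" and ?I = "LINT r:{s<..t}|lborel. h (x r \<omega>)"
      have i1: "set_integrable lborel {0..s} (\<lambda>s. h (x s \<omega>))"
        and i2: "set_integrable lborel {s<..t} (\<lambda>s. h (x s \<omega>))"
        by (rule set_integrable_subset[OF int], use st in auto)+
      have "{0..t} = {0..s} \<union> {s<..t}" using st by auto
      then have "?A t = (LINT s:{0..s} \<union> {s<..t}|lborel. h (x s \<omega>))" by (simp only:)
      also have "\<dots> = ?A s + ?I" by (rule set_integral_Un[OF _ i1 i2]) auto
      finally have A: "?A t = ?A s + ?I" .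
      have "norm ?I \<le> (LINT r:{s<..t}|lborel. norm (h (x r \<omega>)))" by (rule set_integral_norm_bound[OF i2])
      also have "\<dots> \<le> (LINT r:{s<..t}|lborel. Ch)"
      proof (rule set_integral_mono[OF set_integrable_norm[OF i2]])
        have "set_integrable lborel {s..t} (\<lambda>_. Ch)"
          by (rule borel_integrable_atLeastAtMost') (rule continuous_on_const)
        then show "set_integrable lborel {s<..t} (\<lambda>_. Ch)"
          by (rule set_integrable_subset) auto
      qed (use Ch in \<open>simp add: less_imp_le\<close>)
      also have "\<dots> = Ch * (t - s)" using st by (simp add: set_lebesgue_integral_def)
      finally have "\<bar>?I $ k\<bar> \<le> Ch * (t - s)" using component_le_norm_cart[of ?I k] by linarith
      moreover have "(y t \<omega> $ k - y s \<omega> $ k) - (w t \<omega> $ k - w s \<omega> $ k) = ?I $ k"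
      proof -
        have "y t \<omega> = y 0 \<omega> + ?A t + (w t \<omega> - w 0 \<omega>)" "y s \<omega> = y 0 \<omega> + ?A s + (w s \<omega> - w 0 \<omega>)"
          by (rule elim(1)[rule_format], use st in simp)+
        then have "(y t \<omega> - y s \<omega>) - (w t \<omega> - w s \<omega>) = ?I" unfolding A by simp
        then have "((y t \<omega> - y s \<omega>) - (w t \<omega> - w s \<omega>)) $ k = ?I $ k" by (rule arg_cong)
        then show ?thesis by simp
      qed
      ultimately show "\<bar>(y t \<omega> $ k - y s \<omega> $ k) - (w t \<omega> $ k - w s \<omega> $ k)\<bar> \<le> Ch * (t - s)" by simp
    qed
  qed
  have "adapted_on F {0..T} (\<lambda>t \<omega>. y t \<omega> $ k)" for k
    using ya unfolding adapted_on_def by (blast intro: borel_measurable_vec_component)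
  from L2_integrator_drift_brownian[OF W this Ch0 T drift] show ?thesis by blast
qed

section \<open>Entrywise bounds on the grid and the final estimate\<close>

lemma finite_grid: "finite (grid N :: ('d::finite \<Rightarrow> nat) set)"
proof -
  have "grid N = (PiE UNIV (\<lambda>_. {1..N}) :: ('d \<Rightarrow> nat) set)"
    by (auto simp: grid_def PiE_UNIV_domain)
  then show ?thesis by (simp add: finite_PiE)
qed

lemma entry_le_frob_mat:
  fixes A :: "('d::finite \<Rightarrow> nat) fmat"
  assumes "i \<in> grid N" "j \<in> grid N" shows "\<bar>A i j\<bar> \<le> frob_mat N A"
proof -
  have "(A i j)\<^sup>2 \<le> (\<Sum>j\<in>grid N. (A i j)\<^sup>2)"
    using assms finite_grid by (intro member_le_sum[where f="\<lambda>j. (A i j)\<^sup>2"]) auto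
  also have "\<dots> \<le> (\<Sum>i\<in>grid N. \<Sum>j\<in>grid N. (A i j)\<^sup>2)"
    using assms finite_grid by (intro member_le_sum[where f="\<lambda>i. \<Sum>j\<in>grid N. (A i j)\<^sup>2"]) (auto intro: sum_nonneg)
  finally show ?thesis unfolding frob_mat_def using real_le_rsqrt[of "\<bar>A i j\<bar>"] by simp
qed

lemma frob_mat_nonneg: "0 \<le> frob_mat N A"
  unfolding frob_mat_def by (intro real_sqrt_ge_zero sum_nonneg) auto

text \<open>The entries are at most \<open>B\<close> for \<open>K\<close>,
  \<open>\<epsilon> * (B * Q)\<close> for the difference, and therefore
  \<open>B + e0 * (B * Q)\<close> for \<open>Kt\<close>. The common constant covers all three, and
  the cap \<open>e0\<close> makes it independent of \<epsilon>.\<close>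

lemma perturbed_entry_bounds:
  fixes K Kt :: "('d::finite \<Rightarrow> nat) fmat"
  assumes \<epsilon>: "0 < \<epsilon>" "\<epsilon> \<le> e0" and q: "0 \<le> q" "q \<le> Q" and B: "frob_mat N K \<le> B"
    and d: "frob_mat N (\<lambda>i j. Kt i j - K i j) \<le> \<epsilon> * q * frob_mat N K"
    and ij: "i \<in> grid N" "j \<in> grid N"
  shows "\<bar>K i j\<bar> \<le> B * (1 + Q + e0 * Q) \<and> \<bar>Kt i j\<bar> \<le> B * (1 + Q + e0 * Q) \<and>
    \<bar>K i j - Kt i j\<bar> \<le> \<epsilon> * (B * (1 + Q + e0 * Q))"
proof -
  have B0: "0 \<le> B" and Q0: "0 \<le> Q" and e0: "0 < e0"
    using B frob_mat_nonneg[of N K] q \<epsilon> by linarith+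
  have K: "\<bar>K i j\<bar> \<le> B" using entry_le_frob_mat[OF ij, of K] B by linarith
  have "\<bar>Kt i j - K i j\<bar> \<le> \<epsilon> * q * frob_mat N K"
    using entry_le_frob_mat[OF ij, of "\<lambda>i j. Kt i j - K i j"] d by linarith
  also have "\<dots> \<le> \<epsilon> * Q * B"
    using \<epsilon> q B B0 Q0 by (intro mult_mono frob_mat_nonneg) auto
  finally have d1: "\<bar>Kt i j - K i j\<bar> \<le> \<epsilon> * (B * Q)" by (simp add: mult_ac)
  also have "\<dots> \<le> e0 * (B * Q)" using \<epsilon> B0 Q0 by (intro mult_right_mono) auto
  finally have d2: "\<bar>Kt i j - K i j\<bar> \<le> e0 * (B * Q)" .
  have nn: "0 \<le> B * Q" "0 \<le> e0 * (B * Q)" using B0 Q0 e0 by auto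
  have eq: "B * (1 + Q + e0 * Q) = B + B * Q + e0 * (B * Q)" by (simp add: algebra_simps)
  have "\<epsilon> * (B * Q) \<le> \<epsilon> * (B * (1 + Q + e0 * Q))"
    unfolding eq using \<epsilon> B0 nn by (intro mult_left_mono) auto
  then show ?thesis using K d1 d2 nn unfolding eq by (simp add: abs_minus_commute)
qed

lemma grid_norm_square:
  fixes u :: "('d::finite \<Rightarrow> nat) \<Rightarrow> real"
  assumes "0 < mesh L N"
  shows "(grid_norm L N u)\<^sup>2 = mesh L N ^ CARD('d) * (\<Sum>i\<in>grid N. (u i)\<^sup>2)"
  unfolding grid_norm_def using assms
  by (intro real_sqrt_pow2 mult_nonneg_nonneg sum_nonneg) auto

text \<open>\<open>eps0\<close> is an arbitrary cap on the accuracy; it allows the entries of all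
  admissible \<open>Lt\<close> to be bounded before \<epsilon> is chosen. Integrability is stated
  along with the estimate because the expectation of a non-integrable function is 0 by
  convention.\<close>

theorem theorem4p5:
  fixes M :: "'a measure" and F :: "real \<Rightarrow> 'a measure"
    and f h :: "real^'d \<Rightarrow> real^'d"
    and G :: "real^'d \<Rightarrow> real^'m^'d" and \<rho> :: "real^'d \<Rightarrow> real^'d^'d"
    and v :: "real \<Rightarrow> 'a \<Rightarrow> real^'m" and w x y :: "real \<Rightarrow> 'a \<Rightarrow> real^'d"
    and u0 :: "real^'d \<Rightarrow> real" and u :: "real \<Rightarrow> 'a \<Rightarrow> real^'d \<Rightarrow> real"
    and T L h0 eps0 :: real and N :: nat
  assumes "0 \<le> T"
    and "signal_model M F T f h G \<rho> v w x y"
    and "standing_assumptions f h G \<rho>"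
    and "0 < L" and "1 \<le> N"
    and "h0_condition L \<rho> h0"
    and "0 < mesh L N" and "mesh L N < h0"
    and "\<forall>n. Ck_on n UNIV u0"
    and "DMZ_strong_solution M F T f h G \<rho> y u0 u"
    and "AE \<omega> in M. \<exists>B. \<forall>t\<in>{0..T}.
           Ck_on 4 (cbox (\<chi> k. - L) (\<chi> k. L)) (u t \<omega>) \<and>
           derivs_bounded 4 (cbox (\<chi> k. - L) (\<chi> k. L)) B (u t \<omega>)"
    and "0 < eps0"
  shows "\<exists>K0TT>0. \<exists>K1TT>0.
    \<forall>(\<epsilon>::real) (U0 :: ('d \<Rightarrow> nat) \<Rightarrow> real) (U :: real \<Rightarrow> 'a \<Rightarrow> ('d \<Rightarrow> nat) \<Rightarrow> real)
     (Lt0 :: ('d \<Rightarrow> nat) fmat) (Lt :: 'd \<Rightarrow> ('d \<Rightarrow> nat) fmat)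
     (Ut :: real \<Rightarrow> 'a \<Rightarrow> ('d \<Rightarrow> nat) \<Rightarrow> real).
      0 < \<epsilon> \<and> \<epsilon> \<le> eps0 \<and>
      semi_discrete_solution M F T N (disc_L0 L N f G \<rho>) (disc_L L N h \<rho>) y U \<and>
      (AE \<omega> in M. \<forall>i\<in>grid N. U 0 \<omega> i = U0 i) \<and>
      semi_discrete_solution M F T N Lt0 Lt y Ut \<and>
      (AE \<omega> in M. frob_vec N (\<lambda>i. Ut 0 \<omega> i - U 0 \<omega> i) \<le> \<epsilon> * frob_vec N (U 0 \<omega>)) \<and>
      frob_mat N (\<lambda>i j. Lt0 i j - disc_L0 L N f G \<rho> i j)
        \<le> \<epsilon> * mesh L N powr (real CARD('d) / 2 + 2) * frob_mat N (disc_L0 L N f G \<rho>) \<and>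
      (\<forall>k. frob_mat N (\<lambda>i j. Lt k i j - disc_L L N h \<rho> k i j)
        \<le> \<epsilon> * mesh L N powr (real CARD('d) / 2 + 1) * frob_mat N (disc_L L N h \<rho> k))
      \<longrightarrow>
      (\<forall>t\<in>{0..T}.
         integrable M (\<lambda>\<omega>. (grid_norm L N (\<lambda>i. U t \<omega> i - Ut t \<omega> i))\<^sup>2) \<and>
         prob_space.expectation M (\<lambda>\<omega>. (grid_norm L N (\<lambda>i. U t \<omega> i - Ut t \<omega> i))\<^sup>2)
         \<le> exp (K0TT * t) *
            (\<epsilon>\<^sup>2 * K1TT * (grid_norm L N U0)\<^sup>2 +
             prob_space.expectation M (\<lambda>\<omega>. (grid_norm L N (\<lambda>i. U 0 \<omega> i - Ut 0 \<omega> i))\<^sup>2)))"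
proof -
  interpret filtered_space M F
    using assms(2) by unfold_locales (simp add: signal_model_def)
  obtain C where Y: "\<And>k. L2_integrator M F T (\<lambda>t \<omega>. y t \<omega> $ k) C"
    using signal_model_L2_integrator[OF assms(2,3,1)] by blast
  have C0: "0 \<le> C" using Y by (auto simp: L2_integrator_def)
  have m0: "0 < mesh L N" by fact
  let ?G = "grid N :: ('d \<Rightarrow> nat) set"
  let ?LA = "disc_L0 L N f G \<rho>" and ?LB = "disc_L L N h \<rho>"
  define B where "B = frob_mat N ?LA + (\<Sum>k\<in>UNIV. frob_mat N (?LB k))"
  define p0 where "p0 = mesh L N powr (real CARD('d) / 2 + 2)"
  define p1 where "p1 = mesh L N powr (real CARD('d) / 2 + 1)"
  define Q where "Q = p0 + p1"
  define a where "a = B * (1 + Q + eps0 * Q)"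
  define \<kappa> where "\<kappa> = 3 * (2 * real (card ?G))\<^sup>2 * a\<^sup>2 * (T + (real CARD('d))\<^sup>2 * (2 * C))"
  define c where "c = 6 * exp (2 * (\<kappa> + 1) * T)"
  have p: "0 \<le> p0" "p0 \<le> Q" "0 \<le> p1" "p1 \<le> Q" "0 \<le> Q" by (auto simp: p0_def p1_def Q_def)
  have B0: "frob_mat N ?LA \<le> B" unfolding B_def by (simp add: sum_nonneg frob_mat_nonneg)
  have Bk: "frob_mat N (?LB k) \<le> B" for k
  proof -
    have "frob_mat N (?LB k) \<le> (\<Sum>k\<in>UNIV. frob_mat N (?LB k))"
      by (rule member_le_sum) (simp_all add: frob_mat_nonneg)
    then show ?thesis using frob_mat_nonneg[of N ?LA] unfolding B_def by linarith
  qed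
  have a0: "0 \<le> a" unfolding a_def using p order_trans[OF frob_mat_nonneg B0] assms(12)
    by (intro mult_nonneg_nonneg add_nonneg_nonneg) auto
  have c0: "0 < c" by (simp add: c_def)
  show ?thesis
  \<comment> \<open>The growth up to time \<open>T\<close> is contained in \<open>c\<close>, so any
    positive \<open>K0TT\<close> serves and 1 is taken. The factor 2 in \<open>2 * c\<close> counts
    the two components of the pair at time 0.\<close>
  proof (rule exI[of _ 1], rule conjI, simp, rule exI[of _ "2 * c"], intro conjI allI impI ballI)
    show "0 < 2 * c" using c0 by simp
  next
    fix \<epsilon> :: real and U0 :: "('d \<Rightarrow> nat) \<Rightarrow> real" and U Ut :: "real \<Rightarrow> 'a \<Rightarrow> ('d \<Rightarrow> nat) \<Rightarrow> real"
      and Lt0 :: "('d \<Rightarrow> nat) fmat" and Lt :: "'d \<Rightarrow> ('d \<Rightarrow> nat) fmat" and t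
    assume H: "0 < \<epsilon> \<and> \<epsilon> \<le> eps0 \<and>
      semi_discrete_solution M F T N ?LA ?LB y U \<and>
      (AE \<omega> in M. \<forall>i\<in>grid N. U 0 \<omega> i = U0 i) \<and>
      semi_discrete_solution M F T N Lt0 Lt y Ut \<and>
      (AE \<omega> in M. frob_vec N (\<lambda>i. Ut 0 \<omega> i - U 0 \<omega> i) \<le> \<epsilon> * frob_vec N (U 0 \<omega>)) \<and>
      frob_mat N (\<lambda>i j. Lt0 i j - ?LA i j)
        \<le> \<epsilon> * mesh L N powr (real CARD('d) / 2 + 2) * frob_mat N ?LA \<and>
      (\<forall>k. frob_mat N (\<lambda>i j. Lt k i j - ?LB k i j)
        \<le> \<epsilon> * mesh L N powr (real CARD('d) / 2 + 1) * frob_mat N (?LB k))"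
      and t: "t \<in> {0..T}"
    have \<epsilon>: "0 < \<epsilon>" "\<epsilon> \<le> eps0" using H by auto
    have U: "has_stoch_diff M F T (\<lambda>t \<omega>. U t \<omega> i) (\<lambda>t \<omega>. mvec ?G ?LA (U t \<omega>) i)
        (\<lambda>k t \<omega>. mvec ?G (?LB k) (U t \<omega>) i) (\<lambda>k t \<omega>. y t \<omega> $ k)"
      and Ut: "has_stoch_diff M F T (\<lambda>t \<omega>. Ut t \<omega> i) (\<lambda>t \<omega>. mvec ?G Lt0 (Ut t \<omega>) i)
        (\<lambda>k t \<omega>. mvec ?G (Lt k) (Ut t \<omega>) i) (\<lambda>k t \<omega>. y t \<omega> $ k)" if "i \<in> ?G" for i
      using H that unfolding semi_discrete_solution_def by blast+
    have U0: "AE \<omega> in M. \<forall>i\<in>?G. U 0 \<omega> i = U0 i"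
      and fv: "AE \<omega> in M. frob_vec N (\<lambda>i. Ut 0 \<omega> i - U 0 \<omega> i) \<le> \<epsilon> * frob_vec N (U 0 \<omega>)"
      using H by blast+
    have init: "AE \<omega> in M. (\<Sum>i\<in>?G. (U 0 \<omega> i - Ut 0 \<omega> i)\<^sup>2) \<le> \<epsilon>\<^sup>2 * (\<Sum>i\<in>?G. (U 0 \<omega> i)\<^sup>2)"
      using fv
    proof eventually_elim
      case (elim \<omega>)
      have "(frob_vec N (\<lambda>i. Ut 0 \<omega> i - U 0 \<omega> i))\<^sup>2 \<le> (\<epsilon> * frob_vec N (U 0 \<omega>))\<^sup>2"
        by (rule power_mono[OF elim]) (simp add: frob_vec_def sum_nonneg)
      then show ?case
        by (simp add: frob_vec_def power_mult_distrib sum_nonneg power2_commute)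
    qed
    let ?E = "\<lambda>s \<omega>. \<Sum>i\<in>?G. (U s \<omega> i - Ut s \<omega> i)\<^sup>2"
    let ?R = "c * (2 * \<epsilon>\<^sup>2 * (\<Sum>i\<in>?G. (U0 i)\<^sup>2))"
    have mom: "(\<integral>\<^sup>+\<omega>. ennreal (?E t \<omega>) \<partial>M) \<le> ennreal ?R"
      unfolding c_def \<kappa>_def
    proof (rule perturbed_scheme_second_moment[OF finite_grid assms(1) \<epsilon>(1) U Ut Y _ _ a0 U0 init t])
      show "\<bar>?LA i j\<bar> \<le> a \<and> \<bar>Lt0 i j\<bar> \<le> a \<and> \<bar>?LA i j - Lt0 i j\<bar> \<le> \<epsilon> * a"
        if "i \<in> ?G" "j \<in> ?G" for i j
        unfolding a_def using H
        by (intro perturbed_entry_bounds[OF \<epsilon> p(1,2) B0 _ that]) (auto simp: p0_def)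
      show "\<bar>?LB k i j\<bar> \<le> a \<and> \<bar>Lt k i j\<bar> \<le> a \<and> \<bar>?LB k i j - Lt k i j\<bar> \<le> \<epsilon> * a"
        if "i \<in> ?G" "j \<in> ?G" for k i j
        unfolding a_def using H
        by (intro perturbed_entry_bounds[OF \<epsilon> p(3,4) Bk _ that]) (auto simp: p1_def)
    qed
    have Em: "?E t \<in> borel_measurable M"
    proof -
      have "adapted_on F {0..T} (\<lambda>t \<omega>. U t \<omega> i)" "adapted_on F {0..T} (\<lambda>t \<omega>. Ut t \<omega> i)" if "i \<in> ?G" for i
        using U[OF that] Ut[OF that] by (simp_all add: has_stoch_diff_def)
      then show ?thesis
        by (intro borel_measurable_sum borel_measurable_power borel_measurable_diff)
           (use adapted_measurable[OF _ t] in blast)+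
    qed
    have E0: "0 \<le> ?E s \<omega>" for s \<omega> by (intro sum_nonneg) simp
    have R0: "0 \<le> ?R" using c0 by (intro mult_nonneg_nonneg sum_nonneg) auto
    have Ei: "integrable M (?E t)"
      by (rule integrableI_nonneg[OF Em]) (use E0 mom in \<open>auto intro: le_less_trans\<close>)
    have Eb: "expectation (?E t) \<le> ?R" by (rule integral_real_bounded[OF R0 mom])
    let ?g = "\<lambda>s \<omega>. (grid_norm L N (\<lambda>i. U s \<omega> i - Ut s \<omega> i))\<^sup>2"
    show "integrable M (?g t)" unfolding grid_norm_square[OF m0] using Ei by simp
    have "expectation (?g t) = mesh L N ^ CARD('d) * expectation (?E t)"
      unfolding grid_norm_square[OF m0] by simp
    also have "\<dots> \<le> mesh L N ^ CARD('d) * ?R" using m0 Eb by (intro mult_left_mono) auto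
    also have "\<dots> = \<epsilon>\<^sup>2 * (2 * c) * (grid_norm L N U0)\<^sup>2" unfolding grid_norm_square[OF m0] by (simp add: mult_ac)
    \<comment> \<open>Weakening to the required form: the exponential is at least 1 and the mean
      squared initial error is nonnegative.\<close>
    also have "\<dots> \<le> exp (1 * t) * (\<epsilon>\<^sup>2 * (2 * c) * (grid_norm L N U0)\<^sup>2 + expectation (?g 0))"
    proof -
      let ?b = "\<epsilon>\<^sup>2 * (2 * c) * (grid_norm L N U0)\<^sup>2"
      have b: "0 \<le> ?b" "0 \<le> expectation (?g 0)" using c0 by auto
      have "1 * ?b \<le> exp (1 * t) * (?b + expectation (?g 0))"
        using b t by (intro mult_mono) auto
      then show ?thesis by simp
    qed
    finally show "expectation (?g t) \<le> exp (1 * t) * (\<epsilon>\<^sup>2 * (2 * c) * (grid_norm L N U0)\<^sup>2 + expectation (?g 0))" .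
  qed
qed

end
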